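(* Let $m\ge1$ be an integer and let $J$ be a graded ideal of superdimension $(k\mid k+1)$ of the Heisenberg Lie superalgebra $H_m$. Then: (1) if $k=1$ and $m=1$, then $\dim\mathcal{M}(H_1,J)$ is $1$ or $2$; (2) if $k=0$, then $\dim\mathcal{M}(H_m,J)=2m$; (3) if $k\geq 1$, then $$\dim\mathcal{M}(H_m,J)=\Big(\tfrac12 k\big[(2m-k-1)+(2m-k+1)\big]\ \Big|\ m^2-(m-k)^2-1\Big).$$ In (1) and (2) $\dim$ is the total dimension; in (3) it is the superdimension (even dimension $\mid$ odd dimension).
   Context: All Lie superalgebras are over a field $\mathbb{F}$ of characteristic different from $2,3$. $H_m$ is the Heisenberg Lie superalgebra with odd center, of superdimension $(m\mid m+1)$: its even part has basis $x_1,\dots,x_m$, its odd part has basis $y_1,\dots,y_m,z$, and its only nonzero brackets of basis elements (up to graded skew-symmetry) are $[x_j,y_j]=z$ $(1\le j\le m)$. Superdimension $(p\mid q)$ means even part of dimension $p$ and odd part of dimension $q$. For a Lie superalgebra $L$ with graded ideal $I$, the Schur multiplier of the pair $(L,I)$ is the abelian Lie superalgebra $\mathcal{M}(L,I)$ appearing in the exact sequence $$\mathcal{H}_3(L)\to\mathcal{H}_3(L/I)\to\mathcal{M}(L,I)\to\mathcal{M}(L)\to\mathcal{M}(L/I)\to I/[L,I]\to L/L^2\to L/(L^2+I)\to 0,$$ where $\mathcal{H}_3$ is the third homology, $\mathcal{M}(L)$ is the Schur multiplier of $L$ and $L^2=[L,L]$. The paper identifies it as follows: if $0\to R\to F\to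 L\to 0$ is a free presentation ($F$ a free Lie superalgebra) and $I\cong S/R$ for a graded ideal $S$ of $F$, then $\mathcal{M}(L,I)\cong (R\cap[F,S])/[F,R]$.
   Formalization: Part (3) is proved for all k ≥ 1 except k = m = 1, where it is false: M(H_1,H_1) has superdimension (1|1), not (1|0); that pair is covered by (1) only. M(L,I) is taken from the exact sequence, not from the quotient (R∩[F,S])/[F,R]. *)

theory Defs
  imports
    "Jordan_Normal_Form.VS_Connect"
    "HOL-Algebra.AbelCoset"
    "HOL-Library.Poly_Mapping"
    "HOL-Library.Z2"
begin

section \<open>Super vector spaces\<close>

text \<open>Vector spaces are carrier-based, over the record \<open>class_ring\<close> of a field given as a type.
  The fields \<open>mult\<close> and \<open>one\<close>, which a module record inherits from the ring record, are unused.
  Parities are elements of \<^typ>\<open>bit\<close>, so that they add and multiply as in Z/2.\<close>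

record ('f, 'v) graded_space = "('f, 'v) module" +
  part :: "bit \<Rightarrow> 'v set"

locale super_vectorspace = vectorspace "class_ring :: 'f::field ring" V
  for V :: "('f::field, 'v, 'z) graded_space_scheme" (structure) +
  assumes part_subspace: "subspace class_ring (part V a) V"
    and part_inter: "part V 0 \<inter> part V 1 = {\<zero>}"
    and part_sum: "part V 0 <+>\<^bsub>V\<^esub> part V 1 = carrier V"

definition sub_space ::
  "('f, 'v, 'z) graded_space_scheme \<Rightarrow> 'v set \<Rightarrow> ('f, 'v, 'z) graded_space_scheme" where
  "sub_space V W = V\<lparr>carrier := W, part := (\<lambda>a. part V a \<inter> W)\<rparr>"

definition quot_space ::
  "('f, 'v, 'z) graded_space_scheme \<Rightarrow> 'v set \<Rightarrow> ('f, 'v set) graded_space" where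
  "quot_space V W =
    \<lparr>carrier = a_rcosets\<^bsub>V\<^esub> W, mult = undefined, one = undefined,
     zero = W, add = set_add V,
     smult = (\<lambda>c A. \<Union>x\<in>A. W +>\<^bsub>V\<^esub> (c \<odot>\<^bsub>V\<^esub> x)),
     part = (\<lambda>a. (\<lambda>x. W +>\<^bsub>V\<^esub> x) ` part V a)\<rparr>"

text \<open>The map of quotients, with target V/W, induced by a map f of representatives.\<close>

definition coset_map ::
  "('f, 'v, 'z) graded_space_scheme \<Rightarrow> 'v set \<Rightarrow> ('u \<Rightarrow> 'v) \<Rightarrow> 'u set \<Rightarrow> 'v set" where
  "coset_map V W f A = (\<Union>x\<in>A. W +>\<^bsub>V\<^esub> f x)"

definition even_linear ::
  "('f::field, 'u, 'y) graded_space_scheme \<Rightarrow> ('f, 'v, 'z) graded_space_scheme \<Rightarrow> ('u \<Rightarrow> 'v) \<Rightarrow> bool" where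
  "even_linear U V f \<longleftrightarrow>
    linear_map class_ring U V f \<and> (\<forall>a. f ` part U a \<subseteq> part V a)"

definition exact_at ::
  "('f, 'u, 'x) graded_space_scheme \<Rightarrow> ('u \<Rightarrow> 'v) \<Rightarrow> ('f, 'v, 'y) graded_space_scheme \<Rightarrow>
   ('v \<Rightarrow> 'w) \<Rightarrow> ('f, 'w, 'z) graded_space_scheme \<Rightarrow> bool" where
  "exact_at U f V g W \<longleftrightarrow> f ` carrier U = {v \<in> carrier V. g v = \<zero>\<^bsub>W\<^esub>}"

definition part_dim :: "('f::field, 'v, 'z) graded_space_scheme \<Rightarrow> bit \<Rightarrow> nat" where
  "part_dim V a = vectorspace.dim class_ring (V\<lparr>carrier := part V a\<rparr>)"

definition total_dim :: "('f::field, 'v, 'z) graded_space_scheme \<Rightarrow> nat" where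
  "total_dim V = vectorspace.dim class_ring V"

definition finite_dim :: "('f::field, 'v, 'z) graded_space_scheme \<Rightarrow> bool" where
  "finite_dim V \<longleftrightarrow> vectorspace.fin_dim class_ring V"

section \<open>Lie superalgebras\<close>

definition psign :: "bit \<Rightarrow> 'f::field" where
  "psign a = (if a = 0 then 1 else - 1)"

record ('f, 'v) lie_superalg = "('f, 'v) graded_space" +
  lbrak :: "'v \<Rightarrow> 'v \<Rightarrow> 'v"

text \<open>These axioms are the right ones only in characteristic different from 2 and 3:
  otherwise [x,x] = 0 for x even and [y,[y,y]] = 0 for y odd have to be required as well.\<close>

locale lie_superalgebra = super_vectorspace L
  for L :: "('f::field, 'v, 'z) lie_superalg_scheme" (structure) +
  assumes lbrak_part: "\<lbrakk>x \<in> part L a; y \<in> part L b\<rbrakk> \<Longrightarrow> lbrak L x y \<in> part L (a + b)"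
    and lbrak_add_left: "\<lbrakk>x \<in> carrier L; y \<in> carrier L; z \<in> carrier L\<rbrakk> \<Longrightarrow>
          lbrak L (x \<oplus> y) z = lbrak L x z \<oplus> lbrak L y z"
    and lbrak_add_right: "\<lbrakk>x \<in> carrier L; y \<in> carrier L; z \<in> carrier L\<rbrakk> \<Longrightarrow>
          lbrak L x (y \<oplus> z) = lbrak L x y \<oplus> lbrak L x z"
    and lbrak_smult_left: "\<lbrakk>x \<in> carrier L; y \<in> carrier L\<rbrakk> \<Longrightarrow>
          lbrak L (r \<odot> x) y = r \<odot> lbrak L x y"
    and lbrak_smult_right: "\<lbrakk>x \<in> carrier L; y \<in> carrier L\<rbrakk> \<Longrightarrow>
          lbrak L x (r \<odot> y) = r \<odot> lbrak L x y"
    and lbrak_skew: "\<lbrakk>x \<in> part L a; y \<in> part L b\<rbrakk> \<Longrightarrow>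
          lbrak L x y = (- psign (a * b)) \<odot> lbrak L y x"
    and jacobi: "\<lbrakk>x \<in> part L a; y \<in> part L b; z \<in> part L c\<rbrakk> \<Longrightarrow>
          lbrak L x (lbrak L y z) =
            lbrak L (lbrak L x y) z \<oplus> psign (a * b) \<odot> lbrak L y (lbrak L x z)"

definition abelian_lie :: "('f::field, 'v, 'z) lie_superalg_scheme \<Rightarrow> bool" where
  "abelian_lie L \<longleftrightarrow> (\<forall>x\<in>carrier L. \<forall>y\<in>carrier L. lbrak L x y = \<zero>\<^bsub>L\<^esub>)"

definition graded_ideal :: "('f::field, 'v, 'z) lie_superalg_scheme \<Rightarrow> 'v set \<Rightarrow> bool" where
  "graded_ideal L I \<longleftrightarrow>
    subspace class_ring I L \<and>
    I = (I \<inter> part L 0) <+>\<^bsub>L\<^esub> (I \<inter> part L 1) \<and>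
    (\<forall>x\<in>carrier L. \<forall>y\<in>I. lbrak L x y \<in> I)"

definition brak_span ::
  "('f::field, 'v, 'z) lie_superalg_scheme \<Rightarrow> 'v set \<Rightarrow> 'v set \<Rightarrow> 'v set" where
  "brak_span L A B =
    LinearCombinations.module.span class_ring L {lbrak L x y |x y. x \<in> A \<and> y \<in> B}"

abbreviation derived :: "('f::field, 'v, 'z) lie_superalg_scheme \<Rightarrow> 'v set" where
  "derived L \<equiv> brak_span L (carrier L) (carrier L)"

definition quot_lie ::
  "('f, 'v, 'z) lie_superalg_scheme \<Rightarrow> 'v set \<Rightarrow> ('f, 'v set) lie_superalg" where
  "quot_lie L I = graded_space.extend (quot_space L I)
    (lie_superalg.fields (\<lambda>A B. \<Union>x\<in>A. \<Union>y\<in>B. I +>\<^bsub>L\<^esub> lbrak L x y))"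

section \<open>Homology with trivial coefficients\<close>

text \<open>Homology is computed from the Chevalley--Eilenberg complex. The n-th super exterior power
  of L is presented as the free vector space on words of length n in homogeneous elements,
  modulo multilinearity and super skew-symmetry. A letter is a pair (a, x) with x in the part
  of parity a; recording a makes the parity of a word well-defined even if some x is 0.\<close>

type_synonym ('f, 'v) chain = "(bit \<times> 'v) list \<Rightarrow>\<^sub>0 'f"

definition words :: "('f, 'v, 'z) graded_space_scheme \<Rightarrow> nat \<Rightarrow> (bit \<times> 'v) list set" where
  "words L n = {w. length w = n \<and> (\<forall>(a, x)\<in>set w. x \<in> part L a)}"

abbreviation gen :: "(bit \<times> 'v) list \<Rightarrow> ('f::field, 'v) chain" where
  "gen w \<equiv> Poly_Mapping.single w 1"

definition cscale :: "'f::field \<Rightarrow> ('f, 'v) chain \<Rightarrow> ('f, 'v) chain" where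
  "cscale c p = Poly_Mapping.map ((*) c) p"

definition lin_ext ::
  "((bit \<times> 'u) list \<Rightarrow> ('f::field, 'v) chain) \<Rightarrow> ('f, 'u) chain \<Rightarrow> ('f, 'v) chain" where
  "lin_ext g p = (\<Sum>w\<in>Poly_Mapping.keys p. cscale (Poly_Mapping.lookup p w) (g w))"

definition chain_space ::
  "('f::field, 'v, 'z) graded_space_scheme \<Rightarrow> nat \<Rightarrow> ('f, ('f, 'v) chain) graded_space" where
  "chain_space L n =
    \<lparr>carrier = {p. Poly_Mapping.keys p \<subseteq> words L n}, mult = undefined, one = undefined,
     zero = 0, add = (+), smult = cscale,
     part = (\<lambda>a. {p. Poly_Mapping.keys p \<subseteq> {w \<in> words L n. sum_list (map fst w) = a}})\<rparr>"

definition ext_rel :: "('f::field, 'v, 'z) graded_space_scheme \<Rightarrow> nat \<Rightarrow> ('f, 'v) chain set" where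
  "ext_rel L n = LinearCombinations.module.span class_ring (chain_space L n)
    ({gen (u @ (a, x \<oplus>\<^bsub>L\<^esub> y) # v) - gen (u @ (a, x) # v) - gen (u @ (a, y) # v) |u a x y v.
        u @ (a, x) # v \<in> words L n \<and> u @ (a, y) # v \<in> words L n} \<union>
     {gen (u @ (a, c \<odot>\<^bsub>L\<^esub> x) # v) - cscale c (gen (u @ (a, x) # v)) |u a c x v.
        u @ (a, x) # v \<in> words L n} \<union>
     {gen (u @ (a, x) # (b, y) # v) + cscale (psign (a * b)) (gen (u @ (b, y) # (a, x) # v)) |u a x b y v.
        u @ (a, x) # (b, y) # v \<in> words L n})"

text \<open>For i < j, in the super exterior power the word w equals \<open>pull_sign (map fst w) i j\<close> times
  the word obtained by moving the letters i and j (counted from 0) to the front, in this order.\<close>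

definition pull_sign :: "bit list \<Rightarrow> nat \<Rightarrow> nat \<Rightarrow> 'f::field" where
  "pull_sign as i j = (- 1) ^ (i + j + 1) *
    psign (as ! i * (\<Sum>l\<in>{..<i}. as ! l) + as ! j * (\<Sum>l\<in>{..<j} - {i}. as ! l))"

definition word_boundary ::
  "('f::field, 'v, 'z) lie_superalg_scheme \<Rightarrow> (bit \<times> 'v) list \<Rightarrow> ('f, 'v) chain" where
  "word_boundary L w = (\<Sum>(i, j)\<in>{(i, j). i < j \<and> j < length w}.
    Poly_Mapping.single
      ((fst (w ! i) + fst (w ! j), lbrak L (snd (w ! i)) (snd (w ! j))) # nths w (- {i, j}))
      (pull_sign (map fst w) i j))"

abbreviation boundary ::
  "('f::field, 'v, 'z) lie_superalg_scheme \<Rightarrow> ('f, 'v) chain \<Rightarrow> ('f, 'v) chain" where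
  "boundary L \<equiv> lin_ext (word_boundary L)"

text \<open>Cycles and boundaries are taken in the free space; both contain the relations.
  The definition of cycles is meant for n > 0.\<close>

definition cycles :: "('f::field, 'v, 'z) lie_superalg_scheme \<Rightarrow> nat \<Rightarrow> ('f, 'v) chain set" where
  "cycles L n = {p \<in> carrier (chain_space L n). boundary L p \<in> ext_rel L (n - 1)}"

definition boundaries :: "('f::field, 'v, 'z) lie_superalg_scheme \<Rightarrow> nat \<Rightarrow> ('f, 'v) chain set" where
  "boundaries L n =
    boundary L ` carrier (chain_space L (Suc n)) <+>\<^bsub>chain_space L n\<^esub> ext_rel L n"

definition homology ::
  "('f::field, 'v, 'z) lie_superalg_scheme \<Rightarrow> nat \<Rightarrow> ('f, ('f, 'v) chain set) graded_space" where
  "homology L n = quot_space (sub_space (chain_space L n) (cycles L n)) (boundaries L n)"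

text \<open>The map from n-th homology to the n-th homology of L' induced by a homomorphism h to L'.\<close>

definition homology_map ::
  "('f::field, 'v, 'z) lie_superalg_scheme \<Rightarrow> nat \<Rightarrow> ('u \<Rightarrow> 'v) \<Rightarrow>
   ('f, 'u) chain set \<Rightarrow> ('f, 'v) chain set" where
  "homology_map L' n h =
    coset_map (chain_space L' n) (boundaries L' n) (lin_ext (\<lambda>w. gen (map (map_prod id h) w)))"

section \<open>Schur multipliers\<close>

definition schur_multiplier ::
  "('f::field, 'v, 'z) lie_superalg_scheme \<Rightarrow> ('f, ('f, 'v) chain set) graded_space" where
  "schur_multiplier L = homology L 2"

text \<open>\<open>is_pair_multiplier L I M\<close>: M is an abelian Lie superalgebra that fits into the exact sequence
  H3(L) \<open>\<rightarrow>\<close> H3(L/I) \<open>\<rightarrow>\<close> M \<open>\<rightarrow>\<close> M(L) \<open>\<rightarrow>\<close> M(L/I) \<open>\<rightarrow>\<close> I/[L,I] \<open>\<rightarrow>\<close> L/[L,L] \<open>\<rightarrow>\<close> L/([L,L]+I) \<open>\<rightarrow>\<close> 0,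
  in which the maps between homology groups of L and L/I are induced by the projection and the
  last two maps are induced by the identity of L. By exactness M is an extension of the kernel of
  M(L) \<open>\<rightarrow>\<close> M(L/I) by the cokernel of H3(L) \<open>\<rightarrow>\<close> H3(L/I), so it is unique up to isomorphism.\<close>

definition is_pair_multiplier ::
  "('f::field, 'v, 'y) lie_superalg_scheme \<Rightarrow> 'v set \<Rightarrow> ('f, 'w, 'z) lie_superalg_scheme \<Rightarrow> bool" where
  "is_pair_multiplier L I M \<longleftrightarrow>
    lie_superalgebra M \<and> abelian_lie M \<and>
    (let Q = quot_lie L I;
         proj = (\<lambda>x. I +>\<^bsub>L\<^esub> x);
         LI = brak_span L (carrier L) I;
         I_ab = quot_space (sub_space L I) LI;
         L_ab = quot_space L (derived L);
         Q_ab = quot_space L (derived L <+>\<^bsub>L\<^esub> I);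
         p3 = homology_map Q 3 proj;
         p2 = homology_map Q 2 proj;
         incl = coset_map L (derived L) (\<lambda>x. x);
         proj_ab = coset_map L (derived L <+>\<^bsub>L\<^esub> I) (\<lambda>x. x)
     in \<exists>\<alpha> \<beta> \<gamma>.
       even_linear (homology Q 3) M \<alpha> \<and>
       even_linear M (schur_multiplier L) \<beta> \<and>
       even_linear (schur_multiplier Q) I_ab \<gamma> \<and>
       exact_at (homology L 3) p3 (homology Q 3) \<alpha> M \<and>
       exact_at (homology Q 3) \<alpha> M \<beta> (schur_multiplier L) \<and>
       exact_at M \<beta> (schur_multiplier L) p2 (schur_multiplier Q) \<and>
       exact_at (schur_multiplier L) p2 (schur_multiplier Q) \<gamma> I_ab \<and>
       exact_at (schur_multiplier Q) \<gamma> I_ab incl L_ab \<and>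
       exact_at I_ab incl L_ab proj_ab Q_ab \<and>
       proj_ab ` carrier L_ab = carrier Q_ab)"

section \<open>The Heisenberg Lie superalgebra with odd center\<close>

datatype heis_basis = HX nat | HY nat | HZ

definition heis_even :: "nat \<Rightarrow> heis_basis set" where
  "heis_even m = HX ` {1..m}"

definition heis_odd :: "nat \<Rightarrow> heis_basis set" where
  "heis_odd m = HY ` {1..m} \<union> {HZ}"

text \<open>Elements are given by their coordinates. The bracket is the bilinear extension of
  [x_j, y_j] = z = - [y_j, x_j]; the sign is -1 because x_j is even.\<close>

definition heisenberg :: "nat \<Rightarrow> ('f::field, heis_basis \<Rightarrow> 'f) lie_superalg" where
  "heisenberg m =
    \<lparr>carrier = {f. \<forall>b. f b \<noteq> 0 \<longrightarrow> b \<in> heis_even m \<union> heis_odd m},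
     mult = undefined, one = undefined,
     zero = (\<lambda>_. 0), add = (\<lambda>f g b. f b + g b), smult = (\<lambda>c f b. c * f b),
     part = (\<lambda>a. {f. \<forall>b. f b \<noteq> 0 \<longrightarrow> b \<in> (if a = 0 then heis_even m else heis_odd m)}),
     lbrak = (\<lambda>f g b. if b = HZ
                then \<Sum>j\<in>{1..m}. f (HX j) * g (HY j) - f (HY j) * g (HX j) else 0)\<rparr>"

lemma support_add: "\<lbrakk>\<forall>b. f b \<noteq> (0::'f::field) \<longrightarrow> P b; \<forall>b. g b \<noteq> 0 \<longrightarrow> P b\<rbrakk> \<Longrightarrow> \<forall>b. f b + g b \<noteq> 0 \<longrightarrow> P b"
  by (metis add.right_neutral)

lemma heisenberg_vectorspace: "vectorspace (class_ring :: 'f::field ring) (heisenberg m :: ('f, heis_basis \<Rightarrow> 'f) lie_superalg)"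
proof -
  have ab: "abelian_group (heisenberg m :: ('f, heis_basis \<Rightarrow> 'f) lie_superalg)"
  proof (rule abelian_groupI, goal_cases)
    case (1 x y)
    then show ?case by (simp add: heisenberg_def) (rule support_add, auto)
  next
    case (6 x)
    then show ?case
      by (intro bexI[of _ "\<lambda>b. - x b"]) (auto simp: heisenberg_def)
  qed (auto simp: heisenberg_def algebra_simps)
  show ?thesis
    unfolding vectorspace_def
  proof (intro conjI)
    show "field (class_ring :: 'f ring)" by (rule class_field)
    then have "cring (class_ring :: 'f ring)" by (rule fieldE(1))
    then show "module (class_ring :: 'f ring) (heisenberg m :: ('f, heis_basis \<Rightarrow> 'f) lie_superalg)"
      by (rule moduleI[OF _ ab]) (auto simp: heisenberg_def algebra_simps)
  qed
qed

lemma heisenberg_lie_superalgebra: "lie_superalgebra (heisenberg m :: ('f::field, heis_basis \<Rightarrow> 'f) lie_superalg)"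
proof -
  let ?H = "heisenberg m :: ('f, heis_basis \<Rightarrow> 'f) lie_superalg"
  have 1: "subspace class_ring (part ?H a) ?H" for a
    unfolding subspace_def
  proof (intro conjI heisenberg_vectorspace, unfold submodule_def, intro conjI allI impI subsetI)
    show "module class_ring ?H" using heisenberg_vectorspace[of m, where ?'f='f] by (auto simp: vectorspace_def)
    show "x \<oplus>\<^bsub>?H\<^esub> y \<in> part ?H a" if "x \<in> part ?H a" "y \<in> part ?H a" for x y
      using that by (simp add: heisenberg_def del: not_all split del: if_split) (rule support_add, auto)
  qed (auto simp: heisenberg_def split: if_splits)
  have 2: "part ?H 0 \<inter> part ?H 1 = {\<zero>\<^bsub>?H\<^esub>}"
    by (auto simp: heisenberg_def heis_even_def heis_odd_def fun_eq_iff)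
  have 3: "part ?H 0 <+>\<^bsub>?H\<^esub> part ?H 1 = carrier ?H"
  proof (intro equalityI subsetI)
    fix x assume "x \<in> part ?H 0 <+>\<^bsub>?H\<^esub> part ?H 1"
    then show "x \<in> carrier ?H" by (auto simp: set_add_def' heisenberg_def) (metis add.right_neutral)
  next
    fix x assume x: "x \<in> carrier ?H"
    let ?u = "\<lambda>b. if b \<in> heis_even m then x b else 0"
    let ?v = "\<lambda>b. if b \<in> heis_even m then 0 else x b"
    have "?u \<in> part ?H 0" "?v \<in> part ?H 1" "x = ?u \<oplus>\<^bsub>?H\<^esub> ?v"
      using x by (auto simp: heisenberg_def)
    then show "x \<in> part ?H 0 <+>\<^bsub>?H\<^esub> part ?H 1" unfolding set_add_def' by blast
  qed
  have sv: "super_vectorspace ?H"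
    unfolding super_vectorspace_def super_vectorspace_axioms_def
    using heisenberg_vectorspace 1 2 3 by blast
  have ab: "a = 0 \<or> a = 1" for a :: bit by (cases a) auto
  have e: "f (HY j) = 0" if "f \<in> part ?H 0" for f j
    using that by (auto simp: heisenberg_def heis_even_def)
  have o: "f (HX j) = 0" if "f \<in> part ?H 1" for f j
    using that by (auto simp: heisenberg_def heis_odd_def)
  have br: "lbrak ?H f g = (\<lambda>b. if b = HZ then \<Sum>j\<in>{1..m}. f (HX j) * g (HY j) - f (HY j) * g (HX j) else 0)" for f g
    by (simp add: heisenberg_def)
  show ?thesis
    unfolding lie_superalgebra_def lie_superalgebra_axioms_def
  proof (intro conjI allI impI sv, goal_cases)
    case (1 x a y b)
    have z: "(\<Sum>j\<in>{1..m}. x (HX j) * y (HY j) - x (HY j) * y (HX j)) = 0" if "a = b"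
      using 1 that ab[of a] by (auto simp: e o intro!: sum.neutral)
    show ?case using ab[of a] ab[of b] unfolding br using z by (auto simp: heisenberg_def heis_odd_def)
  next
    case (6 x a y b)
    have "(\<Sum>j\<in>{1..m}. x (HX j) * y (HY j) - x (HY j) * y (HX j)) =
          - (\<Sum>j\<in>{1..m}. y (HX j) * x (HY j) - y (HY j) * x (HX j))"
      by (simp add: sum_negf[symmetric] algebra_simps)
    then show ?case using 6 ab[of a] ab[of b] unfolding br
      by (auto simp: psign_def heisenberg_def[of m] fun_eq_iff e o)
  next
    case (7 x a y b z c)
    have "lbrak ?H u (lbrak ?H v w) = \<zero>\<^bsub>?H\<^esub>" "lbrak ?H (lbrak ?H v w) u = \<zero>\<^bsub>?H\<^esub>" for u v w
      by (auto simp: br) (auto simp: heisenberg_def)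
    then show ?case by (simp add: heisenberg_def)
  qed (auto simp: br, auto simp: heisenberg_def fun_eq_iff sum.distrib[symmetric] sum_distrib_left algebra_simps intro!: sum.cong)
qed

end

theory Submission
  imports Defs "HOL-Library.Function_Algebras"
begin

text \<open>Write H for the Heisenberg superalgebra, V = H/z, with \<omega> the pairing on V given by
  [a, b] = \<omega>(a, b) z, and Q = H/J. The ideal J has an odd element \<open>\<noteq> 0\<close>; either this is a multiple
  of z, or some x_j brackets it to a nonzero multiple of z. So z lies in J, Q is a quotient of V and
  is abelian of superdimension (m-k | m-k), and its homology is its exterior algebra.
  The exact sequence makes M an extension of the kernel of M(H) \<open>\<rightarrow>\<close> M(Q) by the cokernel of
  H3(H) \<open>\<rightarrow>\<close> H3(Q). Both depend on the boundary of a \<open>\<and>\<close> b \<open>\<and>\<close> c, which is the sum of the three terms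
  \<open>\<plusminus>\<close> \<omega>(a, b) z \<open>\<and>\<close> c, and hence on the question which z \<open>\<and>\<close> v are boundaries. For \<open>m \<ge> 2\<close> all of them
  are. For m = 1 those with odd v are, but z \<open>\<and>\<close> x_1 is not (\<open>hz_wedge_bounded_through\<close>,
  \<open>coord_HZ_HX_boundaries\<close>).

  Let \<open>k \<ge> 1\<close>. Then J contains an even element \<open>x \<noteq> 0\<close>, and for \<open>m \<ge> 2\<close> every z \<open>\<and>\<close> v is the boundary of a chain
  of multiples of x \<open>\<and>\<close> a \<open>\<and>\<close> b. Such chains vanish in Q, so subtracting one turns any 3-chain of H into
  a cycle with the same image in Q. For m = 1 the quotient Q is zero. In both cases the cokernel is zero
  (\<open>H3_surjective\<close>), and M is isomorphic to the kernel of M(H) \<open>\<rightarrow>\<close> M(Q). In a basis adapted to J, an element of the kernel of the map from the second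
  exterior power of V to that of Q is given by its coordinates at the pairs of basis vectors not both
  outside J, and these are k (2m - k) even and k (2m - k) odd pairs. Being a cycle of H is one further linear
  equation, which involves odd pairs only and is not trivial (\<open>exists_bracket_pair\<close>). For m = k = 1 the class
  of z \<open>\<and>\<close> x_1 is one more odd coordinate.

  Let k = 0, so that J is spanned by z. Every index i of a basis vector of V contributes one dimension
  to M. If z \<open>\<and>\<close> e_i is a boundary, this is the coefficient of z \<open>\<and>\<close> e_i in the boundary of a 3-chain, which
  is a functional on the cokernel. If it is not, then the class of z \<open>\<and>\<close> e_i is in the kernel of
  M(H) \<open>\<rightarrow>\<close> M(Q). Together these are 2m dimensions (\<open>dims_k_zero\<close>).

  As M is known only through the maps into and out of it, its dimensions are found by giving coordinate
  functionals on it (\<open>dim_from_coordinates\<close>). The functionals are those of the exterior powers, evaluated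
  on representatives.\<close>

section \<open>Dimensions from coordinate functionals\<close>

lemma class_ring_a_inv: "\<ominus>\<^bsub>class_ring\<^esub> x = - (x :: 'f::field)"
  by (simp add: class_ring_simps)

lemma functional_finsum:
  fixes W :: "('f::field, 'v, 'z) module_scheme" and t :: "'v \<Rightarrow> 'f"
  assumes "vectorspace class_ring W" and "finite A"
    and add: "\<And>v w. v \<in> carrier W \<Longrightarrow> w \<in> carrier W \<Longrightarrow> t (v \<oplus>\<^bsub>W\<^esub> w) = t v + t w"
    and smult: "\<And>c v. v \<in> carrier W \<Longrightarrow> t (c \<odot>\<^bsub>W\<^esub> v) = c * t v"
    and "\<And>i. i \<in> A \<Longrightarrow> g i \<in> carrier W"
  shows "t (\<Oplus>\<^bsub>W\<^esub>i\<in>A. g i) = (\<Sum>i\<in>A. t (g i))"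
proof -
  interpret W: vectorspace class_ring W by fact
  have "t \<zero>\<^bsub>W\<^esub> = 0" using smult[of "\<zero>\<^bsub>W\<^esub>" 0] by simp
  with \<open>finite A\<close> assms(5) show ?thesis
  proof (induction A)
    case (insert i A)
    then have "(\<Oplus>\<^bsub>W\<^esub>i\<in>insert i A. g i) = g i \<oplus>\<^bsub>W\<^esub> (\<Oplus>\<^bsub>W\<^esub>i\<in>A. g i)"
      by (intro W.finsum_insert) auto
    moreover have "(\<Oplus>\<^bsub>W\<^esub>i\<in>A. g i) \<in> carrier W"
      using insert by (intro W.finsum_closed) auto
    ultimately show ?case using insert by (simp add: add)
  qed simp
qed

text \<open>The dual vectors form a basis: the functionals show their independence, and v minus
  the combination of the \<open>u s\<close> with coefficients \<open>T s v\<close> has only zero coordinates.\<close>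

lemma dim_from_coordinates:
  fixes W :: "('f::field, 'v, 'z) module_scheme" and T :: "'s \<Rightarrow> 'v \<Rightarrow> 'f"
  assumes W: "vectorspace class_ring W" and fin: "finite S"
    and add: "\<And>s v w. s \<in> S \<Longrightarrow> v \<in> carrier W \<Longrightarrow> w \<in> carrier W \<Longrightarrow>
      T s (v \<oplus>\<^bsub>W\<^esub> w) = T s v + T s w"
    and smult: "\<And>s c v. s \<in> S \<Longrightarrow> v \<in> carrier W \<Longrightarrow> T s (c \<odot>\<^bsub>W\<^esub> v) = c * T s v"
    and inj: "\<And>v. v \<in> carrier W \<Longrightarrow> (\<And>s. s \<in> S \<Longrightarrow> T s v = 0) \<Longrightarrow> v = \<zero>\<^bsub>W\<^esub>"
    and u: "\<And>s. s \<in> S \<Longrightarrow> u s \<in> carrier W"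
    and dual: "\<And>s t. s \<in> S \<Longrightarrow> t \<in> S \<Longrightarrow> T t (u s) = (if s = t then 1 else 0)"
  shows "vectorspace.fin_dim class_ring W" and "vectorspace.dim class_ring W = card S"
proof -
  interpret W: vectorspace class_ring W by fact
  have K: "carrier (class_ring :: 'f ring) = UNIV" by simp
  have inj_u: "inj_on u S"
  proof (rule inj_onI)
    fix s t assume "s \<in> S" "t \<in> S" "u s = u t"
    then show "s = t" using dual[of s t] dual[of t t] by (auto split: if_splits)
  qed
  have B: "u ` S \<subseteq> carrier W" "finite (u ` S)" using u fin by auto
  have T_lincomb: "T t (W.lincomb a (u ` S)) = a (u t)" if "t \<in> S" for a t
  proof -
    have "T t (W.lincomb a (u ` S)) = (\<Sum>v\<in>u ` S. T t (a v \<odot>\<^bsub>W\<^esub> v))"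
      unfolding W.lincomb_def
      by (rule functional_finsum[OF W B(2)]) (use that u in \<open>auto simp: add smult\<close>)
    also have "\<dots> = (\<Sum>s\<in>S. a (u s) * T t (u s))"
      using inj_u that u by (simp add: sum.reindex smult)
    also have "\<dots> = (\<Sum>s\<in>S. if s = t then a (u s) else 0)"
      using that dual by (intro sum.cong) auto
    also have "\<dots> = a (u t)" using that fin by simp
    finally show ?thesis .
  qed
  have "W.lin_indpt (u ` S)"
  proof (rule W.finite_lin_indpt2[OF B(2,1)], intro ballI)
    fix a v assume *: "W.lincomb a (u ` S) = \<zero>\<^bsub>W\<^esub>" and "v \<in> u ` S"
    then obtain t where t: "t \<in> S" "v = u t" by blast
    have "T t \<zero>\<^bsub>W\<^esub> = 0" using smult[OF t(1), of "\<zero>\<^bsub>W\<^esub>" 0] by simp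
    then show "a v = \<zero>\<^bsub>class_ring\<^esub>" using T_lincomb[OF t(1), of a] * t(2) by simp
  qed
  moreover have "carrier W \<subseteq> W.span (u ` S)"
  proof
    fix v assume v: "v \<in> carrier W"
    define a where "a = (\<lambda>b. T (the_inv_into S u b) v)"
    have a: "a (u t) = T t v" if "t \<in> S" for t
      using that inj_u by (simp add: a_def the_inv_into_f_f)
    let ?w = "W.lincomb a (u ` S)"
    have w: "?w \<in> carrier W" using B by (intro W.lincomb_closed) auto
    have "v \<oplus>\<^bsub>W\<^esub> ((- 1) \<odot>\<^bsub>W\<^esub> ?w) = \<zero>\<^bsub>W\<^esub>"
      by (rule inj) (use v w in \<open>auto simp: add smult T_lincomb a\<close>)
    moreover have "(- 1) \<odot>\<^bsub>W\<^esub> ?w = \<ominus>\<^bsub>W\<^esub> ?w"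
      using W.smult_minus_1_back[OF w] by (simp add: class_ring_a_inv)
    ultimately have "v = ?w"
      using v w by (metis W.add.inv_closed W.minus_equality W.minus_minus W.a_comm)
    moreover have "?w \<in> W.span (u ` S)"
      unfolding W.span_def using B by auto
    ultimately show "v \<in> W.span (u ` S)" by simp
  qed
  ultimately have basis: "W.basis (u ` S)"
    unfolding W.basis_def using B W.span_is_subset2[OF B(1)] by auto
  then show "W.fin_dim" unfolding W.fin_dim_def W.basis_def using B by auto
  show "W.dim = card S"
    using W.dim_basis[OF B(2) basis] inj_u by (simp add: card_image)
qed

text \<open>The \<open>T s\<close> are coordinates of the quotient by N. The \<open>U r\<close>, which make sense only on the
  subspace N, become functionals on W by composing them with a projection onto N.\<close>

lemma dim_from_coordinates_of_extension:
  fixes W :: "('f::field, 'v, 'z) module_scheme" and T :: "'s \<Rightarrow> 'v \<Rightarrow> 'f" and U :: "'r \<Rightarrow> 'v \<Rightarrow> 'f"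
  assumes W: "vectorspace class_ring W" and fin: "finite S" "finite R"
    and addT: "\<And>s v w. s \<in> S \<Longrightarrow> v \<in> carrier W \<Longrightarrow> w \<in> carrier W \<Longrightarrow>
      T s (v \<oplus>\<^bsub>W\<^esub> w) = T s v + T s w"
    and smultT: "\<And>s c v. s \<in> S \<Longrightarrow> v \<in> carrier W \<Longrightarrow> T s (c \<odot>\<^bsub>W\<^esub> v) = c * T s v"
    and N: "N = {v \<in> carrier W. \<forall>s\<in>S. T s v = 0}"
    and addU: "\<And>r v w. r \<in> R \<Longrightarrow> v \<in> N \<Longrightarrow> w \<in> N \<Longrightarrow> U r (v \<oplus>\<^bsub>W\<^esub> w) = U r v + U r w"
    and smultU: "\<And>r c v. r \<in> R \<Longrightarrow> v \<in> N \<Longrightarrow> U r (c \<odot>\<^bsub>W\<^esub> v) = c * U r v"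
    and inj: "\<And>v. v \<in> N \<Longrightarrow> (\<And>r. r \<in> R \<Longrightarrow> U r v = 0) \<Longrightarrow> v = \<zero>\<^bsub>W\<^esub>"
    and u: "\<And>s. s \<in> S \<Longrightarrow> u s \<in> carrier W"
    and dualT: "\<And>s t. s \<in> S \<Longrightarrow> t \<in> S \<Longrightarrow> T t (u s) = (if s = t then 1 else 0)"
    and n: "\<And>r. r \<in> R \<Longrightarrow> n r \<in> N"
    and dualU: "\<And>r t. r \<in> R \<Longrightarrow> t \<in> R \<Longrightarrow> U t (n r) = (if r = t then 1 else 0)"
  shows "vectorspace.fin_dim class_ring W" and "vectorspace.dim class_ring W = card S + card R"
proof -
  interpret W: vectorspace class_ring W by fact
  \<comment> \<open>P is the projection onto N along the span of the u s.\<close>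
  define P where "P v = v \<oplus>\<^bsub>W\<^esub> (\<Oplus>\<^bsub>W\<^esub>s\<in>S. (- T s v) \<odot>\<^bsub>W\<^esub> u s)" for v
  have corr: "(\<Oplus>\<^bsub>W\<^esub>s\<in>S. a s \<odot>\<^bsub>W\<^esub> u s) \<in> carrier W" for a
    using u by (intro W.finsum_closed) auto
  have T0: "T s \<zero>\<^bsub>W\<^esub> = 0" if "s \<in> S" for s using smultT[OF that, of "\<zero>\<^bsub>W\<^esub>" 0] by simp
  have P_carr: "P v \<in> carrier W" if "v \<in> carrier W" for v
    unfolding P_def using that corr by auto
  have P_N: "P v \<in> N" if v: "v \<in> carrier W" for v
  proof -
    have "T t (P v) = 0" if t: "t \<in> S" for t
    proof -
      have "T t (\<Oplus>\<^bsub>W\<^esub>s\<in>S. (- T s v) \<odot>\<^bsub>W\<^esub> u s) = (\<Sum>s\<in>S. T t ((- T s v) \<odot>\<^bsub>W\<^esub> u s))"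
        by (rule functional_finsum[OF W fin(1)]) (use t u in \<open>auto simp: addT smultT\<close>)
      also have "\<dots> = (\<Sum>s\<in>S. if s = t then - T s v else 0)"
        using t u dualT by (intro sum.cong) (auto simp: smultT)
      also have "\<dots> = - T t v" using t fin by simp
      finally show ?thesis unfolding P_def using t v corr by (simp add: addT)
    qed
    then show ?thesis using v P_carr by (simp add: N)
  qed
  have P_add: "P (v \<oplus>\<^bsub>W\<^esub> w) = P v \<oplus>\<^bsub>W\<^esub> P w" if "v \<in> carrier W" "w \<in> carrier W" for v w
  proof -
    have "(\<Oplus>\<^bsub>W\<^esub>s\<in>S. (- T s (v \<oplus>\<^bsub>W\<^esub> w)) \<odot>\<^bsub>W\<^esub> u s) =
        (\<Oplus>\<^bsub>W\<^esub>s\<in>S. (- T s v) \<odot>\<^bsub>W\<^esub> u s \<oplus>\<^bsub>W\<^esub> (- T s w) \<odot>\<^bsub>W\<^esub> u s)"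
    proof (rule W.finsum_cong2)
      fix s assume s: "s \<in> S"
      have "(- T s (v \<oplus>\<^bsub>W\<^esub> w)) = (- T s v) \<oplus>\<^bsub>class_ring\<^esub> (- T s w)" using s that by (simp add: addT)
      then show "(- T s (v \<oplus>\<^bsub>W\<^esub> w)) \<odot>\<^bsub>W\<^esub> u s = (- T s v) \<odot>\<^bsub>W\<^esub> u s \<oplus>\<^bsub>W\<^esub> (- T s w) \<odot>\<^bsub>W\<^esub> u s"
        using W.smult_l_distr[of "- T s v" "- T s w" "u s"] u[OF s] by simp
    qed (use u in auto)
    also have "\<dots> = (\<Oplus>\<^bsub>W\<^esub>s\<in>S. (- T s v) \<odot>\<^bsub>W\<^esub> u s) \<oplus>\<^bsub>W\<^esub> (\<Oplus>\<^bsub>W\<^esub>s\<in>S. (- T s w) \<odot>\<^bsub>W\<^esub> u s)"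
      using u by (intro W.finsum_addf) auto
    finally show ?thesis unfolding P_def using that corr by (simp add: W.a_ac)
  qed
  have P_smult: "P (c \<odot>\<^bsub>W\<^esub> v) = c \<odot>\<^bsub>W\<^esub> P v" if "v \<in> carrier W" for c v
  proof -
    have "(\<Oplus>\<^bsub>W\<^esub>s\<in>S. (- T s (c \<odot>\<^bsub>W\<^esub> v)) \<odot>\<^bsub>W\<^esub> u s) = (\<Oplus>\<^bsub>W\<^esub>s\<in>S. c \<odot>\<^bsub>W\<^esub> ((- T s v) \<odot>\<^bsub>W\<^esub> u s))"
    proof (rule W.finsum_cong2)
      fix s assume s: "s \<in> S"
      show "(- T s (c \<odot>\<^bsub>W\<^esub> v)) \<odot>\<^bsub>W\<^esub> u s = c \<odot>\<^bsub>W\<^esub> ((- T s v) \<odot>\<^bsub>W\<^esub> u s)"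
        using W.smult_assoc1[of c "- T s v" "u s"] u[OF s] smultT[OF s that] by simp
    qed (use u in auto)
    also have "\<dots> = c \<odot>\<^bsub>W\<^esub> (\<Oplus>\<^bsub>W\<^esub>s\<in>S. (- T s v) \<odot>\<^bsub>W\<^esub> u s)"
      using W.finsum_smult[of c "\<lambda>s. (- T s v) \<odot>\<^bsub>W\<^esub> u s"] u by auto
    finally show ?thesis unfolding P_def using that corr by (simp add: W.smult_r_distr)
  qed
  have P_id: "P v = v" if "v \<in> N" for v
  proof -
    have "(\<Oplus>\<^bsub>W\<^esub>s\<in>S. (- T s v) \<odot>\<^bsub>W\<^esub> u s) = (\<Oplus>\<^bsub>W\<^esub>s\<in>S. \<zero>\<^bsub>W\<^esub>)"
      by (rule W.finsum_cong2) (use that u W.smult_l_null in \<open>auto simp: N\<close>)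
    then show ?thesis using that by (simp add: P_def N)
  qed
  have P_u: "P (u s) = \<zero>\<^bsub>W\<^esub>" if s: "s \<in> S" for s
  proof -
    have "(\<Oplus>\<^bsub>W\<^esub>t\<in>S. (- T t (u s)) \<odot>\<^bsub>W\<^esub> u t) = (\<Oplus>\<^bsub>W\<^esub>t\<in>S. if s = t then \<ominus>\<^bsub>W\<^esub> u t else \<zero>\<^bsub>W\<^esub>)"
      by (rule W.finsum_cong2)
         (use s u W.smult_l_null W.smult_minus_1_back in \<open>auto simp: dualT class_ring_a_inv\<close>)
    also have "\<dots> = \<ominus>\<^bsub>W\<^esub> u s"
      using W.finsum_singleton[OF s fin(1), of "\<lambda>t. \<ominus>\<^bsub>W\<^esub> u t"] u by auto
    finally show ?thesis using u[OF s] by (simp add: P_def W.r_neg)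
  qed
  have U0: "U r \<zero>\<^bsub>W\<^esub> = 0" if "r \<in> R" for r
    using smultU[OF that, of "\<zero>\<^bsub>W\<^esub>" 0] T0 by (simp add: N)
  define T' where "T' i v = (case i of Inl s \<Rightarrow> T s v | Inr r \<Rightarrow> U r (P v))" for i v
  define u' where "u' i = (case i of Inl s \<Rightarrow> u s | Inr r \<Rightarrow> n r)" for i
  have Nc: "v \<in> carrier W" if "v \<in> N" for v using that by (simp add: N)
  have fin': "finite (S <+> R)" using fin by simp
  have add': "T' i (v \<oplus>\<^bsub>W\<^esub> w) = T' i v + T' i w"
    if "i \<in> S <+> R" "v \<in> carrier W" "w \<in> carrier W" for i v w
    using that P_N by (auto simp: T'_def addT P_add addU)
  have smult': "T' i (c \<odot>\<^bsub>W\<^esub> v) = c * T' i v" if "i \<in> S <+> R" "v \<in> carrier W" for i c v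
    using that P_N by (auto simp: T'_def smultT P_smult smultU)
  have inj': "v = \<zero>\<^bsub>W\<^esub>" if "v \<in> carrier W" and *: "\<And>i. i \<in> S <+> R \<Longrightarrow> T' i v = 0" for v
  proof -
    have "T s v = 0" if "s \<in> S" for s using *[of "Inl s"] that by (auto simp: T'_def)
    then have v: "v \<in> N" using \<open>v \<in> carrier W\<close> by (simp add: N)
    show ?thesis
      by (rule inj[OF v]) (use *[of "Inr _"] P_id[OF v] in \<open>auto simp: T'_def\<close>)
  qed
  have u': "u' i \<in> carrier W" if "i \<in> S <+> R" for i
    using that u n Nc by (auto simp: u'_def)
  have dual': "T' j (u' i) = (if i = j then 1 else 0)" if "i \<in> S <+> R" "j \<in> S <+> R" for i j
    using that n P_u U0 P_id by (auto simp: T'_def u'_def dualT dualU N split: if_splits)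
  note coords = dim_from_coordinates[where T = T' and u = u' and S = "S <+> R" and W = W, OF W fin' add' smult' inj' u' dual']
  show "vectorspace.fin_dim class_ring W" by (rule coords(1))
  show "vectorspace.dim class_ring W = card S + card R" by (rule trans[OF coords(2) card_Plus[OF fin]])
qed

context vector_space
begin

lemma vectorspace_carrier:
  fixes W :: "('a, 'b, 'z) module_scheme"
  assumes V: "subspace (carrier W)"
    and ops: "\<And>x y. x \<oplus>\<^bsub>W\<^esub> y = x + y" "\<And>c x. c \<odot>\<^bsub>W\<^esub> x = scale c x" "\<zero>\<^bsub>W\<^esub> = 0"
  shows "vectorspace class_ring W"
proof -
  have "abelian_group W"
  proof (rule abelian_groupI, goal_cases)
    case (6 x)
    then show ?case using V by (intro bexI[of _ "- x"]) (auto simp: ops intro: subspace_neg)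
  qed (use V in \<open>auto intro: subspace_add subspace_0 simp: ops add_ac\<close>)
  then have "module (class_ring :: 'a ring) W"
    by (rule moduleI[OF fieldE(1)[OF class_field]])
       (use V in \<open>auto intro: subspace_scale simp: ops scale_left_distrib scale_right_distrib\<close>)
  then show ?thesis by (simp add: vectorspace_def class_field)
qed

end

section \<open>Chains\<close>

lemma lookup_cscale [simp]: "Poly_Mapping.lookup (cscale c p) w = c * Poly_Mapping.lookup p w"
  by (simp add: cscale_def map.rep_eq when_def)

global_interpretation chain: vector_space "cscale :: 'f::field \<Rightarrow> ('f, 'v) chain \<Rightarrow> ('f, 'v) chain"
  by standard (auto intro!: poly_mapping_eqI simp: lookup_add algebra_simps)

lemma cscale_gen [simp]: "cscale c (Poly_Mapping.single w d) = Poly_Mapping.single w (c * d)"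
  by (rule poly_mapping_eqI) (simp add: lookup_single when_def)

text \<open>The scalar-valued counterpart of \<open>lin_ext\<close>: functionals on chains are determined by their values
  on words.\<close>

definition leval :: "((bit \<times> 'v) list \<Rightarrow> 'f) \<Rightarrow> ('f::field, 'v) chain \<Rightarrow> 'f" where
  "leval \<phi> p = (\<Sum>w\<in>Poly_Mapping.keys p. Poly_Mapping.lookup p w * \<phi> w)"

lemma leval_superset:
  assumes "finite A" "Poly_Mapping.keys p \<subseteq> A"
  shows "leval \<phi> p = (\<Sum>w\<in>A. Poly_Mapping.lookup p w * \<phi> w)"
  unfolding leval_def using assms by (intro sum.mono_neutral_left) (auto simp: in_keys_iff)

lemma lin_ext_superset:
  assumes "finite A" "Poly_Mapping.keys p \<subseteq> A"
  shows "lin_ext g p = (\<Sum>w\<in>A. cscale (Poly_Mapping.lookup p w) (g w))"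
  unfolding lin_ext_def using assms by (intro sum.mono_neutral_left) (auto simp: in_keys_iff)

lemma leval_add: "leval \<phi> (p + q) = leval \<phi> p + leval \<phi> q"
proof -
  let ?A = "Poly_Mapping.keys p \<union> Poly_Mapping.keys q"
  have "Poly_Mapping.keys (p + q) \<subseteq> ?A" by (rule keys_add)
  then show ?thesis
    by (subst (1 2 3) leval_superset[of ?A]) (auto simp: lookup_add distrib_right sum.distrib)
qed

lemma leval_cscale: "leval \<phi> (cscale c p) = c * leval \<phi> p"
proof -
  have "Poly_Mapping.keys (cscale c p) \<subseteq> Poly_Mapping.keys p" by (auto simp: in_keys_iff)
  then show ?thesis
    by (subst (1 2) leval_superset[of "Poly_Mapping.keys p"])
       (auto simp: sum_distrib_left mult.assoc)
qed

lemma leval_single [simp]: "leval \<phi> (Poly_Mapping.single w c) = c * \<phi> w"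
  by (subst leval_superset[of "{w}"]) auto

lemma leval_0 [simp]: "leval \<phi> 0 = 0"
  by (simp add: leval_def)

lemma leval_minus: "leval \<phi> (- p) = - leval \<phi> p"
  using leval_add[of \<phi> p "- p"] by (simp add: eq_neg_iff_add_eq_0 add.commute)

lemma leval_diff: "leval \<phi> (p - q) = leval \<phi> p - leval \<phi> q"
  using leval_add[of \<phi> p "- q"] by (simp add: leval_minus)

lemmas leval_simps = leval_add leval_diff leval_cscale leval_minus

lemma lin_ext_add: "lin_ext g (p + q) = lin_ext g p + lin_ext g q"
proof -
  let ?A = "Poly_Mapping.keys p \<union> Poly_Mapping.keys q"
  have "Poly_Mapping.keys (p + q) \<subseteq> ?A" by (rule keys_add)
  then show ?thesis
    by (subst (1 2 3) lin_ext_superset[of ?A])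
       (auto simp: lookup_add chain.scale_left_distrib sum.distrib)
qed

lemma lin_ext_cscale: "lin_ext g (cscale c p) = cscale c (lin_ext g p)"
proof -
  have "Poly_Mapping.keys (cscale c p) \<subseteq> Poly_Mapping.keys p" by (auto simp: in_keys_iff)
  then show ?thesis
    by (subst (1 2) lin_ext_superset[of "Poly_Mapping.keys p"])
       (auto simp: chain.scale_sum_right)
qed

lemma lin_ext_single [simp]: "lin_ext g (Poly_Mapping.single w c) = cscale c (g w)"
  by (subst lin_ext_superset[of "{w}"]) auto

lemma lin_ext_0 [simp]: "lin_ext g 0 = 0"
  by (simp add: lin_ext_def)

lemma lin_ext_minus: "lin_ext g (- p) = - lin_ext g p"
  using lin_ext_add[of g p "- p"] by (simp add: eq_neg_iff_add_eq_0 add.commute)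

lemma lin_ext_diff: "lin_ext g (p - q) = lin_ext g p - lin_ext g q"
  using lin_ext_add[of g p "- q"] by (simp add: lin_ext_minus)

lemmas lin_ext_simps = lin_ext_add lin_ext_diff lin_ext_cscale lin_ext_minus

lemma subspace_vimage_lin_ext:
  assumes "chain.subspace V" shows "chain.subspace {p. lin_ext g p \<in> V}"
  using assms by (auto simp: chain.subspace_def lin_ext_simps)

lemma subspace_leval_zero: "chain.subspace {p. leval \<phi> p = 0}"
  by (auto simp: chain.subspace_def leval_simps)

lemma subspace_supported: "chain.subspace {p :: ('f::field, 'v) chain. Poly_Mapping.keys p \<subseteq> A}"
proof -
  have "{p :: ('f, 'v) chain. Poly_Mapping.keys p \<subseteq> A} = {p. \<forall>w. w \<notin> A \<longrightarrow> Poly_Mapping.lookup p w = 0}"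
    by (auto simp: in_keys_iff)
  then show ?thesis by (simp add: chain.subspace_def lookup_add)
qed

lemma chain_expansion: "p = (\<Sum>w\<in>Poly_Mapping.keys p. cscale (Poly_Mapping.lookup p w) (gen w))"
proof (rule poly_mapping_eqI)
  fix v
  have "(\<Sum>w\<in>Poly_Mapping.keys p. Poly_Mapping.lookup p w * (1 when w = v)) =
      (\<Sum>w\<in>Poly_Mapping.keys p. if w = v then Poly_Mapping.lookup p w else 0)"
    by (intro sum.cong) (auto simp: when_def)
  also have "\<dots> = Poly_Mapping.lookup p v" by (auto simp: in_keys_iff)
  finally show "Poly_Mapping.lookup p v = Poly_Mapping.lookup
      (\<Sum>w\<in>Poly_Mapping.keys p. cscale (Poly_Mapping.lookup p w) (gen w)) v"
    by (simp add: lookup_sum lookup_single del: cscale_gen)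
qed

lemma supported_in_subspace:
  assumes "Poly_Mapping.keys p \<subseteq> A" "chain.subspace V" "\<And>w. w \<in> A \<Longrightarrow> gen w \<in> V"
  shows "p \<in> V"
  by (subst chain_expansion)
     (use assms in \<open>auto intro!: chain.subspace_sum chain.subspace_scale simp del: cscale_gen\<close>)

abbreviation chains :: "('f::field, 'v, 'z) graded_space_scheme \<Rightarrow> nat \<Rightarrow> ('f, 'v) chain set" where
  "chains L n \<equiv> carrier (chain_space L n)"

lemma chains_iff: "p \<in> chains L n \<longleftrightarrow> Poly_Mapping.keys p \<subseteq> words L n"
  by (simp add: chain_space_def)

lemma chain_space_simps [simp]:
  "\<zero>\<^bsub>chain_space L n\<^esub> = 0" "p \<oplus>\<^bsub>chain_space L n\<^esub> q = p + q" "c \<odot>\<^bsub>chain_space L n\<^esub> p = cscale c p"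
  by (simp_all add: chain_space_def)

lemma subspace_chains: "chain.subspace (chains L n)"
  using subspace_supported[of "words L n"] by (simp add: chain_space_def)

lemma gen_in_chains: "w \<in> words L n \<Longrightarrow> Poly_Mapping.single w c \<in> chains L n"
  by (simp add: chains_iff)

lemma chains_in_subspace:
  assumes "p \<in> chains L n" "chain.subspace V" "\<And>w. w \<in> words L n \<Longrightarrow> gen w \<in> V"
  shows "p \<in> V"
  using assms supported_in_subspace by (metis chains_iff)

lemma vectorspace_chain_space:
  "vectorspace (class_ring :: 'f ring) (chain_space (L :: ('f::field, 'v, 'z) graded_space_scheme) n)"
  by (rule chain.vectorspace_carrier) (simp_all add: subspace_chains)

lemma submodule_chain_space:
  "submodule (class_ring :: 'f ring) V (chain_space (L :: ('f::field, 'v, 'z) graded_space_scheme) n)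
    \<longleftrightarrow> chain.subspace V \<and> V \<subseteq> chains L n"
  using vectorspace_chain_space[of L n]
  by (auto simp: vectorspace_def submodule_def chain.subspace_def)

text \<open>The relations are defined by a span relative to a carrier. As the operations on chains are those of the
  type, it agrees with the span of the type-based theory.\<close>

lemma span_chain_space:
  fixes L :: "('f::field, 'v, 'z) graded_space_scheme"
  assumes "G \<subseteq> chains L n"
  shows "LinearCombinations.module.span class_ring (chain_space L n) G = chain.span G"
proof -
  interpret C: vectorspace "class_ring :: 'f ring" "chain_space L n" by (rule vectorspace_chain_space)
  have "chain.span G \<subseteq> chains L n"
    using assms subspace_chains by (rule chain.span_minimal)
  then have "submodule class_ring (chain.span G) (chain_space L n)"
    by (simp add: submodule_chain_space)
  then have "C.span G \<subseteq> chain.span G"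
    by (intro C.span_is_subset) (auto intro: chain.span_base)
  moreover have "submodule class_ring (C.span G) (chain_space L n)"
    using assms by (rule C.span_is_submodule)
  then have "chain.span G \<subseteq> C.span G"
    using C.in_own_span[OF assms] by (intro chain.span_minimal) (auto simp: submodule_chain_space)
  ultimately show ?thesis by blast
qed

lemma words_append: "u @ l # v \<in> words L n \<longleftrightarrow>
   length u + length v + 1 = n \<and> (\<forall>(a, x)\<in>set u. x \<in> part L a) \<and> snd l \<in> part L (fst l) \<and> (\<forall>(a, x)\<in>set v. x \<in> part L a)"
  by (auto simp: words_def case_prod_beta)

lemma words_2: "w \<in> words L 2 \<longleftrightarrow> (\<exists>a x b y. w = [(a, x), (b, y)] \<and> x \<in> part L a \<and> y \<in> part L b)"
  by (auto simp: words_def length_Suc_conv numeral_2_eq_2)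

lemma words_3: "w \<in> words L 3 \<longleftrightarrow>
    (\<exists>a x b y c z. w = [(a, x), (b, y), (c, z)] \<and> x \<in> part L a \<and> y \<in> part L b \<and> z \<in> part L c)"
  by (auto simp: words_def length_Suc_conv numeral_3_eq_3)

lemma words_1: "w \<in> words L (Suc 0) \<longleftrightarrow> (\<exists>a x. w = [(a, x)] \<and> x \<in> part L a)"
  by (auto simp: words_def length_Suc_conv)

section \<open>The relations of the super exterior power\<close>

text \<open>This is all that calculations with the relations require of L; for a quotient of H it is
  immediate.\<close>

locale graded_parts =
  fixes L :: "('f::field, 'v, 'z) graded_space_scheme"
  assumes part_add: "\<And>a x y. x \<in> part L a \<Longrightarrow> y \<in> part L a \<Longrightarrow> x \<oplus>\<^bsub>L\<^esub> y \<in> part L a"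
    and part_smult: "\<And>a c x. x \<in> part L a \<Longrightarrow> c \<odot>\<^bsub>L\<^esub> x \<in> part L a"
begin

definition ext_gens :: "nat \<Rightarrow> ('f, 'v) chain set" where
  "ext_gens n = {gen (u @ (a, x \<oplus>\<^bsub>L\<^esub> y) # v) - gen (u @ (a, x) # v) - gen (u @ (a, y) # v) |u a x y v.
        u @ (a, x) # v \<in> words L n \<and> u @ (a, y) # v \<in> words L n} \<union>
     {gen (u @ (a, c \<odot>\<^bsub>L\<^esub> x) # v) - cscale c (gen (u @ (a, x) # v)) |u a c x v.
        u @ (a, x) # v \<in> words L n} \<union>
     {gen (u @ (a, x) # (b, y) # v) + cscale (psign (a * b)) (gen (u @ (b, y) # (a, x) # v)) |u a x b y v.
        u @ (a, x) # (b, y) # v \<in> words L n}"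

lemma ext_gens_chains: "ext_gens n \<subseteq> chains L n"
proof -
  note * = chain.subspace_add[OF subspace_chains] chain.subspace_diff[OF subspace_chains]
  show ?thesis
    unfolding ext_gens_def
    by (auto intro!: * gen_in_chains simp: words_append part_add part_smult)
qed

lemma ext_rel_eq: "ext_rel L n = chain.span (ext_gens n)"
  using span_chain_space[OF ext_gens_chains[of n]] unfolding ext_rel_def ext_gens_def .

lemma subspace_ext_rel: "chain.subspace (ext_rel L n)"
  by (simp add: ext_rel_eq)

lemma ext_rel_chains: "ext_rel L n \<subseteq> chains L n"
  unfolding ext_rel_eq using ext_gens_chains subspace_chains by (rule chain.span_minimal)

lemma ext_rel_add_letter:
  assumes "u @ (a, x) # v \<in> words L n" "u @ (a, y) # v \<in> words L n"
  shows "gen (u @ (a, x \<oplus>\<^bsub>L\<^esub> y) # v) - gen (u @ (a, x) # v) - gen (u @ (a, y) # v) \<in> ext_rel L n"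
  unfolding ext_rel_eq by (rule chain.span_base) (unfold ext_gens_def, use assms in blast)

lemma ext_rel_smult_letter:
  assumes "u @ (a, x) # v \<in> words L n"
  shows "gen (u @ (a, c \<odot>\<^bsub>L\<^esub> x) # v) - cscale c (gen (u @ (a, x) # v)) \<in> ext_rel L n"
  unfolding ext_rel_eq by (rule chain.span_base) (unfold ext_gens_def, use assms in blast)

lemma ext_rel_swap:
  assumes "u @ (a, x) # (b, y) # v \<in> words L n"
  shows "gen (u @ (a, x) # (b, y) # v) + cscale (psign (a * b)) (gen (u @ (b, y) # (a, x) # v)) \<in> ext_rel L n"
  unfolding ext_rel_eq by (rule chain.span_base) (unfold ext_gens_def, use assms in blast)

text \<open>The zero vector appears as \<open>0 \<odot> x\<close> because nothing is known about the zero of L.\<close>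

lemma ext_rel_null_letter:
  assumes "u @ (a, x) # v \<in> words L n"
  shows "Poly_Mapping.single (u @ (a, 0 \<odot>\<^bsub>L\<^esub> x) # v) c \<in> ext_rel L n"
  using chain.subspace_scale[OF subspace_ext_rel ext_rel_smult_letter[OF assms, of 0], of c] by simp

lemma ext_rel_in_subspace:
  assumes p: "p \<in> ext_rel L n" and "chain.subspace V"
    and "\<And>u a x y v. u @ (a, x) # v \<in> words L n \<Longrightarrow> u @ (a, y) # v \<in> words L n \<Longrightarrow>
      gen (u @ (a, x \<oplus>\<^bsub>L\<^esub> y) # v) - gen (u @ (a, x) # v) - gen (u @ (a, y) # v) \<in> V"
    and "\<And>u a c x v. u @ (a, x) # v \<in> words L n \<Longrightarrow>
      gen (u @ (a, c \<odot>\<^bsub>L\<^esub> x) # v) - cscale c (gen (u @ (a, x) # v)) \<in> V"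
    and "\<And>u a x b y v. u @ (a, x) # (b, y) # v \<in> words L n \<Longrightarrow>
      gen (u @ (a, x) # (b, y) # v) + cscale (psign (a * b)) (gen (u @ (b, y) # (a, x) # v)) \<in> V"
  shows "p \<in> V"
proof -
  have "ext_gens n \<subseteq> V" unfolding ext_gens_def using assms(3-5) by blast
  then show ?thesis using p chain.span_minimal[OF _ assms(2)] unfolding ext_rel_eq by blast
qed

end

section \<open>Homology classes\<close>

text \<open>The cosets of the boundaries are the same sets whether they are formed among the cycles or among all
  chains.\<close>

definition hclass ::
  "('f::field, 'v, 'z) lie_superalg_scheme \<Rightarrow> nat \<Rightarrow> ('f, 'v) chain \<Rightarrow> ('f, 'v) chain set" where
  "hclass L n p = (\<lambda>b. b + p) ` boundaries L n"

lemma boundaries_eq: "boundaries L n = {boundary L q + r |q r. q \<in> chains L (Suc n) \<and> r \<in> ext_rel L n}"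
  unfolding boundaries_def set_add_def' by (auto simp: chain_space_def)

lemma carrier_homology: "carrier (homology L n) = hclass L n ` cycles L n"
  by (auto simp: homology_def quot_space_def sub_space_def A_RCOSETS_def' a_r_coset_def' hclass_def)

lemma zero_homology: "\<zero>\<^bsub>homology L n\<^esub> = boundaries L n"
  by (simp add: homology_def quot_space_def)

lemma part_homology: "part (homology L n) a = hclass L n ` (part (chain_space L n) a \<inter> cycles L n)"
  by (auto simp: homology_def quot_space_def sub_space_def a_r_coset_def' hclass_def)

lemma add_homology: "A \<oplus>\<^bsub>homology L n\<^esub> B = {p + q |p q. p \<in> A \<and> q \<in> B}"
  by (auto simp: homology_def quot_space_def sub_space_def set_add_def')

lemma smult_homology: "c \<odot>\<^bsub>homology L n\<^esub> A = (\<Union>p\<in>A. hclass L n (cscale c p))"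
  by (auto simp: homology_def quot_space_def sub_space_def a_r_coset_def' hclass_def)

lemma homology_map_eq: "homology_map L' n h A =
    (\<Union>p\<in>A. hclass L' n (lin_ext (\<lambda>w. gen (map (map_prod id h) w)) p))"
  by (auto simp: homology_map_def coset_map_def a_r_coset_def' hclass_def)

locale lie_parts = graded_parts L for L :: "('f::field, 'v, 'z) lie_superalg_scheme" +
  assumes brak_part: "\<And>a b x y. x \<in> part L a \<Longrightarrow> y \<in> part L b \<Longrightarrow> lbrak L x y \<in> part L (a + b)"
begin

text \<open>Each term of a boundary is a multiple of a word that begins with a bracket. Many facts about boundaries
  follow from this alone, without signs or positions.\<close>

lemma boundary_in_subspace:
  assumes "q \<in> chains L (Suc n)" and V: "chain.subspace V"
    and gens: "\<And>a x b y v. x \<in> part L a \<Longrightarrow> y \<in> part L b \<Longrightarrow>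
      (a + b, lbrak L x y) # v \<in> words L n \<Longrightarrow> gen ((a + b, lbrak L x y) # v) \<in> V"
  shows "boundary L q \<in> V"
proof (rule CollectD[of q "\<lambda>q. boundary L q \<in> V"], rule chains_in_subspace[OF assms(1)])
  show "chain.subspace {q. boundary L q \<in> V}" using V by (rule subspace_vimage_lin_ext)
  fix w assume w: "w \<in> words L (Suc n)"
  have "Poly_Mapping.single ((fst (w ! i) + fst (w ! j), lbrak L (snd (w ! i)) (snd (w ! j))) # nths w (- {i, j})) c \<in> V"
    if ij: "i < j" "j < length w" for i j c
  proof -
    have len: "length w = Suc n" and l: "\<And>l. l \<in> set w \<Longrightarrow> snd l \<in> part L (fst l)"
      using w by (auto simp: words_def)
    have "{k. k < Suc n \<and> k \<in> - {i, j}} = {..n} - {i, j}" by auto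
    then have "length (nths w (- {i, j})) = n - 1"
      using ij len by (simp add: length_nths card_Diff_subset)
    moreover have "n \<ge> 1" using ij len by auto
    moreover have "set (nths w (- {i, j})) \<subseteq> set w" by (rule set_nths_subset)
    ultimately have "(fst (w ! i) + fst (w ! j), lbrak L (snd (w ! i)) (snd (w ! j))) # nths w (- {i, j}) \<in> words L n"
      using l ij brak_part by (auto simp: words_def)
    then have "gen ((fst (w ! i) + fst (w ! j), lbrak L (snd (w ! i)) (snd (w ! j))) # nths w (- {i, j})) \<in> V"
      using l ij by (intro gens) auto
    from chain.subspace_scale[OF V this, of c] show ?thesis by simp
  qed
  then show "gen w \<in> {q. boundary L q \<in> V}"
    by (auto simp: word_boundary_def intro!: chain.subspace_sum[OF V])
qed

lemma boundary_chains: "q \<in> chains L (Suc n) \<Longrightarrow> boundary L q \<in> chains L n"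
  by (erule boundary_in_subspace[OF _ subspace_chains]) (rule gen_in_chains)

lemma subspace_boundaries: "chain.subspace (boundaries L n)"
proof -
  have "0 \<in> boundary L ` chains L (Suc n)"
    by (rule image_eqI[of _ _ 0]) (simp_all add: chain.subspace_0 subspace_chains)
  then have "chain.subspace (boundary L ` chains L (Suc n))"
    using subspace_chains[of L "Suc n"]
    by (auto simp: chain.subspace_def lin_ext_simps[symmetric])
  from chain.subspace_sums[OF this subspace_ext_rel]
  show ?thesis unfolding boundaries_eq by (rule back_subst[of chain.subspace]) blast
qed

lemma ext_rel_boundaries: "ext_rel L n \<subseteq> boundaries L n"
  unfolding boundaries_eq using subspace_chains[of L "Suc n"]
  by (force intro: exI[of _ 0] chain.subspace_0)

lemma hclass_self: "p \<in> hclass L n p"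
  unfolding hclass_def using chain.subspace_0[OF subspace_boundaries] by force

lemma mem_hclass: "q \<in> hclass L n p \<longleftrightarrow> q - p \<in> boundaries L n"
  unfolding hclass_def by (auto simp: image_iff) (metis diff_add_cancel)

lemma hclass_eq_iff: "hclass L n p = hclass L n q \<longleftrightarrow> p - q \<in> boundaries L n"
proof
  assume "hclass L n p = hclass L n q"
  then show "p - q \<in> boundaries L n" using hclass_self mem_hclass by blast
next
  assume pq: "p - q \<in> boundaries L n"
  have "r - p \<in> boundaries L n \<longleftrightarrow> r - q \<in> boundaries L n" for r
    using chain.subspace_add[OF subspace_boundaries[of n], of "r - p" "p - q"]
      chain.subspace_diff[OF subspace_boundaries[of n], of "r - q" "p - q"] pq by auto
  then show "hclass L n p = hclass L n q" by (auto simp: mem_hclass)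
qed

lemma hclass_zero: "hclass L n 0 = boundaries L n"
  by (simp add: hclass_def)

lemma hclass_zero_iff: "hclass L n p = boundaries L n \<longleftrightarrow> p \<in> boundaries L n"
  using hclass_eq_iff[of n p 0] by (simp add: hclass_zero)

lemma hclass_add: "hclass L n p \<oplus>\<^bsub>homology L n\<^esub> hclass L n q = hclass L n (p + q)"
proof -
  have "r \<in> hclass L n (p + q) \<longleftrightarrow> (\<exists>p' q'. r = p' + q' \<and> p' \<in> hclass L n p \<and> q' \<in> hclass L n q)" for r
  proof
    assume "r \<in> hclass L n (p + q)"
    then have "r - q \<in> hclass L n p" by (simp add: mem_hclass algebra_simps)
    then show "\<exists>p' q'. r = p' + q' \<and> p' \<in> hclass L n p \<and> q' \<in> hclass L n q"
      using hclass_self by (intro exI[of _ "r - q"] exI[of _ q]) auto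
  next
    assume "\<exists>p' q'. r = p' + q' \<and> p' \<in> hclass L n p \<and> q' \<in> hclass L n q"
    then obtain p' q' where "r = p' + q'" "p' - p \<in> boundaries L n" "q' - q \<in> boundaries L n"
      by (auto simp: mem_hclass)
    then show "r \<in> hclass L n (p + q)"
      using chain.subspace_add[OF subspace_boundaries[of n], of "p' - p" "q' - q"]
      by (simp add: mem_hclass algebra_simps)
  qed
  then show ?thesis by (auto simp: add_homology)
qed

lemma hclass_smult: "c \<odot>\<^bsub>homology L n\<^esub> hclass L n p = hclass L n (cscale c p)"
proof -
  have "hclass L n (cscale c q) = hclass L n (cscale c p)" if "q \<in> hclass L n p" for q
    using that chain.subspace_scale[OF subspace_boundaries[of n], of "q - p" c]
    by (simp add: hclass_eq_iff mem_hclass chain.scale_right_diff_distrib)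
  then show ?thesis unfolding smult_homology using hclass_self by blast
qed

end

section \<open>The Heisenberg superalgebra and its quotients\<close>

(* Parities stay sums and products, as in the statements of the lemmas, instead of becoming
   Boolean expressions. *)
declare add_bit_eq_xor [simp del] mult_bit_eq_and [simp del]

definition hz :: "heis_basis \<Rightarrow> 'f::field" where
  "hz = (\<lambda>b. if b = HZ then 1 else 0)"

abbreviation (input) fscale :: "'f::field \<Rightarrow> (heis_basis \<Rightarrow> 'f) \<Rightarrow> heis_basis \<Rightarrow> 'f" where
  "fscale c f \<equiv> (\<lambda>b. c * f b)"

definition omega :: "nat \<Rightarrow> (heis_basis \<Rightarrow> 'f::field) \<Rightarrow> (heis_basis \<Rightarrow> 'f) \<Rightarrow> 'f" where
  "omega m x y = (\<Sum>j\<in>{1..m}. x (HX j) * y (HY j) - x (HY j) * y (HX j))"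

fun par :: "heis_basis \<Rightarrow> bit" where
  "par (HX _) = 0" | "par (HY _) = 1" | "par HZ = 1"

definition heis_index :: "nat \<Rightarrow> heis_basis set" where
  "heis_index m = HX ` {1..m} \<union> (HY ` {1..m} \<union> {HZ})"

lemma heis_even_Un_odd: "heis_even m \<union> heis_odd m = heis_index m"
  by (auto simp: heis_index_def heis_even_def heis_odd_def)

lemma heis_simps [simp]:
  "x \<oplus>\<^bsub>heisenberg m\<^esub> y = x + y" "c \<odot>\<^bsub>heisenberg m\<^esub> x = fscale c x" "\<zero>\<^bsub>heisenberg m\<^esub> = 0"
  "lbrak (heisenberg m) x y = fscale (omega m x y) hz"
  by (auto simp: heisenberg_def plus_fun_def zero_fun_def omega_def hz_def)

lemma finite_heis_index [simp]: "finite (heis_index m)"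
  by (simp add: heis_index_def)

lemma HZ_index [simp]: "HZ \<in> heis_index m"
  by (simp add: heis_index_def)

lemma carrier_heis: "x \<in> carrier (heisenberg m) \<longleftrightarrow> (\<forall>b. x b \<noteq> 0 \<longrightarrow> b \<in> heis_index m)"
  unfolding heis_even_Un_odd[symmetric] by (simp add: heisenberg_def)

lemma part_heis: "x \<in> part (heisenberg m) a \<longleftrightarrow> (\<forall>b. x b \<noteq> 0 \<longrightarrow> b \<in> heis_index m \<and> par b = a)"
proof -
  have 1: "a = 0 \<or> a = 1" by (cases a) auto
  have 2: "b \<in> (if a = 0 then heis_even m else heis_odd m) \<longleftrightarrow> b \<in> heis_index m \<and> par b = a" for b
    using 1 by (auto simp: heis_index_def heis_even_def heis_odd_def)
  show ?thesis by (simp add: heisenberg_def[of m] 2 split del: if_split)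
qed

lemma part_carrier_heis: "x \<in> part (heisenberg m) a \<Longrightarrow> x \<in> carrier (heisenberg m)"
  by (auto simp: part_heis carrier_heis)

lemma hz_part: "hz \<in> part (heisenberg m) 1"
  by (auto simp: part_heis hz_def)

lemma hz_carrier: "hz \<in> carrier (heisenberg m)"
  using hz_part by (rule part_carrier_heis)

lemma omega_add: "omega m (x + x') y = omega m x y + omega m x' y" "omega m x (y + y') = omega m x y + omega m x y'"
  by (simp_all add: omega_def sum.distrib[symmetric] algebra_simps)

lemma omega_scale: "omega m (fscale c x) y = c * omega m x y" "omega m x (fscale c y) = c * omega m x y"
  by (simp_all add: omega_def sum_distrib_left algebra_simps)

lemma omega_skew: "omega m y x = - omega m x y"
  by (simp add: omega_def sum_negf[symmetric] algebra_simps)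

lemma omega_hz [simp]: "omega m hz y = 0" "omega m y hz = 0"
  by (simp_all add: omega_def hz_def)

lemma omega_parity:
  assumes "x \<in> part (heisenberg m) a" "y \<in> part (heisenberg m) b" "a + b \<noteq> 1"
  shows "omega m x y = 0"
proof -
  have "a = b" using assms(3) by (cases a; cases b) auto
  have "x (HX j) * y (HY j) - x (HY j) * y (HX j) = 0" for j
  proof -
    have "x (HX j) = 0 \<or> y (HY j) = 0" "x (HY j) = 0 \<or> y (HX j) = 0"
      using assms(1,2) \<open>a = b\<close> unfolding part_heis by (metis par.simps(1,2) zero_neq_one)+
    then show ?thesis by auto
  qed
  then show ?thesis by (simp add: omega_def)
qed

lemma part_heis_add: "x \<in> part (heisenberg m) a \<Longrightarrow> y \<in> part (heisenberg m) a \<Longrightarrow> x + y \<in> part (heisenberg m) a"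
  unfolding part_heis by (metis add.right_neutral plus_fun_apply)

lemma part_heis_scale: "x \<in> part (heisenberg m) a \<Longrightarrow> fscale c x \<in> part (heisenberg m) a"
  by (auto simp: part_heis)

lemma brak_heis_part:
  assumes "x \<in> part (heisenberg m) a" "y \<in> part (heisenberg m) b"
  shows "fscale (omega m x y) hz \<in> part (heisenberg m) (a + b)"
proof (cases "a + b = 1")
  case True
  then show ?thesis using hz_part part_heis_scale by metis
next
  case False
  then show ?thesis using omega_parity[OF assms] by (simp add: part_heis)
qed

interpretation heis: lie_parts "heisenberg m :: ('f::field, heis_basis \<Rightarrow> 'f) lie_superalg" for m
  by unfold_locales
     (simp_all only: heis_simps part_heis_add part_heis_scale brak_heis_part)

text \<open>Every subspace that contains z is an ideal with abelian quotient, since all brackets are multiples of z.\<close>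

locale heis_quotient =
  fixes m :: nat and J :: "(heis_basis \<Rightarrow> 'f::field) set"
  assumes J_carrier: "J \<subseteq> carrier (heisenberg m)"
    and J_zero: "0 \<in> J"
    and J_add: "x \<in> J \<Longrightarrow> y \<in> J \<Longrightarrow> x + y \<in> J"
    and J_scale: "x \<in> J \<Longrightarrow> fscale c x \<in> J"
    and hz_J: "hz \<in> J"
begin

abbreviation H :: "('f, heis_basis \<Rightarrow> 'f) lie_superalg" where "H \<equiv> heisenberg m"
abbreviation Q :: "('f, (heis_basis \<Rightarrow> 'f) set) lie_superalg" where "Q \<equiv> quot_lie H J"
abbreviation proj :: "(heis_basis \<Rightarrow> 'f) \<Rightarrow> (heis_basis \<Rightarrow> 'f) set" where "proj \<equiv> (\<lambda>x. J +>\<^bsub>H\<^esub> x)"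

lemma J_uminus: "x \<in> J \<Longrightarrow> - x \<in> J"
  using J_scale[of x "- 1"] by (simp add: fun_Compl_def)

lemma J_diff: "x \<in> J \<Longrightarrow> y \<in> J \<Longrightarrow> x - y \<in> J"
  using J_add[of x "- y"] J_uminus[of y] by simp

lemma proj_eq: "proj x = (\<lambda>j. j + x) ` J"
  by (auto simp: a_r_coset_def')

lemma mem_proj: "y \<in> proj x \<longleftrightarrow> y - x \<in> J"
  by (auto simp: proj_eq image_iff) (metis diff_add_cancel)

lemma proj_eq_iff: "proj x = proj y \<longleftrightarrow> x - y \<in> J"
proof
  assume "proj x = proj y"
  then show "x - y \<in> J" using mem_proj[of x x] mem_proj[of x y] J_zero by simp
next
  assume xy: "x - y \<in> J"
  have "r - x \<in> J \<longleftrightarrow> r - y \<in> J" for r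
    using J_add[of "r - x" "x - y"] J_diff[of "r - y" "x - y"] xy by auto
  then show "proj x = proj y" by (intro Set.set_eqI) (simp only: mem_proj)
qed

lemma proj_J: "x \<in> J \<Longrightarrow> proj x = J"
  using proj_eq_iff[of x 0] by (simp add: proj_eq)

lemma part_Q: "part Q a = proj ` part H a"
  by (simp add: quot_lie_def quot_space_def graded_space.defs lie_superalg.defs)

lemma proj_add: "proj x \<oplus>\<^bsub>Q\<^esub> proj y = proj (x + y)"
proof -
  have "{x' + y' |x' y'. x' \<in> proj x \<and> y' \<in> proj y} = proj (x + y)"
  proof (intro Set.set_eqI iffI)
    fix r assume "r \<in> proj (x + y)"
    then have "r - y \<in> proj x" by (simp only: mem_proj diff_diff_eq add.commute)
    moreover have "y \<in> proj y" by (simp only: mem_proj diff_self J_zero)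
    moreover have "r = (r - y) + y" by simp
    ultimately show "r \<in> {x' + y' |x' y'. x' \<in> proj x \<and> y' \<in> proj y}" by blast
  next
    fix r assume "r \<in> {x' + y' |x' y'. x' \<in> proj x \<and> y' \<in> proj y}"
    then obtain x' y' where "r = x' + y'" "x' - x \<in> J" "y' - y \<in> J" by (auto simp only: mem_proj)
    moreover have "x' + y' - (x + y) = (x' - x) + (y' - y)" by simp
    ultimately show "r \<in> proj (x + y)" by (simp only: mem_proj J_add)
  qed
  moreover have "proj x \<oplus>\<^bsub>Q\<^esub> proj y = {x' + y' |x' y'. x' \<in> proj x \<and> y' \<in> proj y}"
    unfolding quot_lie_def quot_space_def graded_space.defs lie_superalg.defs set_add_def'
    by (auto simp del: ex_simps)
  ultimately show ?thesis by (rule trans[rotated])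
qed

lemma proj_smult: "c \<odot>\<^bsub>Q\<^esub> proj x = proj (fscale c x)"
proof -
  have "proj (fscale c y) = proj (fscale c x)" if "y \<in> proj x" for y
  proof -
    have "fscale c (y - x) = fscale c y - fscale c x" by (simp add: fun_eq_iff algebra_simps)
    then show ?thesis using that J_scale[of "y - x" c] by (simp only: proj_eq_iff mem_proj)
  qed
  moreover have "x \<in> proj x" by (simp only: mem_proj diff_self J_zero)
  ultimately have "(\<Union>y\<in>proj x. proj (fscale c y)) = proj (fscale c x)" by blast
  then show ?thesis
    by (simp add: quot_lie_def quot_space_def graded_space.defs lie_superalg.defs)
qed

lemma lbrak_Q: "lbrak Q (proj x) (proj y) = J"
proof -
  have "proj (fscale c hz) = J" for c using J_scale[OF hz_J] by (rule proj_J)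
  moreover have "x \<in> proj x" "y \<in> proj y" by (simp_all only: mem_proj diff_self J_zero)
  ultimately show ?thesis
    by (auto simp: quot_lie_def quot_space_def graded_space.defs lie_superalg.defs)
qed

lemma J_part_Q: "J \<in> part Q a"
proof -
  have "proj 0 \<in> proj ` part H a" by (rule imageI) (simp add: part_heis)
  then show ?thesis by (simp only: part_Q proj_J[OF J_zero])
qed

sublocale Q: lie_parts Q
proof
  fix a b X Y assume X: "X \<in> part Q a" and Y: "Y \<in> part Q b"
  show "lbrak Q X Y \<in> part Q (a + b)"
    using X Y J_part_Q unfolding part_Q by (auto simp: lbrak_Q)
qed (auto simp: part_Q proj_add proj_smult intro!: imageI part_heis_add part_heis_scale)

abbreviation pword :: "(bit \<times> (heis_basis \<Rightarrow> 'f)) list \<Rightarrow> (bit \<times> (heis_basis \<Rightarrow> 'f) set) list" where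
  "pword \<equiv> map (map_prod id proj)"

abbreviation pchain :: "('f, heis_basis \<Rightarrow> 'f) chain \<Rightarrow> ('f, (heis_basis \<Rightarrow> 'f) set) chain" where
  "pchain \<equiv> lin_ext (\<lambda>w. gen (pword w))"

lemma pword_words: "w \<in> words H n \<Longrightarrow> pword w \<in> words Q n"
  by (fastforce simp: words_def part_Q)

lemma letters_lift:
  assumes "\<forall>(a, X)\<in>set u. X \<in> part Q a"
  shows "\<exists>u'. u = pword u' \<and> (\<forall>(a, x)\<in>set u'. x \<in> part H a)"
  using assms
proof (induction u)
  case (Cons l u)
  obtain a X where l: "l = (a, X)" by (cases l)
  with Cons.prems obtain x where "X = proj x" "x \<in> part H a" by (auto simp: part_Q)
  moreover have "\<exists>u'. u = pword u' \<and> (\<forall>(a, x)\<in>set u'. x \<in> part H a)"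
    by (rule Cons.IH) (use Cons.prems in auto)
  then obtain u' where "u = pword u'" "\<forall>(a, x)\<in>set u'. x \<in> part H a" by blast
  ultimately show ?case by (intro exI[of _ "(a, x) # u'"]) (auto simp: l)
qed simp

lemma words_lift: "W \<in> words Q n \<Longrightarrow> \<exists>w\<in>words H n. W = pword w"
  using letters_lift[of W] by (auto simp: words_def)

lemma pchain_chains: "p \<in> chains H n \<Longrightarrow> pchain p \<in> chains Q n"
  by (rule CollectD[of p "\<lambda>p. pchain p \<in> chains Q n"], erule chains_in_subspace)
     (auto intro: subspace_vimage_lin_ext subspace_chains gen_in_chains pword_words)

lemma chains_lift: "P \<in> chains Q n \<Longrightarrow> \<exists>p\<in>chains H n. P = pchain p"
proof -
  assume P: "P \<in> chains Q n"
  have "P \<in> pchain ` chains H n"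
  proof (rule chains_in_subspace[OF P])
    have "0 \<in> pchain ` chains H n"
      by (rule image_eqI[of _ _ 0]) (simp_all add: chain.subspace_0 subspace_chains)
    then show "chain.subspace (pchain ` chains H n)"
      using subspace_chains[of H n] by (auto simp: chain.subspace_def lin_ext_simps[symmetric])
    fix W assume "W \<in> words Q n"
    then obtain w where "w \<in> words H n" "W = pword w" using words_lift by blast
    then show "gen W \<in> pchain ` chains H n"
      by (intro image_eqI[of _ _ "gen w"]) (auto intro: gen_in_chains)
  qed
  then show ?thesis by blast
qed

text \<open>Letters of Q lift to H, and so do the relations, one letter at a time.\<close>

lemma ext_rel_Q_in_subspace:
  assumes P: "P \<in> ext_rel Q n" and V: "chain.subspace V"
    and lift: "\<And>p. p \<in> ext_rel H n \<Longrightarrow> pchain p \<in> V"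
  shows "P \<in> V"
proof (rule Q.ext_rel_in_subspace[OF P V])
  fix u v :: "(bit \<times> (heis_basis \<Rightarrow> 'f) set) list" and a b X Y and c :: 'f
  { assume *: "u @ (a, X) # v \<in> words Q n" "u @ (a, Y) # v \<in> words Q n"
    then obtain u' v' x y where l: "u = pword u'" "v = pword v'" "X = proj x" "Y = proj y"
      and "\<forall>(a, x)\<in>set u'. x \<in> part H a" "\<forall>(a, x)\<in>set v'. x \<in> part H a" "x \<in> part H a" "y \<in> part H a"
      using letters_lift[of u] letters_lift[of v] by (auto simp: words_append part_Q)
    then have "u' @ (a, x) # v' \<in> words H n" "u' @ (a, y) # v' \<in> words H n"
      using * by (auto simp: words_append)
    from lift[OF heis.ext_rel_add_letter[OF this]]
    show "gen (u @ (a, X \<oplus>\<^bsub>Q\<^esub> Y) # v) - gen (u @ (a, X) # v) - gen (u @ (a, Y) # v) \<in> V"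
      by (simp add: l lin_ext_simps proj_add) }
  { assume *: "u @ (a, X) # v \<in> words Q n"
    then obtain u' v' x where l: "u = pword u'" "v = pword v'" "X = proj x"
      and "\<forall>(a, x)\<in>set u'. x \<in> part H a" "\<forall>(a, x)\<in>set v'. x \<in> part H a" "x \<in> part H a"
      using letters_lift[of u] letters_lift[of v] by (auto simp: words_append part_Q)
    then have "u' @ (a, x) # v' \<in> words H n"
      using * by (auto simp: words_append)
    from lift[OF heis.ext_rel_smult_letter[OF this, of c]]
    show "gen (u @ (a, c \<odot>\<^bsub>Q\<^esub> X) # v) - cscale c (gen (u @ (a, X) # v)) \<in> V"
      by (simp add: l lin_ext_simps proj_smult) }
  { assume *: "u @ (a, X) # (b, Y) # v \<in> words Q n"
    then obtain u' v' x y where l: "u = pword u'" "v = pword v'" "X = proj x" "Y = proj y"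
      and "\<forall>(a, x)\<in>set u'. x \<in> part H a" "\<forall>(a, x)\<in>set v'. x \<in> part H a" "x \<in> part H a" "y \<in> part H b"
      using letters_lift[of u] letters_lift[of v] by (auto simp: words_append part_Q)
    then have "u' @ (a, x) # (b, y) # v' \<in> words H n"
      using * by (auto simp: words_append)
    from lift[OF heis.ext_rel_swap[OF this]]
    show "gen (u @ (a, X) # (b, Y) # v) + cscale (psign (a * b)) (gen (u @ (b, Y) # (a, X) # v)) \<in> V"
      by (simp add: l lin_ext_simps) }
qed

text \<open>A functional \<phi> that depends on the letters modulo J only descends to chains of Q, by evaluating it on
  lifts of words, and there it kills the relations as they lift to relations. This gives functionals on
  exterior powers of Q without any choice of coordinates on Q.\<close>

lemma leval_vanishes_if_pchain_ext_rel:
  assumes kills: "\<And>p. p \<in> ext_rel H n \<Longrightarrow> leval \<phi> p = 0"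
    and inv: "\<And>w w'. w \<in> words H n \<Longrightarrow> w' \<in> words H n \<Longrightarrow> pword w = pword w' \<Longrightarrow> \<phi> w = \<phi> w'"
    and p: "p \<in> chains H n" "pchain p \<in> ext_rel Q n"
  shows "leval \<phi> p = 0"
proof -
  define \<psi> where "\<psi> W = \<phi> (SOME w. w \<in> words H n \<and> pword w = W)" for W
  have \<psi>: "\<psi> (pword w) = \<phi> w" if "w \<in> words H n" for w
    unfolding \<psi>_def
  proof (rule someI2[of _ w])
    show "w \<in> words H n \<and> pword w = pword w" using that by blast
    show "\<phi> w' = \<phi> w" if "w' \<in> words H n \<and> pword w' = pword w" for w'
      using that \<open>w \<in> words H n\<close> by (intro inv) blast+
  qed
  have eq: "leval \<psi> (pchain q) = leval \<phi> q" if "q \<in> chains H n" for q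
  proof (rule CollectD[of q "\<lambda>q. leval \<psi> (pchain q) = leval \<phi> q"], rule chains_in_subspace[OF that])
    show "chain.subspace {q. leval \<psi> (pchain q) = leval \<phi> q}"
      by (auto simp: chain.subspace_def leval_simps lin_ext_simps)
  qed (simp add: \<psi>)
  have "pchain p \<in> {q. leval \<psi> q = 0}"
  proof (rule ext_rel_Q_in_subspace[OF p(2) subspace_leval_zero])
    fix q assume "q \<in> ext_rel H n"
    then show "pchain q \<in> {q. leval \<psi> q = 0}"
      using eq[of q] kills[of q] heis.ext_rel_chains[of m n] by auto
  qed
  then show ?thesis using eq[OF p(1)] by simp
qed

lemma pchain_ext_rel:
  assumes "p \<in> ext_rel H n" shows "pchain p \<in> ext_rel Q n"
proof -
  have pw: "pword u @ (a, proj x) # pword v \<in> words Q n" if "u @ (a, x) # v \<in> words H n" for u a x v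
    using pword_words[OF that] by simp
  have pw2: "pword u @ (a, proj x) # (b, proj y) # pword v \<in> words Q n"
    if "u @ (a, x) # (b, y) # v \<in> words H n" for u a x b y v
    using pword_words[OF that] by simp
  show ?thesis
    using assms
    by (rule CollectD[OF heis.ext_rel_in_subspace[where V = "{p. pchain p \<in> ext_rel Q n}"]])
       (use Q.ext_rel_add_letter[OF pw pw] Q.ext_rel_smult_letter[OF pw] Q.ext_rel_swap[OF pw2]
         in \<open>auto intro: subspace_vimage_lin_ext Q.subspace_ext_rel simp: lin_ext_simps proj_add proj_smult\<close>)
qed

lemma gen_J_letter:
  assumes "u @ (a, J) # v \<in> words Q n"
  shows "Poly_Mapping.single (u @ (a, J) # v) c \<in> ext_rel Q n"
  using Q.ext_rel_null_letter[OF assms, of c] proj_smult[of 0 0] proj_J[OF J_zero]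
  by (simp add: zero_fun_def)

lemma pchain_J_letter:
  assumes "w \<in> words H n" "(a, x) \<in> set w" "x \<in> J"
  shows "pchain (Poly_Mapping.single w c) \<in> ext_rel Q n"
proof -
  obtain u v where "w = u @ (a, x) # v" using assms(2) by (meson split_list)
  then show ?thesis using gen_J_letter[of "pword u" a "pword v" n c] pword_words[OF assms(1)] proj_J[OF assms(3)]
    by simp
qed

text \<open>In the abelian superalgebra Q each term of a boundary has a zero letter.\<close>

lemma boundary_Q: "q \<in> chains Q (Suc n) \<Longrightarrow> boundary Q q \<in> ext_rel Q n"
proof (erule Q.boundary_in_subspace[OF _ Q.subspace_ext_rel])
  fix a X b Y v assume "X \<in> part Q a" "Y \<in> part Q b" and *: "(a + b, lbrak Q X Y) # v \<in> words Q n"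
  then have "lbrak Q X Y = J" by (auto simp: part_Q lbrak_Q)
  then show "gen ((a + b, lbrak Q X Y) # v) \<in> ext_rel Q n"
    using gen_J_letter[of "[]"] * by simp
qed

lemma boundaries_Q: "boundaries Q n = ext_rel Q n"
  using Q.ext_rel_boundaries boundary_Q chain.subspace_add[OF Q.subspace_ext_rel]
  by (fastforce simp: boundaries_eq)

lemma cycles_Q: "cycles Q (Suc n) = chains Q (Suc n)"
  using boundary_Q by (auto simp: cycles_def)

lemma pchain_boundary: "q \<in> chains H (Suc n) \<Longrightarrow> pchain (boundary H q) \<in> ext_rel Q n"
proof (rule CollectD[of "boundary H q" "\<lambda>p. pchain p \<in> ext_rel Q n"], erule heis.boundary_in_subspace)
  fix a x b y v assume "(a + b, lbrak H x y) # v \<in> words H n"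
  then show "gen ((a + b, lbrak H x y) # v) \<in> {p. pchain p \<in> ext_rel Q n}"
    by (intro CollectI pchain_J_letter[of _ _ "a + b" "lbrak H x y"])
       (simp_all only: heis_simps J_scale[OF hz_J] list.set insert_iff simp_thms)
qed (intro subspace_vimage_lin_ext Q.subspace_ext_rel)

lemma pchain_boundaries: "p \<in> boundaries H n \<Longrightarrow> pchain p \<in> ext_rel Q n"
  using pchain_boundary pchain_ext_rel chain.subspace_add[OF Q.subspace_ext_rel]
  by (fastforce simp: boundaries_eq lin_ext_simps)

lemma homology_map_hclass: "homology_map Q n proj (hclass H n p) = hclass Q n (pchain p)"
proof -
  have "hclass Q n (pchain q) = hclass Q n (pchain p)" if "q \<in> hclass H n p" for q
    using that pchain_boundaries[of "q - p" n]
    by (simp add: Q.hclass_eq_iff heis.mem_hclass boundaries_Q lin_ext_simps)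
  then show ?thesis unfolding homology_map_eq using heis.hclass_self by blast
qed

end

section \<open>Coordinates on 2-chains\<close>

lemma sum_heis_index:
  "(\<Sum>b\<in>heis_index m. f b) = (\<Sum>i\<in>{1..m}. f (HX i)) + (\<Sum>i\<in>{1..m}. f (HY i)) + f HZ"
proof -
  have "(\<Sum>b\<in>HX ` {1..m} \<union> (HY ` {1..m} \<union> {HZ}). f b) =
      (\<Sum>b\<in>HX ` {1..m}. f b) + ((\<Sum>b\<in>HY ` {1..m}. f b) + (\<Sum>b\<in>{HZ}. f b))"
    by (subst sum.union_disjoint; (subst sum.union_disjoint)?) auto
  then show ?thesis by (simp add: heis_index_def sum.reindex inj_on_def add.assoc)
qed

lemma word_boundary_2:
  "word_boundary L [(a, x), (b, y)] = gen [(a + b, lbrak L x y)]"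
proof -
  have "{(i, j). i < j \<and> j < length [(a, x), (b, y)]} = {(0, 1)}" by auto
  then show ?thesis unfolding word_boundary_def by (simp add: pull_sign_def psign_def nths_Cons)
qed

lemma word_boundary_3:
  fixes L :: "('f::field, 'v, 'z) lie_superalg_scheme"
  shows "word_boundary L [(a, x), (b, y), (c, z)] =
    Poly_Mapping.single [(a + b, lbrak L x y), (c, z)] 1 +
    Poly_Mapping.single [(a + c, lbrak L x z), (b, y)] (- psign (c * b)) +
    Poly_Mapping.single [(b + c, lbrak L y z), (a, x)] (psign (b * a + c * a))"
proof -
  have ij: "{(i, j). i < j \<and> j < length [(a, x), (b, y), (c, z)]} = {(0, 1), (0, 2), (1, 2)}" by auto
  have sets: "{..<2} - {0 :: nat} = {1}" "{..<2} - {1 :: nat} = {0}" "{..<1} = {0 :: nat}"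
    "{..<1} - {0 :: nat} = {}" by auto
  have sign: "pull_sign [a, b, c] 0 1 = (1 :: 'f)" "pull_sign [a, b, c] 0 2 = (- psign (c * b) :: 'f)"
    "pull_sign [a, b, c] 1 2 = (psign (b * a + c * a) :: 'f)"
    unfolding pull_sign_def sets by (simp_all add: psign_def)
  have rest: "nths [(a, x), (b, y), (c, z)] (- {0, 1}) = [(c, z)]"
    "nths [(a, x), (b, y), (c, z)] (- {0, 2}) = [(b, y)]"
    "nths [(a, x), (b, y), (c, z)] (- {1, 2}) = [(a, x)]"
    by (simp_all add: nths_Cons)
  have "word_boundary L [(a, x), (b, y), (c, z)] =
    (\<Sum>(i, j)\<in>{(0, 1), (0, 2), (1, 2)}. Poly_Mapping.single
      ((fst ([(a, x), (b, y), (c, z)] ! i) + fst ([(a, x), (b, y), (c, z)] ! j),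
        lbrak L (snd ([(a, x), (b, y), (c, z)] ! i)) (snd ([(a, x), (b, y), (c, z)] ! j))) #
        nths [(a, x), (b, y), (c, z)] (- {i, j}))
      (pull_sign [a, b, c] i j))"
    unfolding word_boundary_def ij by simp
  also have "\<dots> = Poly_Mapping.single [(a + b, lbrak L x y), (c, z)] 1 +
    (Poly_Mapping.single [(a + c, lbrak L x z), (b, y)] (- psign (c * b)) +
    Poly_Mapping.single [(b + c, lbrak L y z), (a, x)] (psign (b * a + c * a)))"
    by (simp only: sum.insert finite.intros sum.empty insert_iff empty_iff prod.inject case_prod_conv
          rest sign zero_neq_one one_neq_zero simp_thms zero_neq_numeral numeral_eq_one_iff
          one_eq_numeral_iff num.distinct)
       simp
  finally show ?thesis by (simp add: add.assoc)
qed

text \<open>A homogeneous basis e of H with coordinate functionals \<xi>, indexed like the standard basis. It is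
  adapted to J: the basis vectors with \<open>i \<le> k\<close> and z span J. The coordinates are constrained on H only.\<close>

locale heis_coords = heis_quotient m J for m and J :: "(heis_basis \<Rightarrow> 'f::field) set" +
  fixes k :: nat and e :: "heis_basis \<Rightarrow> heis_basis \<Rightarrow> 'f" and \<xi> :: "heis_basis \<Rightarrow> (heis_basis \<Rightarrow> 'f) \<Rightarrow> 'f"
  assumes two: "(2::'f) \<noteq> 0" and m_pos: "m \<ge> 1" and k_le: "k \<le> m"
    and e_part: "b \<in> heis_index m \<Longrightarrow> e b \<in> part H (par b)"
    and e_HZ: "e HZ = hz"
    and \<xi>_add: "b \<in> heis_index m \<Longrightarrow> x \<in> carrier H \<Longrightarrow> y \<in> carrier H \<Longrightarrow> \<xi> b (x + y) = \<xi> b x + \<xi> b y"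
    and \<xi>_scale: "b \<in> heis_index m \<Longrightarrow> x \<in> carrier H \<Longrightarrow> \<xi> b (fscale c x) = c * \<xi> b x"
    and \<xi>_e: "b \<in> heis_index m \<Longrightarrow> b' \<in> heis_index m \<Longrightarrow> \<xi> b (e b') = (if b = b' then 1 else 0)"
    and \<xi>_parity: "b \<in> heis_index m \<Longrightarrow> x \<in> part H a \<Longrightarrow> par b \<noteq> a \<Longrightarrow> \<xi> b x = 0"
    and expand: "x \<in> carrier H \<Longrightarrow> x = (\<Sum>b\<in>heis_index m. fscale (\<xi> b x) (e b))"
    and J_iff: "x \<in> carrier H \<Longrightarrow> x \<in> J \<longleftrightarrow>
      (\<forall>b\<in>heis_index m - (HX ` {1..k} \<union> HY ` {1..k} \<union> {HZ}). \<xi> b x = 0)"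
begin

abbreviation I :: "heis_basis set" where "I \<equiv> heis_index m"
abbreviation IJ :: "heis_basis set" where "IJ \<equiv> HX ` {1..k} \<union> HY ` {1..k} \<union> {HZ}"

lemmas \<xi>_add_part = \<xi>_add[OF _ part_carrier_heis part_carrier_heis]
lemmas \<xi>_scale_part = \<xi>_scale[OF _ part_carrier_heis]

text \<open>The coordinate of a 2-chain at \<open>e i \<and> e j\<close>; for an odd index i, \<open>coord i i\<close> is twice the coefficient
  of \<open>e i \<and> e i\<close>.\<close>

definition coord :: "heis_basis \<Rightarrow> heis_basis \<Rightarrow> (bit \<times> (heis_basis \<Rightarrow> 'f)) list \<Rightarrow> 'f" where
  "coord i j w = \<xi> i (snd (w ! 0)) * \<xi> j (snd (w ! 1)) -
    psign (par i * par j) * \<xi> j (snd (w ! 0)) * \<xi> i (snd (w ! 1))"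

abbreviation pair :: "heis_basis \<Rightarrow> heis_basis \<Rightarrow> (bit \<times> (heis_basis \<Rightarrow> 'f)) list" where
  "pair i j \<equiv> [(par i, e i), (par j, e j)]"

lemma \<xi>_0: "b \<in> I \<Longrightarrow> \<xi> b 0 = 0"
  using \<xi>_scale[of b 0 0] by (simp add: zero_fun_def carrier_heis)

lemma \<xi>_hz: "b \<in> I \<Longrightarrow> b \<noteq> HZ \<Longrightarrow> \<xi> b hz = 0"
  using \<xi>_e[of b HZ] by (simp add: e_HZ)

lemma \<xi>_HZ_hz: "\<xi> HZ hz = 1"
  using \<xi>_e[of HZ HZ] by (simp add: e_HZ)

lemma \<xi>_fscale_hz: "b \<in> I \<Longrightarrow> \<xi> b (fscale c hz) = (if b = HZ then c else 0)"
  by (simp add: \<xi>_scale hz_carrier \<xi>_hz \<xi>_HZ_hz)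

lemma pair_words: "i \<in> I \<Longrightarrow> j \<in> I \<Longrightarrow> pair i j \<in> words H 2"
  by (auto simp: words_2 e_part)

lemma psign_square [simp]: "psign a * psign a = (1 :: 'f)" "psign a * (psign a * c) = (c :: 'f)"
  by (simp_all add: psign_def)

lemma coord_swap: "coord j i w = - psign (par i * par j) * coord i j w"
  by (simp add: coord_def mult.commute algebra_simps)

lemma leval_coord_swap: "leval (coord j i) p = - psign (par i * par j) * leval (coord i j) p"
  unfolding leval_def coord_swap[of j i] sum_distrib_left by (intro sum.cong) (simp_all add: algebra_simps)

lemma coord_pair:
  assumes "i \<in> I" "j \<in> I" "i' \<in> I" "j' \<in> I"
  shows "coord i j (pair i' j') = (if i = i' \<and> j = j' then 1 else 0) -
    psign (par i * par j) * (if j = i' \<and> i = j' then 1 else 0)"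
proof -
  have "\<xi> i (e i') = (if i = i' then 1 else 0)" "\<xi> j (e j') = (if j = j' then 1 else 0)"
    "\<xi> j (e i') = (if j = i' then 1 else 0)" "\<xi> i (e j') = (if i = j' then 1 else 0)"
    using assms by (simp_all only: \<xi>_e)
  note \<xi> = this
  have if_mult: "(if P then 1 else 0) * (if P' then 1 else 0) = (if P \<and> P' then 1 else (0 :: 'f))" for P P'
    by simp
  have "coord i j (pair i' j') = \<xi> i (e i') * \<xi> j (e j') -
      psign (par i * par j) * (\<xi> j (e i') * \<xi> i (e j'))"
    by (simp add: coord_def mult.assoc)
  then show ?thesis by (simp only: \<xi> if_mult)
qed

lemma split_words_2:
  assumes "u @ l # v \<in> words L 2"
  obtains b y where "u = []" "v = [(b, y)]" "y \<in> part L b" | b y where "u = [(b, y)]" "v = []" "y \<in> part L b"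
  using assms by (cases u; cases v; cases l) (auto simp: words_def)

lemma coord_ext_rel:
  assumes i: "i \<in> I" and j: "j \<in> I" and p: "p \<in> ext_rel H 2"
  shows "leval (coord i j) p = 0"
proof (rule CollectD[of p "\<lambda>p. leval (coord i j) p = 0"],
       rule heis.ext_rel_in_subspace[OF p subspace_leval_zero])
  fix u v :: "(bit \<times> (heis_basis \<Rightarrow> 'f)) list" and a b x y and c :: 'f
  { assume *: "u @ (a, x) # v \<in> words H 2" "u @ (a, y) # v \<in> words H 2"
    then have x: "x \<in> part H a" "y \<in> part H a" by (auto simp: words_append)
    have "\<xi> i (x + y) = \<xi> i x + \<xi> i y" "\<xi> j (x + y) = \<xi> j x + \<xi> j y"
      using x i j \<xi>_add_part by blast+
    with *(1) show "gen (u @ (a, x \<oplus>\<^bsub>H\<^esub> y) # v) - gen (u @ (a, x) # v) - gen (u @ (a, y) # v)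
        \<in> {p. leval (coord i j) p = 0}"
      by (elim split_words_2) (simp_all add: leval_simps coord_def algebra_simps) }
  { assume *: "u @ (a, x) # v \<in> words H 2"
    then have x: "x \<in> part H a" by (auto simp: words_append)
    have "\<xi> i (fscale c x) = c * \<xi> i x" "\<xi> j (fscale c x) = c * \<xi> j x"
      using x i j \<xi>_scale_part by blast+
    with * show "gen (u @ (a, c \<odot>\<^bsub>H\<^esub> x) # v) - cscale c (gen (u @ (a, x) # v)) \<in> {p. leval (coord i j) p = 0}"
      by (elim split_words_2) (simp_all add: leval_simps coord_def algebra_simps) }
  { assume *: "u @ (a, x) # (b, y) # v \<in> words H 2"
    then have x: "x \<in> part H a" and y: "y \<in> part H b" and "u = []" "v = []"
      by (auto simp: words_append)
    have 1: "\<xi> i x * \<xi> j y = 0 \<or> (a = par i \<and> b = par j)"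
      using \<xi>_parity[OF i x] \<xi>_parity[OF j y] by auto
    have 2: "\<xi> j x * \<xi> i y = 0 \<or> (a = par j \<and> b = par i)"
      using \<xi>_parity[OF j x] \<xi>_parity[OF i y] by auto
    have 1: "psign (a * b) * psign (par i * par j) * (\<xi> i x * \<xi> j y) = \<xi> i x * \<xi> j y"
      using 1 by auto
    have 2: "psign (a * b) * (\<xi> j x * \<xi> i y) = psign (par i * par j) * (\<xi> j x * \<xi> i y)"
      using 2 by (auto simp: mult.commute)
    have "leval (coord i j) (gen [(a, x), (b, y)] + cscale (psign (a * b)) (gen [(b, y), (a, x)])) =
        (\<xi> i x * \<xi> j y - psign (a * b) * psign (par i * par j) * (\<xi> i x * \<xi> j y)) +
        (psign (a * b) * (\<xi> j x * \<xi> i y) - psign (par i * par j) * (\<xi> j x * \<xi> i y))"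
      by (simp add: leval_simps coord_def algebra_simps)
    also have "\<dots> = 0" by (simp only: 1 2 diff_self add_0)
    finally have "leval (coord i j) (gen [(a, x), (b, y)] + cscale (psign (a * b)) (gen [(b, y), (a, x)])) = 0" .
    then show "gen (u @ (a, x) # (b, y) # v) + cscale (psign (a * b)) (gen (u @ (b, y) # (a, x) # v))
        \<in> {p. leval (coord i j) p = 0}"
      using \<open>u = []\<close> \<open>v = []\<close> by simp }
qed

lemma letter_sum:
  assumes "finite B" "\<And>b. b \<in> B \<Longrightarrow> f b \<in> part H a" "u @ (a, 0) # v \<in> words H n"
  shows "gen (u @ (a, \<Sum>b\<in>B. fscale (c b) (f b)) # v) - (\<Sum>b\<in>B. cscale (c b) (gen (u @ (a, f b) # v)))
    \<in> ext_rel H n \<and> (\<Sum>b\<in>B. fscale (c b) (f b)) \<in> part H a"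
  using assms
proof (induction B)
  case empty
  then show ?case
    using heis.ext_rel_null_letter[of u a 0 v m n 1] by (simp add: zero_fun_def part_heis)
next
  case (insert b B)
  let ?s = "\<Sum>b\<in>B. fscale (c b) (f b)"
  have w: "u @ (a, x) # v \<in> words H n" if "x \<in> part H a" for x
    using insert.prems(2) that by (auto simp: words_append)
  have s: "?s \<in> part H a" and fb: "f b \<in> part H a"
    and IH: "gen (u @ (a, ?s) # v) - (\<Sum>b\<in>B. cscale (c b) (gen (u @ (a, f b) # v))) \<in> ext_rel H n"
    using insert by auto
  note A = heis.ext_rel_add_letter[OF w[OF part_heis_scale[OF fb, of "c b"]] w[OF s]]
  note S = heis.ext_rel_smult_letter[OF w[OF fb], of "c b"]
  have sum_eq: "(\<Sum>b\<in>insert b B. fscale (c b) (f b)) = fscale (c b) (f b) + ?s"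
    using insert.hyps by (rule sum.insert)
  have "gen (u @ (a, fscale (c b) (f b) + ?s) # v) -
        (\<Sum>b\<in>insert b B. cscale (c b) (gen (u @ (a, f b) # v))) =
      (gen (u @ (a, fscale (c b) (f b) \<oplus>\<^bsub>H\<^esub> ?s) # v) - gen (u @ (a, fscale (c b) (f b)) # v) - gen (u @ (a, ?s) # v)) +
      (gen (u @ (a, c b \<odot>\<^bsub>H\<^esub> f b) # v) - cscale (c b) (gen (u @ (a, f b) # v))) +
      (gen (u @ (a, ?s) # v) - (\<Sum>b\<in>B. cscale (c b) (gen (u @ (a, f b) # v))))"
    using insert.hyps by (simp add: algebra_simps del: cscale_gen)
  also have "\<dots> \<in> ext_rel H n"
    by (intro chain.subspace_add[OF heis.subspace_ext_rel] A S IH)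
  finally show ?case unfolding sum_eq using s fb by (blast intro: part_heis_add part_heis_scale)
qed

lemma letter_expand:
  assumes "u @ (a, x) # v \<in> words H n"
  shows "gen (u @ (a, x) # v) - (\<Sum>b\<in>I. cscale (\<xi> b x) (gen (u @ (par b, e b) # v))) \<in> ext_rel H n"
proof -
  let ?B = "{b \<in> I. par b = a}"
  have x: "x \<in> part H a" and w0: "u @ (a, 0) # v \<in> words H n"
    using assms by (auto simp: words_append part_heis)
  have null: "\<xi> b x = 0" if "b \<in> I - ?B" for b using that \<xi>_parity x by auto
  have "x = (\<Sum>b\<in>I. fscale (\<xi> b x) (e b))" using x by (intro expand part_carrier_heis)
  also have "\<dots> = (\<Sum>b\<in>?B. fscale (\<xi> b x) (e b))"
    by (rule sum.mono_neutral_right) (use null in \<open>auto simp: zero_fun_def\<close>)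
  finally have x_eq: "x = (\<Sum>b\<in>?B. fscale (\<xi> b x) (e b))" .
  have "gen (u @ (a, x) # v) - (\<Sum>b\<in>?B. cscale (\<xi> b x) (gen (u @ (a, e b) # v))) \<in> ext_rel H n"
    using letter_sum[of ?B e a u v n "\<lambda>b. \<xi> b x"] w0 e_part unfolding x_eq[symmetric] by auto
  moreover have "(\<Sum>b\<in>?B. cscale (\<xi> b x) (gen (u @ (a, e b) # v))) =
      (\<Sum>b\<in>I. cscale (\<xi> b x) (gen (u @ (par b, e b) # v)))"
    by (rule sum.mono_neutral_cong_left) (use null in auto)
  ultimately show ?thesis by simp
qed

lemma pair_expand:
  assumes "x \<in> part H a" "y \<in> part H b"
  shows "gen [(a, x), (b, y)] - (\<Sum>i\<in>I. \<Sum>j\<in>I. cscale (\<xi> i x * \<xi> j y) (gen (pair i j))) \<in> ext_rel H 2"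
proof -
  let ?h = "\<lambda>i. gen [(par i, e i), (b, y)]"
  let ?s = "\<lambda>i. \<Sum>j\<in>I. cscale (\<xi> j y) (gen (pair i j))"
  have "gen [(a, x), (b, y)] - (\<Sum>i\<in>I. cscale (\<xi> i x) (?h i)) \<in> ext_rel H 2"
    using letter_expand[of "[]" a x "[(b, y)]" 2] assms by (auto simp: words_2)
  moreover have "cscale (\<xi> i x) (?h i - ?s i) \<in> ext_rel H 2" if "i \<in> I" for i
    using letter_expand[of "[(par i, e i)]" b y "[]" 2] assms e_part[OF that]
    by (intro chain.subspace_scale[OF heis.subspace_ext_rel]) (auto simp: words_2)
  then have "(\<Sum>i\<in>I. cscale (\<xi> i x) (?h i - ?s i)) \<in> ext_rel H 2"
    by (intro chain.subspace_sum[OF heis.subspace_ext_rel])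
  ultimately have "gen [(a, x), (b, y)] - (\<Sum>i\<in>I. cscale (\<xi> i x) (?h i)) +
      (\<Sum>i\<in>I. cscale (\<xi> i x) (?h i - ?s i)) \<in> ext_rel H 2"
    by (rule chain.subspace_add[OF heis.subspace_ext_rel])
  moreover have "(\<Sum>i\<in>I. cscale (\<xi> i x) (?h i - ?s i)) =
      (\<Sum>i\<in>I. cscale (\<xi> i x) (?h i)) - (\<Sum>i\<in>I. \<Sum>j\<in>I. cscale (\<xi> i x * \<xi> j y) (gen (pair i j)))"
    by (simp add: chain.scale_right_diff_distrib sum_subtractf chain.scale_sum_right del: cscale_gen)
  ultimately show ?thesis by simp
qed

text \<open>Modulo the relations p is the sum of the \<open>\<xi>_i \<xi>_j (e i \<and> e j)\<close>. Adding the same sum after swapping the two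
  letters in each term makes the coefficients antisymmetric, at the price of the factor 2.\<close>

lemma coord_expand:
  assumes "p \<in> chains H 2"
  shows "cscale 2 p - (\<Sum>i\<in>I. \<Sum>j\<in>I. cscale (leval (coord i j) p) (gen (pair i j))) \<in> ext_rel H 2"
    (is "?P p")
proof (rule CollectD[of p ?P], rule chains_in_subspace[OF assms])
  let ?S = "\<lambda>p. \<Sum>i\<in>I. \<Sum>j\<in>I. cscale (leval (coord i j) p) (gen (pair i j))"
  have S: "?S (p + q) = ?S p + ?S q" "?S (cscale c p) = cscale c (?S p)" "?S 0 = 0" for p q c
    by (simp_all add: leval_simps chain.scale_left_distrib chain.scale_sum_right sum.distrib del: cscale_gen)
  show "chain.subspace {p. ?P p}"
    unfolding chain.subspace_def mem_Collect_eq
  proof (intro conjI allI ballI)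
    show "?P 0"
      unfolding S using chain.subspace_0[OF heis.subspace_ext_rel] by simp
    show "?P (p + q)" if "p \<in> {p. ?P p}" "q \<in> {p. ?P p}" for p q
      using chain.subspace_add[OF heis.subspace_ext_rel CollectD[OF that(1)] CollectD[OF that(2)]]
      unfolding S by (simp add: algebra_simps)
    show "?P (cscale c p)" if "p \<in> {p. ?P p}" for c p
      using chain.subspace_scale[OF heis.subspace_ext_rel CollectD[OF that(1)], of c]
      unfolding S by (simp add: chain.scale_right_diff_distrib mult.commute)
  qed
  fix w assume "w \<in> words H 2"
  then obtain a x b y where w: "w = [(a, x), (b, y)]" and x: "x \<in> part H a" and y: "y \<in> part H b"
    by (auto simp: words_2)
  let ?s = "\<lambda>i j. psign (par i * par j) :: 'f"
  let ?d = "\<lambda>i j. \<xi> i x * \<xi> j y"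
  let ?g = "\<lambda>i j. gen (pair i j)"
  note E = pair_expand[OF x y]
  have "cscale (?d i j) (?g i j + cscale (?s i j) (?g j i)) \<in> ext_rel H 2" if "i \<in> I" "j \<in> I" for i j
    using heis.ext_rel_swap[of "[]" "par i" "e i" "par j" "e j" "[]" m 2] pair_words[OF that]
    by (intro chain.subspace_scale[OF heis.subspace_ext_rel]) simp
  then have W: "(\<Sum>i\<in>I. \<Sum>j\<in>I. cscale (?d i j) (?g i j + cscale (?s i j) (?g j i))) \<in> ext_rel H 2"
    by (intro chain.subspace_sum[OF heis.subspace_ext_rel])
  have "(\<Sum>i\<in>I. \<Sum>j\<in>I. cscale (?d i j) (cscale (?s i j) (?g j i))) =
      (\<Sum>i\<in>I. \<Sum>j\<in>I. cscale (?d j i) (cscale (?s i j) (?g i j)))"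
    by (subst sum.swap) (simp add: mult.commute del: cscale_gen)
  then have W': "(\<Sum>i\<in>I. \<Sum>j\<in>I. cscale (?d i j) (?g i j)) + (\<Sum>i\<in>I. \<Sum>j\<in>I. cscale (?d j i) (cscale (?s i j) (?g i j)))
      \<in> ext_rel H 2"
    using W by (simp add: chain.scale_right_distrib sum.distrib del: cscale_gen)
  have "?S (gen w) = (\<Sum>i\<in>I. \<Sum>j\<in>I. cscale (?d i j) (?g i j)) - (\<Sum>i\<in>I. \<Sum>j\<in>I. cscale (?d j i) (cscale (?s i j) (?g i j)))"
    unfolding sum_subtractf[symmetric]
    by (intro sum.cong refl) (simp add: w coord_def algebra_simps single_diff[symmetric])
  then have "cscale 2 (gen w) - ?S (gen w) =
     ((gen w - (\<Sum>i\<in>I. \<Sum>j\<in>I. cscale (?d i j) (?g i j))) + (gen w - (\<Sum>i\<in>I. \<Sum>j\<in>I. cscale (?d i j) (?g i j)))) +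
     ((\<Sum>i\<in>I. \<Sum>j\<in>I. cscale (?d i j) (?g i j)) + (\<Sum>i\<in>I. \<Sum>j\<in>I. cscale (?d j i) (cscale (?s i j) (?g i j))))"
    using chain.scale_left_distrib[of 1 1 "gen w"] by (simp add: algebra_simps del: cscale_gen)
  also have "\<dots> \<in> ext_rel H 2"
    unfolding w
    by (rule chain.subspace_add[OF heis.subspace_ext_rel chain.subspace_add[OF heis.subspace_ext_rel E E] W'])
  finally show "gen w \<in> {p. ?P p}" by blast
qed

text \<open>With the relations for V, this says that the coordinates separate the elements of the second exterior power.
  With the boundaries for V, the coordinates at those pairs which are boundaries may be ignored.\<close>

lemma in_subspace_by_coords:
  assumes p: "p \<in> chains H 2" and V: "chain.subspace V" "ext_rel H 2 \<subseteq> V"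
    and c: "\<And>i j. i \<in> I \<Longrightarrow> j \<in> I \<Longrightarrow> leval (coord i j) p = 0 \<or> gen (pair i j) \<in> V"
  shows "p \<in> V"
proof -
  have "(\<Sum>i\<in>I. \<Sum>j\<in>I. cscale (leval (coord i j) p) (gen (pair i j))) \<in> V"
    using c chain.subspace_0[OF V(1)]
    by (intro chain.subspace_sum[OF V(1)]) (metis chain.scale_zero_left chain.subspace_scale[OF V(1)])
  from chain.subspace_add[OF V(1) _ this] coord_expand[OF p] V(2)
  have "cscale 2 p \<in> V" by force
  from chain.subspace_scale[OF V(1) this, of "1 / 2"] show ?thesis using two by simp
qed

end

section \<open>Boundaries and cycles of the Heisenberg superalgebra\<close>

lemma leval_lin_ext: "leval \<phi> (lin_ext g p) = leval (\<lambda>w. leval \<phi> (g w)) p"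
proof -
  have "p \<in> {p. leval \<phi> (lin_ext g p) = leval (\<lambda>w. leval \<phi> (g w)) p}"
    by (rule supported_in_subspace[of p UNIV])
       (auto simp: chain.subspace_def leval_simps lin_ext_simps)
  then show ?thesis by simp
qed

lemma heis_null_letter:
  assumes "u @ (a, 0) # v \<in> words (heisenberg m) n"
  shows "Poly_Mapping.single (u @ (a, 0) # v) c \<in> ext_rel (heisenberg m) n"
  using heis.ext_rel_null_letter[OF assms] by (simp add: zero_fun_def)

lemma zero_part: "0 \<in> part (heisenberg m) a"
  by (simp add: part_heis)

text \<open>Combinations of words with a letter x, which become relations in every quotient that kills x.\<close>

definition through :: "nat \<Rightarrow> (heis_basis \<Rightarrow> 'f::field) \<Rightarrow> ('f, heis_basis \<Rightarrow> 'f) chain set" where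
  "through m x = chain.span {gen w |w. w \<in> words (heisenberg m) 3 \<and> (0, x) \<in> set w}"

definition bounded_through :: "nat \<Rightarrow> (heis_basis \<Rightarrow> 'f::field) \<Rightarrow> ('f, heis_basis \<Rightarrow> 'f) chain set" where
  "bounded_through m x = {p. \<exists>r\<in>through m x. p - boundary (heisenberg m) r \<in> ext_rel (heisenberg m) 2}"

lemma through_chains: "through m x \<subseteq> chains (heisenberg m) 3"
  unfolding through_def
  by (rule chain.span_minimal) (auto simp: subspace_chains intro: gen_in_chains)

lemma subspace_bounded_through: "chain.subspace (bounded_through m x)"
proof -
  have "0 \<in> bounded_through m x"
    unfolding bounded_through_def through_def using chain.span_zero chain.subspace_0[OF heis.subspace_ext_rel]
    by (auto intro!: bexI[of _ 0])
  moreover have "p + q \<in> bounded_through m x" if "p \<in> bounded_through m x" "q \<in> bounded_through m x" for p q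
  proof -
    from that obtain r s where "r \<in> through m x" "s \<in> through m x"
      and *: "p - boundary (heisenberg m) r \<in> ext_rel (heisenberg m) 2"
        "q - boundary (heisenberg m) s \<in> ext_rel (heisenberg m) 2"
      unfolding bounded_through_def by blast
    moreover have "p + q - boundary (heisenberg m) (r + s) \<in> ext_rel (heisenberg m) 2"
      using chain.subspace_add[OF heis.subspace_ext_rel *] by (simp add: lin_ext_simps algebra_simps)
    ultimately show ?thesis
      unfolding bounded_through_def through_def by (blast intro: chain.span_add)
  qed
  moreover have "cscale c p \<in> bounded_through m x" if "p \<in> bounded_through m x" for c p
  proof -
    from that obtain r where "r \<in> through m x"
      and *: "p - boundary (heisenberg m) r \<in> ext_rel (heisenberg m) 2"
      unfolding bounded_through_def by blast
    moreover have "cscale c p - boundary (heisenberg m) (cscale c r) \<in> ext_rel (heisenberg m) 2"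
      using chain.subspace_scale[OF heis.subspace_ext_rel *, of c]
      by (simp add: lin_ext_simps chain.scale_right_diff_distrib)
    ultimately show ?thesis
      unfolding bounded_through_def through_def by (blast intro: chain.span_scale)
  qed
  ultimately show ?thesis by (simp add: chain.subspace_def)
qed

lemma ext_rel_bounded_through: "ext_rel (heisenberg m) 2 \<subseteq> bounded_through m x"
  unfolding bounded_through_def through_def using chain.span_zero by (auto intro!: bexI[of _ 0])

lemma word_bounded_through:
  assumes "w \<in> words (heisenberg m) 3" "(0, x) \<in> set w"
  shows "word_boundary (heisenberg m) w \<in> bounded_through m x"
proof -
  have "gen w \<in> through m x" unfolding through_def using assms by (intro chain.span_base) blast
  then show ?thesis unfolding bounded_through_def
    using chain.subspace_0[OF heis.subspace_ext_rel] by (auto intro!: bexI[of _ "gen w"])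
qed

lemma bounded_through_boundaries: "bounded_through m x \<subseteq> boundaries (heisenberg m) 2"
proof
  fix p assume "p \<in> bounded_through m x"
  then obtain r where r: "r \<in> through m x" "p - boundary (heisenberg m) r \<in> ext_rel (heisenberg m) 2"
    unfolding bounded_through_def by blast
  moreover have "r \<in> chains (heisenberg m) (Suc 2)" using r(1) through_chains by auto
  moreover have "p = boundary (heisenberg m) r + (p - boundary (heisenberg m) r)" by simp
  ultimately show "p \<in> boundaries (heisenberg m) 2" unfolding boundaries_eq by blast
qed

text \<open>The terms \<open>[a, b] \<and> v\<close> of a boundary are multiples t of \<open>z \<and> v\<close>, and t = 0 unless the
  parity d of \<open>[a, b]\<close> is that of z.\<close>

lemma bracket_letter_in_subspace:
  assumes V: "chain.subspace V" "ext_rel (heisenberg m) 2 \<subseteq> V"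
    and v: "v \<in> part (heisenberg m) c" and g: "t = 0 \<or> d = 1 \<and> gen [(1, hz), (c, v)] \<in> V"
  shows "Poly_Mapping.single [(d, fscale t hz), (c, v)] s \<in> V"
proof (cases "t = 0")
  case True
  then have "fscale t hz = 0" by (simp add: zero_fun_def)
  then show ?thesis
    using heis_null_letter[of "[]" d "[(c, v)]" m 2 s] v V(2) zero_part by (auto simp: words_2)
next
  case False
  then have d: "d = 1" and g: "gen [(1, hz), (c, v)] \<in> V" using g by auto
  have "gen [(1, fscale t hz), (c, v)] - cscale t (gen [(1, hz), (c, v)]) \<in> V"
    using heis.ext_rel_smult_letter[of "[]" 1 hz "[(c, v)]" m 2 t] v V(2) hz_part by (auto simp: words_2)
  from chain.subspace_add[OF V(1) this chain.subspace_scale[OF V(1) g, of t]]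
  have "gen [(1, fscale t hz), (c, v)] \<in> V" by simp
  from chain.subspace_scale[OF V(1) this, of s] show ?thesis using d by simp
qed

lemma even_nonzero_dual:
  fixes x :: "heis_basis \<Rightarrow> 'f::field"
  assumes "x \<in> part (heisenberg m) 0" "x \<noteq> 0"
  obtains j where "j \<in> {1..m}" "x (HX j) \<noteq> 0"
proof -
  from assms(2) obtain b where "x b \<noteq> 0" by (auto simp: fun_eq_iff)
  then show ?thesis using assms(1) that by (cases b) (force simp: part_heis heis_index_def)+
qed

definition delta :: "heis_basis \<Rightarrow> heis_basis \<Rightarrow> 'f::field" where
  "delta b = (\<lambda>b'. if b' = b then 1 else 0)"

lemma delta_part:
  "j \<in> {1..m} \<Longrightarrow> delta (HX j) \<in> part (heisenberg m) 0"
  "j \<in> {1..m} \<Longrightarrow> delta (HY j) \<in> part (heisenberg m) 1"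
  by (simp_all add: part_heis delta_def heis_index_def)

lemma omega_delta_HY: "j \<in> {1..m} \<Longrightarrow> omega m x (delta (HY j)) = x (HX j)"
proof -
  assume j: "j \<in> {1..m}"
  have "omega m x (delta (HY j)) = (\<Sum>i\<in>{1..m}. if i = j then x (HX i) else 0)"
    unfolding omega_def by (intro sum.cong) (auto simp: delta_def)
  then show ?thesis using j by simp
qed

lemma omega_zero [simp]: "omega m 0 y = 0" "omega m y 0 = 0"
  by (simp_all add: omega_def)

lemma omega_sum: "omega m (\<Sum>b\<in>B. f b) t = (\<Sum>b\<in>B. omega m (f b) t)"
  "omega m t (\<Sum>b\<in>B. f b) = (\<Sum>b\<in>B. omega m t (f b))"
  by (induction B rule: infinite_finite_induct) (simp_all add: omega_add)

text \<open>Choose an odd y with \<open>[x, y] = z\<close>. The boundary of \<open>x \<and> y \<and> v\<close> is \<open>z \<and> v\<close> plus a multiple of \<open>z \<and> y\<close> for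
  odd v, or plus a multiple of \<open>z \<and> x\<close> for even v. So it suffices to treat v = y and v = x. For the latter a
  second pair of basis vectors is needed, which exists for \<open>m \<ge> 2\<close>.\<close>

lemma hz_wedge_bounded_through:
  fixes x v :: "heis_basis \<Rightarrow> 'f::field"
  assumes two: "(2::'f) \<noteq> 0" and x: "x \<in> part (heisenberg m) 0" "x \<noteq> 0"
    and v: "v \<in> part (heisenberg m) c" and c: "c = 1 \<or> m \<ge> 2"
  shows "gen [(1, hz), (c, v)] \<in> bounded_through m x" (is "_ \<in> ?Y")
proof -
  let ?H = "heisenberg m :: ('f, heis_basis \<Rightarrow> 'f) lie_superalg"
  note Y = subspace_bounded_through[of m x] ext_rel_bounded_through[of m x]
  note br = bracket_letter_in_subspace[OF Y]
  obtain j where j: "j \<in> {1..m}" "x (HX j) \<noteq> 0" using even_nonzero_dual[OF x] .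
  define y where "y = fscale (1 / x (HX j)) (delta (HY j))"
  have y: "y \<in> part ?H 1"
    unfolding y_def by (intro part_heis_scale delta_part j(1))
  have xy: "omega m x y = 1" unfolding y_def omega_scale omega_delta_HY[OF j(1)] using j(2) by simp
  have yy: "omega m y u = 0" if "u \<in> part ?H 1" for u using omega_parity[OF y that] by simp
  have xx: "omega m x u = 0" if "u \<in> part ?H 0" for u using omega_parity[OF x(1) that] by simp
  have hz1: "fscale 1 hz = (hz :: heis_basis \<Rightarrow> 'f)" by simp
  have d: "gen [(1, hz), (c', u)] +
      Poly_Mapping.single [(c', fscale (omega m x u) hz), (1, y)] (- psign c') +
      Poly_Mapping.single [(1 + c', fscale (omega m y u) hz), (0, x)] 1 \<in> ?Y"
    if "u \<in> part ?H c'" for c' u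
    using word_bounded_through[of "[(0, x), (1, y), (c', u)]" m x] that x y
    by (auto simp: words_3 word_boundary_3 xy hz1 psign_def)
  have add_back: "p \<in> ?Y" if "p + q + r \<in> ?Y" "q \<in> ?Y" "r \<in> ?Y" for p q r
    using chain.subspace_diff[OF Y(1) chain.subspace_diff[OF Y(1) that(1,3)] that(2)] by simp
  \<comment> \<open>The boundary of \<open>x \<and> y \<and> y\<close> is twice \<open>z \<and> y\<close>.\<close>
  have hy: "gen [(1, hz), (1, y)] \<in> ?Y"
  proof -
    have "Poly_Mapping.single [(1, fscale (omega m x y) hz), (1, y)] (- psign 1 :: 'f) = gen [(1, hz), (1, y)]"
      by (simp add: xy hz1 psign_def)
    then have "gen [(1, hz), (1, y)] + gen [(1, hz), (1, y)] +
        Poly_Mapping.single [(0, fscale (omega m y y) hz), (0, x)] 1 \<in> ?Y"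
      using d[OF y] by simp
    moreover have r: "Poly_Mapping.single [(0, fscale (omega m y y) hz), (0, x)] 1 \<in> ?Y"
      using yy[OF y] by (intro br x(1)) simp
    ultimately have "gen [(1, hz), (1, y)] + gen [(1, hz), (1, y)] \<in> ?Y"
      using chain.subspace_diff[OF Y(1) _ r] by force
    moreover have "gen [(1, hz), (1, y)] = cscale (1 / 2 :: 'f) (gen [(1, hz), (1, y)] + gen [(1, hz), (1, y)])"
      using two by (simp add: single_add[symmetric])
    ultimately show ?thesis using chain.subspace_scale[OF Y(1)] by metis
  qed
  show ?thesis
  proof (cases "c = 1")
    case True
    show ?thesis
    proof (rule add_back[OF d[OF v] br[OF y] br[OF x(1)]])
      show "omega m x v = 0 \<or> c = 1 \<and> gen [(1, hz), (1, y)] \<in> ?Y" using True hy by blast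
      show "omega m y v = 0 \<or> 1 + c = 1 \<and> gen [(1, hz), (0, x)] \<in> ?Y" using True v yy by blast
    qed
  next
    case False
    then have c0: "c = 0" and "m \<ge> 2" using c by (auto simp: bit_not_one_iff)
    \<comment> \<open>If x' and y' commute with x and \<open>[x', y'] = z\<close>, then the boundary of \<open>x \<and> x' \<and> y'\<close> is \<open>z \<and> x\<close>.\<close>
    have hx: "gen [(1, hz), (0, x)] \<in> ?Y"
    proof -
      have "\<exists>j'\<in>{1..m}. j' \<noteq> j"
        by (rule bexI[of _ "if j = 1 then 2 else 1"]) (use \<open>m \<ge> 2\<close> in auto)
      then obtain j' where j': "j' \<in> {1..m}" "j' \<noteq> j" by blast
      define x' where "x' = fscale (- 1 / x (HX j)) (delta (HX j'))"
      define y' where "y' = fscale (x (HX j')) (delta (HY j)) + fscale (- x (HX j)) (delta (HY j'))"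
      have x': "x' \<in> part ?H 0"
        unfolding x'_def by (intro part_heis_scale delta_part j'(1))
      have y': "y' \<in> part ?H 1"
        unfolding y'_def by (intro part_heis_add part_heis_scale delta_part j(1) j'(1))
      have xy': "omega m x y' = 0" "omega m x' y' = 1"
        unfolding x'_def y'_def omega_add omega_scale omega_delta_HY[OF j(1)] omega_delta_HY[OF j'(1)]
        using j j' by (simp_all add: delta_def)
      have "word_boundary ?H [(0, x), (0, x'), (1, y')] =
          gen [(1, hz), (0, x)] +
          Poly_Mapping.single [(0, fscale (omega m x x') hz), (1, y')] 1 +
          Poly_Mapping.single [(1, fscale (omega m x y') hz), (0, x')] (- 1)"
        by (simp add: word_boundary_3 xy' hz1 psign_def add_ac)
      then have "gen [(1, hz), (0, x)] +
          Poly_Mapping.single [(0, fscale (omega m x x') hz), (1, y')] 1 +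
          Poly_Mapping.single [(1, fscale (omega m x y') hz), (0, x')] (- 1) \<in> ?Y"
        using word_bounded_through[of "[(0, x), (0, x'), (1, y')]" m x] x x' y' by (auto simp: words_3)
      then show ?thesis
        by (rule add_back[OF _ br[OF y'] br[OF x']]) (use xx[OF x'] xy'(1) in blast)+
    qed
    show ?thesis
    proof (rule add_back[OF d[OF v] br[OF y] br[OF x(1)]])
      show "omega m x v = 0 \<or> c = 1 \<and> gen [(1, hz), (1, y)] \<in> ?Y" using c0 v xx by blast
      show "omega m y v = 0 \<or> 1 + c = 1 \<and> gen [(1, hz), (0, x)] \<in> ?Y" using c0 hx by simp
    qed
  qed
qed

context heis_coords
begin

lemma coord_boundary:
  assumes "i \<in> I" "j \<in> I" "i \<noteq> HZ" "j \<noteq> HZ" "q \<in> chains H 3"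
  shows "leval (coord i j) (boundary H q) = 0"
proof -
  have "boundary H q \<in> {p. leval (coord i j) p = 0}"
  proof (rule heis.boundary_in_subspace[of _ _ 2])
    show "q \<in> chains H (Suc 2)" using assms(5) by simp
    fix a x b y v assume "(a + b, lbrak H x y) # v \<in> words H 2"
    then show "gen ((a + b, lbrak H x y) # v) \<in> {p. leval (coord i j) p = 0}"
      using assms by (simp add: coord_def \<xi>_fscale_hz)
  qed (rule subspace_leval_zero)
  then show ?thesis by simp
qed

lemma coord_boundaries:
  assumes "i \<in> I" "j \<in> I" "i \<noteq> HZ" "j \<noteq> HZ" "p \<in> boundaries H 2"
  shows "leval (coord i j) p = 0"
proof -
  from assms(5) obtain q r where "p = boundary H q + r" "q \<in> chains H (Suc 2)" "r \<in> ext_rel H 2"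
    unfolding boundaries_eq by blast
  then show ?thesis using coord_boundary[of i j q] coord_ext_rel[of i j r] assms by (simp add: leval_simps)
qed

text \<open>For \<open>i \<noteq> HZ\<close>, the coefficient of \<open>z \<and> e i\<close> in the boundary of a word of length 3.\<close>

definition zwedge :: "heis_basis \<Rightarrow> (bit \<times> (heis_basis \<Rightarrow> 'f)) list \<Rightarrow> 'f" where
  "zwedge i w = leval (coord HZ i) (word_boundary H w)"

lemma leval_zwedge: "leval (zwedge i) q = leval (coord HZ i) (boundary H q)"
  by (simp add: leval_lin_ext zwedge_def[abs_def])

lemma zwedge_eq:
  assumes "i \<in> I" "i \<noteq> HZ"
  shows "zwedge i [(a, x), (b, y), (c, v)] = omega m x y * \<xi> i v - psign (c * b) * omega m x v * \<xi> i y +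
    psign (b * a + c * a) * omega m y v * \<xi> i x"
  using assms by (simp add: zwedge_def word_boundary_3 leval_simps coord_def \<xi>_fscale_hz)

lemma split_words_3:
  assumes "u @ l # v \<in> words L 3"
  obtains b y c z where "u = []" "v = [(b, y), (c, z)]" "y \<in> part L b" "z \<in> part L c"
  | b y c z where "u = [(b, y)]" "v = [(c, z)]" "y \<in> part L b" "z \<in> part L c"
  | b y c z where "u = [(b, y), (c, z)]" "v = []" "y \<in> part L b" "z \<in> part L c"
proof -
  have "length u + length v = 2" using assms by (auto simp: words_append)
  then consider b y c z where "u = []" "v = [(b, y), (c, z)]" | b y c z where "u = [(b, y)]" "v = [(c, z)]"
    | b y c z where "u = [(b, y), (c, z)]" "v = []"
    by (cases u; cases "tl u"; cases v; cases "tl v") auto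
  then show ?thesis
  proof cases
    case 1
    then show ?thesis using assms that(1)[of b y c z] by (cases l) (auto simp: words_def)
  next
    case 2
    then show ?thesis using assms that(2)[of b y c z] by (cases l) (auto simp: words_def)
  next
    case 3
    then show ?thesis using assms that(3)[of b y c z] by (cases l) (auto simp: words_def)
  qed
qed

lemma zwedge_sign_first:
  fixes P R S X Y Z :: "'g::field"
  assumes "a + b = 1 \<or> P = 0" "a + c = 1 \<or> R = 0" "b + c = 1 \<or> S = 0"
  shows "P * Z - psign (c * b) * R * Y + psign (b * a + c * a) * S * X +
    psign (a * b) * (- P * Z - psign (c * a) * S * X + psign (a * b + c * b) * R * Y) = 0"
  using assms by (cases a; cases b; cases c) (simp_all add: psign_def)

lemma zwedge_sign_last:
  fixes P R S X Y Z :: "'g::field"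
  assumes "a + b = 1 \<or> P = 0" "a + c = 1 \<or> R = 0" "b + c = 1 \<or> S = 0"
  shows "- R * Y - psign (b * a) * (- S) * X + psign (a * c + b * c) * P * Z +
    psign (a * b) * (- S * X - psign (a * b) * (- R) * Y + psign (b * c + a * c) * (- P) * Z) = 0"
  using assms by (cases a; cases b; cases c) (simp_all add: psign_def)

text \<open>Multilinearity is visible from the formula. Skew-symmetry compares signs, and they agree because
  \<omega>(a, b) = 0 unless a and b have different parities.\<close>

lemma zwedge_ext_rel:
  assumes i: "i \<in> I" "i \<noteq> HZ" and p: "p \<in> ext_rel H 3"
  shows "leval (zwedge i) p = 0"
proof (rule CollectD[of p "\<lambda>p. leval (zwedge i) p = 0"],
       rule heis.ext_rel_in_subspace[OF p subspace_leval_zero])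
  fix u v :: "(bit \<times> (heis_basis \<Rightarrow> 'f)) list" and a b x y and c :: 'f
  { assume *: "u @ (a, x) # v \<in> words H 3" "u @ (a, y) # v \<in> words H 3"
    then have x: "x \<in> part H a" "y \<in> part H a" by (auto simp: words_append)
    have "\<xi> i (x + y) = \<xi> i x + \<xi> i y"
      using x i \<xi>_add_part by blast
    with *(1) show "gen (u @ (a, x \<oplus>\<^bsub>H\<^esub> y) # v) - gen (u @ (a, x) # v) - gen (u @ (a, y) # v)
        \<in> {p. leval (zwedge i) p = 0}"
      by (elim split_words_3) (simp_all add: leval_simps zwedge_eq i omega_add algebra_simps) }
  { assume *: "u @ (a, x) # v \<in> words H 3"
    then have x: "x \<in> part H a" by (auto simp: words_append)
    have "\<xi> i (fscale c x) = c * \<xi> i x"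
      using x i \<xi>_scale_part by blast
    with * show "gen (u @ (a, c \<odot>\<^bsub>H\<^esub> x) # v) - cscale c (gen (u @ (a, x) # v)) \<in> {p. leval (zwedge i) p = 0}"
      by (elim split_words_3) (simp_all add: leval_simps zwedge_eq i omega_scale algebra_simps) }
  { assume *: "u @ (a, x) # (b, y) # v \<in> words H 3"
    then have x: "x \<in> part H a" and y: "y \<in> part H b" by (auto simp: words_append)
    have xy: "a + b = 1 \<or> omega m x y = 0" using omega_parity[OF x y] by blast
    from * consider c z where "u = []" "v = [(c, z)]" "z \<in> part H c" | c z where "u = [(c, z)]" "v = []" "z \<in> part H c"
      by (elim split_words_3) auto
    then show "gen (u @ (a, x) # (b, y) # v) + cscale (psign (a * b)) (gen (u @ (b, y) # (a, x) # v))
        \<in> {p. leval (zwedge i) p = 0}"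
    proof cases
      case (1 c z)
      have xz: "a + c = 1 \<or> omega m x z = 0" using omega_parity[OF x 1(3)] by blast
      have yz: "b + c = 1 \<or> omega m y z = 0" using omega_parity[OF y 1(3)] by blast
      show ?thesis
        using zwedge_sign_first[OF xy xz yz, of "\<xi> i z" "\<xi> i y" "\<xi> i x"]
        by (simp add: 1(1,2) leval_simps zwedge_eq[OF i] omega_skew[of m y x])
    next
      case (2 c z)
      have xz: "a + c = 1 \<or> omega m x z = 0" using omega_parity[OF x 2(3)] by blast
      have yz: "b + c = 1 \<or> omega m y z = 0" using omega_parity[OF y 2(3)] by blast
      show ?thesis
        using zwedge_sign_last[OF xy xz yz, of "\<xi> i y" "\<xi> i x" "\<xi> i z"]
        by (simp add: 2(1,2) leval_simps zwedge_eq[OF i] omega_skew[of m y x] omega_skew[of m z x] omega_skew[of m z y])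
    qed }
qed

lemma \<xi>_even_m1:
  assumes "m = 1" "x \<in> part H 0" shows "x = fscale (\<xi> (HX 1) x) (e (HX 1))"
proof -
  have "x = (\<Sum>b\<in>I. fscale (\<xi> b x) (e b))" using assms by (intro expand part_carrier_heis)
  also have "\<dots> = fscale (\<xi> (HX 1) x) (e (HX 1)) + fscale (\<xi> (HY 1) x) (e (HY 1)) + fscale (\<xi> HZ x) (e HZ)"
    using assms(1) by (simp add: sum_heis_index)
  finally have "x = fscale (\<xi> (HX 1) x) (e (HX 1)) + fscale (\<xi> (HY 1) x) (e (HY 1)) + fscale (\<xi> HZ x) (e HZ)" .
  moreover have "\<xi> (HY 1) x = 0" "\<xi> HZ x = 0"
    using assms by (auto intro!: \<xi>_parity[of _ x 0] simp: heis_index_def)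
  then have "fscale (\<xi> (HY 1) x) (e (HY 1)) = 0" "fscale (\<xi> HZ x) (e HZ) = 0"
    by (simp_all add: zero_fun_def)
  ultimately show ?thesis by (metis add.right_neutral)
qed

text \<open>Only words with two even letters and an odd one could contribute. The even part is spanned by one
  vector, so the two terms with an even letter next to z are opposite to each other.\<close>

lemma zwedge_m1:
  assumes m: "m = 1" and w: "w \<in> words H 3"
  shows "zwedge (HX 1) w = 0"
proof -
  have i: "HX 1 \<in> I" "HX 1 \<noteq> HZ" using m by (auto simp: heis_index_def)
  obtain a x b y c z where w: "w = [(a, x), (b, y), (c, z)]"
    and x: "x \<in> part H a" and y: "y \<in> part H b" and z: "z \<in> part H c" using w by (auto simp: words_3)
  define E where "E = e (HX 1)"
  have even: "omega m u t = \<xi> (HX 1) u * omega m E t" "omega m t u = \<xi> (HX 1) u * omega m t E"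
    if "u \<in> part H d" "d = 0" for u t d
    using \<xi>_even_m1[OF m, of u] that unfolding E_def by (metis omega_scale)+
  have odd: "\<xi> (HX 1) u = 0" if "u \<in> part H d" "d = 1" for u d
    using \<xi>_parity[OF i(1), of u 1] that by simp
  have xy: "a + b = 1 \<or> omega m x y = 0" using omega_parity[OF x y] by blast
  have xz: "a + c = 1 \<or> omega m x z = 0" using omega_parity[OF x z] by blast
  have yz: "b + c = 1 \<or> omega m y z = 0" using omega_parity[OF y z] by blast
  consider "a = 0" "b = 0" "c = 1" | "a = 0" "b = 1" "c = 0" | "a = 1" "b = 0" "c = 0"
    | "(a = 0 \<and> b = 0 \<and> c = 0) \<or> (a = 1 \<and> b = 1) \<or> (a = 1 \<and> c = 1) \<or> (b = 1 \<and> c = 1)"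
    by (cases a; cases b; cases c) auto
  then show ?thesis
  proof cases
    case 1
    then show ?thesis using xy odd[OF z] even[OF x, of z] even[OF y, of z]
      unfolding w zwedge_eq[OF i] by (simp add: psign_def)
  next
    case 2
    have "omega m y z = - omega m z y" by (rule omega_skew)
    then show ?thesis using 2 xz odd[OF y] even[OF x, of y] even[OF z, of y]
      unfolding w zwedge_eq[OF i] by (simp add: psign_def)
  next
    case 3
    have "omega m E x = - omega m x E" by (rule omega_skew)
    then show ?thesis using 3 yz odd[OF x] even[OF y, of x] even[OF z, of x]
      unfolding w zwedge_eq[OF i] by (simp add: psign_def)
  next
    case 4
    then show ?thesis using xy xz yz odd[OF x] odd[OF y] odd[OF z]
      unfolding w zwedge_eq[OF i] by auto
  qed
qed

lemma coord_HZ_HX_boundaries: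
  assumes "m = 1" "p \<in> boundaries H 2"
  shows "leval (coord HZ (HX 1)) p = 0"
proof -
  have i: "HX 1 \<in> I" using assms by (auto simp: heis_index_def)
  from assms(2) obtain q r where pqr: "p = boundary H q + r" and q: "q \<in> chains H (Suc 2)" and r: "r \<in> ext_rel H 2"
    unfolding boundaries_eq by blast
  have "q \<in> {q. leval (zwedge (HX 1)) q = 0}"
    by (rule chains_in_subspace[of q H 3]) (use q zwedge_m1[OF assms(1)] in \<open>auto simp: subspace_leval_zero\<close>)
  then show ?thesis using coord_ext_rel[OF _ i r] by (simp add: pqr leval_simps leval_zwedge)
qed

lemma e_even_nonzero: "i \<in> {1..m} \<Longrightarrow> e (HX i) \<in> part H 0 \<and> e (HX i) \<noteq> 0"
  using e_part[of "HX i"] \<xi>_e[of "HX i" "HX i"] \<xi>_0[of "HX i"] by (auto simp: heis_index_def)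

lemma hz_wedge_boundaries:
  assumes "v \<in> part H c" "c = 1 \<or> m \<ge> 2"
  shows "gen [(1, hz), (c, v)] \<in> boundaries H 2"
  using hz_wedge_bounded_through[OF two, of "e (HX 1)" m v c] e_even_nonzero[of 1] m_pos assms
    bounded_through_boundaries by auto

text \<open>All pairs with an index z are boundaries, except \<open>z \<and> x_1\<close> for m = 1.\<close>

lemma in_boundaries_by_coords:
  assumes p: "p \<in> chains H 2"
    and c: "\<And>i j. i \<in> I - {HZ} \<Longrightarrow> j \<in> I - {HZ} \<Longrightarrow> leval (coord i j) p = 0"
    and m1: "m = 1 \<Longrightarrow> leval (coord HZ (HX 1)) p = 0"
  shows "p \<in> boundaries H 2"
proof (rule in_subspace_by_coords[OF p heis.subspace_boundaries heis.ext_rel_boundaries])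
  have L: "leval (coord HZ j) p = 0 \<or> gen (pair HZ j) \<in> boundaries H 2" if j: "j \<in> I" for j
  proof (cases "par j = 1 \<or> m \<ge> 2")
    case True
    then show ?thesis using hz_wedge_boundaries[OF e_part[OF j]] by (simp add: e_HZ)
  next
    case False
    then have "m = 1" using m_pos by auto
    with False j have "j = HX 1" by (auto simp: heis_index_def)
    then show ?thesis using m1 \<open>m = 1\<close> by simp
  qed
  fix i j assume i: "i \<in> I" and j: "j \<in> I"
  consider "i = HZ" | "j = HZ" | "i \<noteq> HZ" "j \<noteq> HZ" by blast
  then show "leval (coord i j) p = 0 \<or> gen (pair i j) \<in> boundaries H 2"
  proof cases
    case 2
    have swap: "gen (pair i HZ) + cscale (psign (par i * par HZ)) (gen (pair HZ i)) \<in> boundaries H 2"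
      using heis.ext_rel_swap[of "[]" "par i" "e i" "par HZ" "e HZ" "[]" m 2] pair_words[OF i j] 2
        heis.ext_rel_boundaries by auto
    show ?thesis
    proof (cases "leval (coord HZ i) p = 0")
      case True
      then show ?thesis using leval_coord_swap[of i HZ p] 2 by simp
    next
      case False
      then have "gen (pair HZ i) \<in> boundaries H 2" using L[OF i] by blast
      from chain.subspace_diff[OF heis.subspace_boundaries swap
          chain.subspace_scale[OF heis.subspace_boundaries this, of "psign (par i * par HZ)"]]
      show ?thesis using 2 by simp
    qed
  qed (use L j c i in auto)
qed

definition bracket :: "(bit \<times> (heis_basis \<Rightarrow> 'f)) list \<Rightarrow> 'f" where
  "bracket w = omega m (snd (w ! 0)) (snd (w ! 1))"

lemma boundary_2:
  assumes "p \<in> chains H 2"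
  shows "boundary H p - cscale (leval bracket p) (gen [(1, hz)]) \<in> ext_rel H 1"
proof -
  have "p \<in> {p. boundary H p - cscale (leval bracket p) (gen [(1, hz)]) \<in> ext_rel H 1}" (is "_ \<in> {p. ?P p}")
  proof (rule chains_in_subspace[OF assms])
    show "chain.subspace {p. ?P p}"
      unfolding chain.subspace_def mem_Collect_eq
    proof (intro conjI allI ballI)
      show "?P 0" using chain.subspace_0[OF heis.subspace_ext_rel] by simp
      show "?P (p + q)" if "p \<in> {p. ?P p}" "q \<in> {p. ?P p}" for p q
        using chain.subspace_add[OF heis.subspace_ext_rel CollectD[OF that(1)] CollectD[OF that(2)]]
        by (simp add: leval_simps lin_ext_simps chain.scale_left_distrib algebra_simps del: cscale_gen)
      show "?P (cscale c p)" if "p \<in> {p. ?P p}" for c p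
        using chain.subspace_scale[OF heis.subspace_ext_rel CollectD[OF that(1)], of c]
        by (simp add: leval_simps lin_ext_simps chain.scale_right_diff_distrib)
    qed
    fix w assume "w \<in> words H 2"
    then obtain a x b y where w: "w = [(a, x), (b, y)]" and x: "x \<in> part H a" and y: "y \<in> part H b"
      by (auto simp: words_2)
    have "gen [(a + b, fscale (omega m x y) hz)] - cscale (omega m x y) (gen [(1, hz)]) \<in> ext_rel H 1"
    proof (cases "a + b = 1")
      case True
      then show ?thesis
        using heis.ext_rel_smult_letter[of "[]" 1 hz "[]" m 1 "omega m x y"] by (simp add: words_1 hz_part)
    next
      case False
      then have "omega m x y = 0" using omega_parity[OF x y] by blast
      moreover from this have "fscale (omega m x y) hz = 0" by (simp add: zero_fun_def)
      ultimately show ?thesis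
        using heis_null_letter[of "[]" "a + b" "[]" m 1 1] by (simp add: words_1 zero_part)
    qed
    then show "gen w \<in> {p. ?P p}" by (simp add: w word_boundary_2 bracket_def)
  qed
  then show ?thesis by simp
qed

text \<open>The boundary of a 2-chain is its total bracket times z, and z is not zero in the first exterior
  power, as its coordinate at z shows.\<close>

lemma cycles_iff: "p \<in> cycles H 2 \<longleftrightarrow> p \<in> chains H 2 \<and> leval bracket p = 0"
proof (intro iffI conjI)
  assume "p \<in> cycles H 2"
  then show p: "p \<in> chains H 2" and "leval bracket p = 0"
  proof -
    assume "p \<in> cycles H 2"
    then have p: "p \<in> chains H 2" and b: "boundary H p \<in> ext_rel H 1" by (auto simp: cycles_def)
    show "p \<in> chains H 2" by fact
    define \<phi> where "\<phi> = (\<lambda>w :: (bit \<times> (heis_basis \<Rightarrow> 'f)) list. snd (w ! 0) HZ)"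
    have kills: "leval \<phi> r = 0" if "r \<in> ext_rel H 1" for r
      by (rule CollectD[of r "\<lambda>p. leval \<phi> p = 0"], rule heis.ext_rel_in_subspace[OF that subspace_leval_zero])
         (auto simp: words_append leval_simps \<phi>_def)
    have "leval \<phi> (cscale (leval bracket p) (gen [(1, hz)])) = 0"
      using kills[OF b] kills[OF boundary_2[OF p]] by (simp add: leval_simps)
    then show "leval bracket p = 0" by (simp add: \<phi>_def hz_def)
  qed
next
  assume "p \<in> chains H 2 \<and> leval bracket p = 0"
  then show "p \<in> cycles H 2" using boundary_2[of p] by (simp add: cycles_def)
qed

text \<open>The cycle condition as a linear equation in the coordinates: only pairs of different parity have a
  bracket.\<close>

lemma bracket_coords:
  assumes "p \<in> chains H 2"
  shows "leval bracket p = (\<Sum>i\<in>{1..m}. \<Sum>j\<in>{1..m}. omega m (e (HX i)) (e (HY j)) * leval (coord (HX i) (HY j)) p)"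
proof -
  have "p \<in> {p. leval bracket p = (\<Sum>i\<in>{1..m}. \<Sum>j\<in>{1..m}. omega m (e (HX i)) (e (HY j)) * leval (coord (HX i) (HY j)) p)}"
    (is "_ \<in> {p. ?P p}")
  proof (rule chains_in_subspace[OF assms])
    show "chain.subspace {p. ?P p}"
      by (auto simp: chain.subspace_def leval_simps algebra_simps sum.distrib sum_distrib_left)
    fix w assume "w \<in> words H 2"
    then obtain a x b y where w: "w = [(a, x), (b, y)]" and x: "x \<in> part H a" and y: "y \<in> part H b"
      by (auto simp: words_2)
    have "omega m x y = omega m (\<Sum>i\<in>I. fscale (\<xi> i x) (e i)) (\<Sum>j\<in>I. fscale (\<xi> j y) (e j))"
      using expand[OF part_carrier_heis[OF x]] expand[OF part_carrier_heis[OF y]] by simp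
    also have "\<dots> = (\<Sum>i\<in>I. \<Sum>j\<in>I. \<xi> i x * \<xi> j y * omega m (e i) (e j))"
      by (subst omega_sum(1)) (simp only: omega_sum(2) omega_scale sum_distrib_left mult.assoc)
    also have "\<dots> = (\<Sum>i\<in>{1..m}. \<Sum>j\<in>{1..m}. \<xi> (HX i) x * \<xi> (HY j) y * omega m (e (HX i)) (e (HY j))) +
        (\<Sum>i\<in>{1..m}. \<Sum>j\<in>{1..m}. \<xi> (HY i) x * \<xi> (HX j) y * omega m (e (HY i)) (e (HX j)))"
    proof -
      have 0: "omega m (e i) (e j) = 0" if "i \<in> I" "j \<in> I" "par i = par j" for i j
        using omega_parity[OF e_part e_part] that by simp
      have XX: "omega m (e (HX i)) (e (HX j)) = 0" "omega m (e (HY i)) (e (HY j)) = 0"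
        if "i \<in> {1..m}" "j \<in> {1..m}" for i j
        using that by (auto intro!: 0 simp: heis_index_def)
      let ?F = "\<lambda>i j. \<xi> i x * \<xi> j y * omega m (e i) (e j)"
      have "(\<Sum>j\<in>I. ?F (HX i) j) = (\<Sum>j\<in>{1..m}. ?F (HX i) (HY j))" if "i \<in> {1..m}" for i
        using XX that by (simp add: sum_heis_index e_HZ)
      then have X: "(\<Sum>i\<in>{1..m}. \<Sum>j\<in>I. ?F (HX i) j) = (\<Sum>i\<in>{1..m}. \<Sum>j\<in>{1..m}. ?F (HX i) (HY j))"
        by (rule sum.cong[OF refl])
      have "(\<Sum>j\<in>I. ?F (HY i) j) = (\<Sum>j\<in>{1..m}. ?F (HY i) (HX j))" if "i \<in> {1..m}" for i
        using XX that by (simp add: sum_heis_index e_HZ)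
      then have Y: "(\<Sum>i\<in>{1..m}. \<Sum>j\<in>I. ?F (HY i) j) = (\<Sum>i\<in>{1..m}. \<Sum>j\<in>{1..m}. ?F (HY i) (HX j))"
        by (rule sum.cong[OF refl])
      have Z: "(\<Sum>j\<in>I. ?F HZ j) = 0" by (simp add: e_HZ)
      show ?thesis unfolding sum_heis_index[of "\<lambda>i. \<Sum>j\<in>I. ?F i j"] X Y Z by simp
    qed
    also have "(\<Sum>i\<in>{1..m}. \<Sum>j\<in>{1..m}. \<xi> (HY i) x * \<xi> (HX j) y * omega m (e (HY i)) (e (HX j))) =
        (\<Sum>i\<in>{1..m}. \<Sum>j\<in>{1..m}. - (omega m (e (HX i)) (e (HY j)) * (\<xi> (HY j) x * \<xi> (HX i) y)))"
      by (subst sum.swap, intro sum.cong refl, subst omega_skew) (simp add: mult_ac)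
    finally show "gen w \<in> {p. ?P p}"
      by (simp add: w bracket_def coord_def psign_def right_diff_distrib sum_subtractf sum_negf mult_ac)
  qed
  then show ?thesis by simp
qed

lemma \<xi>_mod_J:
  assumes "i \<in> I - IJ" "x \<in> carrier H" "x' \<in> carrier H" "proj x = proj x'"
  shows "\<xi> i x = \<xi> i x'"
proof -
  have J: "x - x' \<in> J" using assms(4) proj_eq_iff by blast
  then have c: "x - x' \<in> carrier H" using J_carrier by blast
  then have "\<xi> i (x - x') = 0" using J J_iff assms(1) by blast
  then show ?thesis using \<xi>_add[of i "x - x'" x'] c assms(1,3) by simp
qed

text \<open>Coordinates at indices outside J depend on the letters modulo J only; they are the coordinates of the image
  in the second exterior power of Q.\<close>

lemma coord_vanishes_if_pchain_ext_rel:
  assumes "i \<in> I - IJ" "j \<in> I - IJ" "p \<in> chains H 2" "pchain p \<in> ext_rel Q 2"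
  shows "leval (coord i j) p = 0"
proof (rule leval_vanishes_if_pchain_ext_rel[OF _ _ assms(3,4)])
  show "leval (coord i j) r = 0" if "r \<in> ext_rel H 2" for r
    using coord_ext_rel that assms by blast
  fix w w' assume "w \<in> words H 2" "w' \<in> words H 2" and eq: "pword w = pword w'"
  then obtain a x b y a' x' b' y' where w: "w = [(a, x), (b, y)]" "w' = [(a', x'), (b', y')]"
    and "x \<in> part H a" "y \<in> part H b" "x' \<in> part H a'" "y' \<in> part H b'"
    by (auto simp: words_2)
  then have c: "x \<in> carrier H" "x' \<in> carrier H" "y \<in> carrier H" "y' \<in> carrier H"
    by (blast intro: part_carrier_heis)+
  have p: "proj x = proj x'" "proj y = proj y'" using eq by (simp_all add: w)
  show "coord i j w = coord i j w'"
    unfolding w coord_def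
    using \<xi>_mod_J[OF assms(1) c(1,2) p(1)] \<xi>_mod_J[OF assms(2) c(1,2) p(1)]
      \<xi>_mod_J[OF assms(1) c(3,4) p(2)] \<xi>_mod_J[OF assms(2) c(3,4) p(2)] by simp
qed

lemma e_J: "b \<in> I \<inter> IJ \<Longrightarrow> e b \<in> J"
  using J_iff[of "e b"] e_part[of b] part_carrier_heis \<xi>_e by (metis (no_types, lifting) DiffE IntE)

lemma J_k0:
  assumes "k = 0" "x \<in> J" shows "x = fscale (\<xi> HZ x) hz"
proof -
  have x: "x \<in> carrier H" using assms J_carrier by blast
  have "\<xi> b x = 0" if "b \<in> I" "b \<noteq> HZ" for b using J_iff[OF x] assms that by auto
  then have "(\<Sum>b\<in>I. fscale (\<xi> b x) (e b)) = (\<Sum>b\<in>{HZ}. fscale (\<xi> b x) (e b))"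
    by (intro sum.mono_neutral_right) (auto simp: zero_fun_def)
  then show ?thesis using expand[OF x] by (simp add: e_HZ)
qed

lemma omega_mod_J:
  assumes "k = 0" "proj x = proj x'"
  shows "omega m x y = omega m x' y" "omega m y x = omega m y x'"
proof -
  have "x - x' = fscale (\<xi> HZ (x - x')) hz" using assms proj_eq_iff by (intro J_k0) blast+
  then have "x = fscale (\<xi> HZ (x - x')) hz + x'" by (simp add: algebra_simps)
  then show "omega m x y = omega m x' y" "omega m y x = omega m y x'"
    by (metis omega_add omega_scale omega_hz mult_zero_right add_0)+
qed

text \<open>For J spanned by z, the formula for \<open>zwedge i\<close> depends on the letters modulo J only. So \<open>zwedge i\<close> is a
  functional on the third exterior power of Q.\<close>

lemma zwedge_vanishes_if_pchain_ext_rel: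
  assumes k: "k = 0" and i: "i \<in> I" "i \<noteq> HZ" and p: "p \<in> chains H 3" "pchain p \<in> ext_rel Q 3"
  shows "leval (zwedge i) p = 0"
proof (rule leval_vanishes_if_pchain_ext_rel[OF _ _ p])
  show "leval (zwedge i) r = 0" if "r \<in> ext_rel H 3" for r
    using zwedge_ext_rel that i by blast
  fix w w' assume "w \<in> words H 3" "w' \<in> words H 3" and eq: "pword w = pword w'"
  then obtain a x b y c z a' x' b' y' c' z' where w: "w = [(a, x), (b, y), (c, z)]" "w' = [(a', x'), (b', y'), (c', z')]"
    and "x \<in> part H a" "y \<in> part H b" "z \<in> part H c" "x' \<in> part H a'" "y' \<in> part H b'" "z' \<in> part H c'"
    by (auto simp: words_3)
  then have C: "x \<in> carrier H" "x' \<in> carrier H" "y \<in> carrier H" "y' \<in> carrier H" "z \<in> carrier H" "z' \<in> carrier H"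
    by (blast intro: part_carrier_heis)+
  have p: "proj x = proj x'" "proj y = proj y'" "proj z = proj z'" and "a = a'" "b = b'" "c = c'"
    using eq by (simp_all add: w)
  have i': "i \<in> I - IJ" using i k by auto
  show "zwedge i w = zwedge i w'"
    unfolding w zwedge_eq[OF i] \<open>a = a'\<close> \<open>b = b'\<close> \<open>c = c'\<close>
    using \<xi>_mod_J[OF i' C(1,2) p(1)] \<xi>_mod_J[OF i' C(3,4) p(2)] \<xi>_mod_J[OF i' C(5,6) p(3)]
      omega_mod_J[OF k p(1)] omega_mod_J[OF k p(2)] omega_mod_J[OF k p(3)] by simp
qed

end

section \<open>The multiplier of the pair\<close>

text \<open>The part H3(H) \<open>\<rightarrow>\<close> H3(Q) \<open>\<rightarrow>\<close> M \<open>\<rightarrow>\<close> M(H) \<open>\<rightarrow>\<close> M(Q) of the exact sequence.\<close>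

locale heis_pair_multiplier = heis_coords m J k e \<xi>
  for m and J :: "(heis_basis \<Rightarrow> 'f::field) set" and k e \<xi> +
  fixes M :: "('f, 'w) lie_superalg" and \<alpha> \<beta>
  assumes M: "super_vectorspace M"
    and \<alpha>_lin: "even_linear (homology Q 3) M \<alpha>"
    and \<beta>_lin: "even_linear M (homology H 2) \<beta>"
    and exact_\<alpha>: "exact_at (homology H 3) (homology_map Q 3 proj) (homology Q 3) \<alpha> M"
    and exact_M: "exact_at (homology Q 3) \<alpha> M \<beta> (homology H 2)"
    and exact_\<beta>: "exact_at M \<beta> (homology H 2) (homology_map Q 2 proj) (homology Q 2)"
begin

sublocale M: super_vectorspace M by (rule M)

lemma cycles_Q3: "cycles Q 3 = chains Q 3"
  using cycles_Q[of 2] by (simp add: numeral_3_eq_3 numeral_2_eq_2)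

lemma \<alpha>_closed: "A \<in> carrier (homology Q 3) \<Longrightarrow> \<alpha> A \<in> carrier M"
  and \<alpha>_add: "A \<in> carrier (homology Q 3) \<Longrightarrow> B \<in> carrier (homology Q 3) \<Longrightarrow>
    \<alpha> (A \<oplus>\<^bsub>homology Q 3\<^esub> B) = \<alpha> A \<oplus>\<^bsub>M\<^esub> \<alpha> B"
  and \<alpha>_smult: "A \<in> carrier (homology Q 3) \<Longrightarrow> \<alpha> (c \<odot>\<^bsub>homology Q 3\<^esub> A) = c \<odot>\<^bsub>M\<^esub> \<alpha> A"
proof -
  have h: "\<alpha> \<in> LinearCombinations.module_hom class_ring (homology Q 3) M"
    using \<alpha>_lin by (auto simp: even_linear_def linear_map_def mod_hom_def mod_hom_axioms_def)
  show "A \<in> carrier (homology Q 3) \<Longrightarrow> \<alpha> A \<in> carrier M"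
    using LinearCombinations.module_hom_closed[OF h] by blast
  show "A \<in> carrier (homology Q 3) \<Longrightarrow> B \<in> carrier (homology Q 3) \<Longrightarrow>
    \<alpha> (A \<oplus>\<^bsub>homology Q 3\<^esub> B) = \<alpha> A \<oplus>\<^bsub>M\<^esub> \<alpha> B"
    using LinearCombinations.module_hom_add[OF h] by blast
  show "A \<in> carrier (homology Q 3) \<Longrightarrow> \<alpha> (c \<odot>\<^bsub>homology Q 3\<^esub> A) = c \<odot>\<^bsub>M\<^esub> \<alpha> A"
    using LinearCombinations.module_hom_smult[OF h, of c A] by simp
qed

lemma \<beta>_add: "v \<in> carrier M \<Longrightarrow> w \<in> carrier M \<Longrightarrow> \<beta> (v \<oplus>\<^bsub>M\<^esub> w) = \<beta> v \<oplus>\<^bsub>homology H 2\<^esub> \<beta> w"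
  and \<beta>_smult: "v \<in> carrier M \<Longrightarrow> \<beta> (c \<odot>\<^bsub>M\<^esub> v) = c \<odot>\<^bsub>homology H 2\<^esub> \<beta> v"
  and \<beta>_part: "v \<in> part M a \<Longrightarrow> \<beta> v \<in> part (homology H 2) a"
proof -
  have h: "\<beta> \<in> LinearCombinations.module_hom class_ring M (homology H 2)"
    using \<beta>_lin by (auto simp: even_linear_def linear_map_def mod_hom_def mod_hom_axioms_def)
  show "v \<in> carrier M \<Longrightarrow> w \<in> carrier M \<Longrightarrow> \<beta> (v \<oplus>\<^bsub>M\<^esub> w) = \<beta> v \<oplus>\<^bsub>homology H 2\<^esub> \<beta> w"
    using LinearCombinations.module_hom_add[OF h] by blast
  show "v \<in> carrier M \<Longrightarrow> \<beta> (c \<odot>\<^bsub>M\<^esub> v) = c \<odot>\<^bsub>homology H 2\<^esub> \<beta> v"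
    using LinearCombinations.module_hom_smult[OF h, of c v] by simp
  show "v \<in> part M a \<Longrightarrow> \<beta> v \<in> part (homology H 2) a"
    using \<beta>_lin by (auto simp: even_linear_def)
qed

definition class_in_H3_Q :: "('f, heis_basis \<Rightarrow> 'f) chain \<Rightarrow> ('f, (heis_basis \<Rightarrow> 'f) set) chain set" where
  "class_in_H3_Q p = hclass Q 3 (pchain p)"

lemma carrier_homology_Q3: "carrier (homology Q 3) = class_in_H3_Q ` chains H 3"
proof -
  have "chains Q 3 = pchain ` chains H 3" using chains_lift[of _ 3] pchain_chains[of _ 3] by blast
  then show ?thesis by (simp add: carrier_homology cycles_Q3 class_in_H3_Q_def image_image)
qed

lemma class_in_H3_Q_carrier: "p \<in> chains H 3 \<Longrightarrow> class_in_H3_Q p \<in> carrier (homology Q 3)"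
  by (simp add: carrier_homology_Q3)

lemma class_in_H3_Q_add: "class_in_H3_Q (p + q) = class_in_H3_Q p \<oplus>\<^bsub>homology Q 3\<^esub> class_in_H3_Q q"
  by (simp add: class_in_H3_Q_def Q.hclass_add lin_ext_simps)

lemma class_in_H3_Q_smult: "class_in_H3_Q (cscale c p) = c \<odot>\<^bsub>homology Q 3\<^esub> class_in_H3_Q p"
  by (simp add: class_in_H3_Q_def Q.hclass_smult lin_ext_simps)

lemma class_in_H3_Q_eq_iff: "class_in_H3_Q p = class_in_H3_Q q \<longleftrightarrow> pchain (p - q) \<in> ext_rel Q 3"
  by (simp add: class_in_H3_Q_def Q.hclass_eq_iff boundaries_Q lin_ext_simps)

lemma \<alpha>_class_in_H3_Q_zero_iff:
  assumes "p \<in> chains H 3"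
  shows "\<alpha> (class_in_H3_Q p) = \<zero>\<^bsub>M\<^esub> \<longleftrightarrow> (\<exists>q\<in>cycles H 3. pchain (p - q) \<in> ext_rel Q 3)"
proof -
  have "\<alpha> (class_in_H3_Q p) = \<zero>\<^bsub>M\<^esub> \<longleftrightarrow> class_in_H3_Q p \<in> homology_map Q 3 proj ` carrier (homology H 3)"
    using exact_\<alpha> class_in_H3_Q_carrier[OF assms] unfolding exact_at_def by blast
  also have "homology_map Q 3 proj ` carrier (homology H 3) = class_in_H3_Q ` cycles H 3"
    unfolding carrier_homology image_image homology_map_hclass class_in_H3_Q_def ..
  finally show ?thesis by (auto simp: class_in_H3_Q_eq_iff)
qed

lemma \<beta>_class:
  assumes "v \<in> carrier M"
  obtains p where "p \<in> cycles H 2" "pchain p \<in> ext_rel Q 2" "\<beta> v = hclass H 2 p"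
proof -
  have "\<beta> v \<in> carrier (homology H 2) \<and> homology_map Q 2 proj (\<beta> v) = boundaries Q 2"
    using exact_\<beta> assms unfolding exact_at_def zero_homology by blast
  then obtain p where "p \<in> cycles H 2" "\<beta> v = hclass H 2 p" "hclass Q 2 (pchain p) = boundaries Q 2"
    unfolding carrier_homology using homology_map_hclass[of 2] by auto
  then show ?thesis using that Q.hclass_zero_iff boundaries_Q by metis
qed

lemma \<beta>_lift:
  assumes "p \<in> cycles H 2" "pchain p \<in> ext_rel Q 2"
  shows "\<exists>v\<in>carrier M. \<beta> v = hclass H 2 p"
proof -
  have "homology_map Q 2 proj (hclass H 2 p) = boundaries Q 2"
    unfolding homology_map_hclass using assms Q.hclass_zero_iff boundaries_Q by metis
  moreover have "hclass H 2 p \<in> carrier (homology H 2)"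
    unfolding carrier_homology using assms by blast
  ultimately have "hclass H 2 p \<in> \<beta> ` carrier M"
    using exact_\<beta> unfolding exact_at_def zero_homology by blast
  then show ?thesis by auto
qed

lemma \<beta>_zero_iff: "v \<in> carrier M \<Longrightarrow> \<beta> v = boundaries H 2 \<longleftrightarrow> (\<exists>p\<in>chains H 3. v = \<alpha> (class_in_H3_Q p))"
  using exact_M unfolding exact_at_def zero_homology carrier_homology_Q3 by blast

definition kills_boundaries :: "heis_basis \<times> heis_basis \<Rightarrow> bool" where
  "kills_boundaries s \<longleftrightarrow> (\<forall>p\<in>boundaries H 2. leval (coord (fst s) (snd s)) p = 0)"

text \<open>The coordinate at the pair s of a cycle that represents \<open>\<beta> v\<close>. For pairs with \<open>kills_boundaries\<close> it does not depend on the
  representative.\<close>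

definition h2_coord :: "heis_basis \<times> heis_basis \<Rightarrow> 'w \<Rightarrow> 'f" where
  "h2_coord s v = leval (coord (fst s) (snd s)) (SOME p. p \<in> \<beta> v)"

lemma h2_coord_eq:
  assumes s: "kills_boundaries s" and v: "\<beta> v = hclass H 2 p"
  shows "h2_coord s v = leval (coord (fst s) (snd s)) p"
proof -
  have "(SOME p. p \<in> \<beta> v) \<in> hclass H 2 p" unfolding v by (rule someI[of _ p]) (rule heis.hclass_self)
  then have "(SOME p. p \<in> \<beta> v) - p \<in> boundaries H 2" by (simp add: heis.mem_hclass)
  then have "leval (coord (fst s) (snd s)) ((SOME p. p \<in> \<beta> v) - p) = 0"
    using s unfolding kills_boundaries_def by blast
  then show ?thesis by (simp add: h2_coord_def leval_simps)
qed

lemma h2_coord_add: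
  assumes s: "kills_boundaries s" and vw: "v \<in> carrier M" "w \<in> carrier M"
  shows "h2_coord s (v \<oplus>\<^bsub>M\<^esub> w) = h2_coord s v + h2_coord s w"
proof -
  obtain p where p: "\<beta> v = hclass H 2 p" using \<beta>_class[OF vw(1)] .
  obtain q where q: "\<beta> w = hclass H 2 q" using \<beta>_class[OF vw(2)] .
  have "\<beta> (v \<oplus>\<^bsub>M\<^esub> w) = hclass H 2 (p + q)" by (simp add: \<beta>_add vw p q heis.hclass_add)
  then show ?thesis using h2_coord_eq[OF s] p q by (simp add: leval_simps)
qed

lemma h2_coord_smult:
  assumes s: "kills_boundaries s" and v: "v \<in> carrier M"
  shows "h2_coord s (c \<odot>\<^bsub>M\<^esub> v) = c * h2_coord s v"
proof -
  obtain p where p: "\<beta> v = hclass H 2 p" using \<beta>_class[OF v] .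
  have "\<beta> (c \<odot>\<^bsub>M\<^esub> v) = hclass H 2 (cscale c p)" by (simp add: \<beta>_smult v p heis.hclass_smult)
  then show ?thesis using h2_coord_eq[OF s] p by (simp add: leval_simps)
qed

lemma coord_parity:
  assumes "i \<in> I" "j \<in> I" "w \<in> words H 2" "sum_list (map fst w) \<noteq> par i + par j"
  shows "coord i j w = 0"
proof -
  obtain a x b y where w: "w = [(a, x), (b, y)]" and x: "x \<in> part H a" and y: "y \<in> part H b"
    using assms(3) by (auto simp: words_2)
  have "a + b \<noteq> par i + par j" using assms(4) by (simp add: w)
  then have "\<not> (par i = a \<and> par j = b)" "\<not> (par j = a \<and> par i = b)" by (auto simp: add.commute)
  then have "\<xi> i x * \<xi> j y = 0" "\<xi> j x * \<xi> i y = 0"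
    using \<xi>_parity[OF assms(1) x] \<xi>_parity[OF assms(2) y] \<xi>_parity[OF assms(2) x] \<xi>_parity[OF assms(1) y]
    by auto
  then show ?thesis by (auto simp: w coord_def)
qed

lemma h2_coord_parity:
  assumes s: "kills_boundaries s" "fst s \<in> I" "snd s \<in> I" and v: "v \<in> part M a" and a: "a \<noteq> par (fst s) + par (snd s)"
  shows "h2_coord s v = 0"
proof -
  obtain p where p: "p \<in> part (chain_space H 2) a" "\<beta> v = hclass H 2 p"
    using \<beta>_part[OF v] by (auto simp: part_homology)
  have "p \<in> {p. leval (coord (fst s) (snd s)) p = 0}"
  proof (rule supported_in_subspace[OF _ subspace_leval_zero])
    show "Poly_Mapping.keys p \<subseteq> {w \<in> words H 2. sum_list (map fst w) = a}"
      using p(1) by (simp add: chain_space_def)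
  qed (use coord_parity[OF s(2,3)] a in auto)
  then show ?thesis using h2_coord_eq[OF s(1) p(2)] by simp
qed

lemma pair_J_pchain:
  assumes "i \<in> I" "j \<in> I" "i \<in> IJ \<or> j \<in> IJ"
  shows "pchain (gen (pair i j)) \<in> ext_rel Q 2"
proof -
  obtain b where "(par b, e b) \<in> set (pair i j)" "e b \<in> J" using assms e_J by auto
  then show ?thesis using pchain_J_letter[OF pair_words[OF assms(1,2)]] by blast
qed

text \<open>The indices i for which \<open>z \<and> e i\<close> is not a boundary.\<close>

definition exceptional :: "heis_basis set" where
  "exceptional = (if m = 1 then {HX 1} else {})"

lemma exceptional_I: "exceptional \<subseteq> I" "HZ \<notin> exceptional" "b \<in> exceptional \<Longrightarrow> m = 1 \<and> b = HX 1"
  by (auto simp: exceptional_def heis_index_def split: if_splits)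

lemma kills_boundariesI:
  assumes "fst s \<in> I" "snd s \<in> I" "fst s \<noteq> HZ" "snd s \<noteq> HZ \<or> fst s \<in> exceptional"
  shows "kills_boundaries s"
proof (cases "snd s = HZ")
  case True
  then have "m = 1" "fst s = HX 1" using assms exceptional_I by auto
  then show ?thesis
    unfolding kills_boundaries_def True using coord_HZ_HX_boundaries leval_coord_swap[of "HX 1" HZ] by auto
next
  case False
  then show ?thesis unfolding kills_boundaries_def using coord_boundaries assms by blast
qed

lemma exceptional_kills_boundaries:
  assumes "s \<in> exceptional \<times> {HZ}" shows "kills_boundaries s"
proof -
  obtain b where b: "s = (b, HZ)" "b \<in> exceptional" using assms by blast
  then have "b \<in> I" "b \<noteq> HZ" using exceptional_I by auto
  then show ?thesis using kills_boundariesI[of s] b by simp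
qed

lemma in_boundaries_if_coords:
  assumes "p \<in> chains H 2"
    and "\<And>i j. i \<in> I - {HZ} \<Longrightarrow> j \<in> I - {HZ} \<Longrightarrow> leval (coord i j) p = 0"
    and "\<And>i. i \<in> exceptional \<Longrightarrow> leval (coord i HZ) p = 0"
  shows "p \<in> boundaries H 2"
proof (rule in_boundaries_by_coords[OF assms(1,2)])
  assume "m = 1"
  then have "HX 1 \<in> exceptional" unfolding exceptional_def by simp
  from assms(3)[OF this] show "leval (coord HZ (HX 1)) p = 0"
    using leval_coord_swap[of HZ "HX 1" p] by simp
qed

subsection \<open>Ideals with nonzero even part\<close>

text \<open>The boundary of p is a combination of terms \<open>z \<and> v\<close>, and so for \<open>m \<ge> 2\<close> it is also the boundary of a chain r
  through an even x in J. The cycle p - r has the same image in Q. For m = 1 nothing is left of Q.\<close>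

lemma H3_surjective:
  assumes k: "k \<ge> 1" and p: "p \<in> chains H 3"
  shows "\<exists>q\<in>cycles H 3. pchain (p - q) \<in> ext_rel Q 3"
proof (cases "m \<ge> 2")
  case True
  define x where "x = e (HX 1)"
  have x: "x \<in> part H 0" "x \<noteq> 0" using e_even_nonzero[of 1] m_pos by (auto simp: x_def)
  have xJ: "x \<in> J" unfolding x_def by (rule e_J) (use k m_pos in \<open>auto simp: heis_index_def\<close>)
  have "boundary H p \<in> bounded_through m x"
  proof (rule heis.boundary_in_subspace[of _ _ 2])
    fix a y b z v assume yz: "y \<in> part H a" "z \<in> part H b" and w: "(a + b, lbrak H y z) # v \<in> words H 2"
    then obtain c t where v: "v = [(c, t)]" "t \<in> part H c" by (auto simp: words_2)
    have "omega m y z = 0 \<or> a + b = 1 \<and> gen [(1, hz), (c, t)] \<in> bounded_through m x"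
      using hz_wedge_bounded_through[OF two x v(2)] True omega_parity[OF yz] by blast
    then show "gen ((a + b, lbrak H y z) # v) \<in> bounded_through m x"
      unfolding v(1) heis_simps
      by (rule bracket_letter_in_subspace[OF subspace_bounded_through ext_rel_bounded_through v(2)])
  qed (use p subspace_bounded_through in auto)
  then obtain r where r: "r \<in> through m x" "boundary H p - boundary H r \<in> ext_rel H 2"
    unfolding bounded_through_def by blast
  have "r \<in> {r. pchain r \<in> ext_rel Q 3}"
  proof (rule set_mp[OF chain.span_minimal r(1)[unfolded through_def]])
    show "chain.subspace {r. pchain r \<in> ext_rel Q 3}"
      by (intro subspace_vimage_lin_ext Q.subspace_ext_rel)
    show "{gen w |w. w \<in> words H 3 \<and> (0, x) \<in> set w} \<subseteq> {r. pchain r \<in> ext_rel Q 3}"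
      using pchain_J_letter[OF _ _ xJ] by blast
  qed
  moreover have "p - r \<in> cycles H 3"
    using r p through_chains[of m x] chain.subspace_diff[OF subspace_chains[of H 3], of p r]
    by (auto simp: cycles_def lin_ext_simps)
  ultimately show ?thesis by (intro bexI[of _ "p - r"]) auto
next
  case False
  then have m: "m = 1" "k = 1" using m_pos k_le k by auto
  have all: "x \<in> J" if "x \<in> part H a" for x a
    using J_iff[OF part_carrier_heis[OF that]] m by (auto simp: heis_index_def)
  have "p \<in> {p. pchain p \<in> ext_rel Q 3}"
  proof (rule chains_in_subspace[OF p])
    fix w assume w: "w \<in> words H 3"
    then obtain a x b y c z where "w = [(a, x), (b, y), (c, z)]" "x \<in> part H a" by (auto simp: words_3)
    then show "gen w \<in> {p. pchain p \<in> ext_rel Q 3}"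
      using pchain_J_letter[OF w, of a x] all by simp
  qed (intro subspace_vimage_lin_ext Q.subspace_ext_rel)
  moreover have "0 \<in> cycles H 3"
    using chain.subspace_0[OF subspace_chains[of H 3]] chain.subspace_0[OF heis.subspace_ext_rel[of m 2]]
    by (simp add: cycles_def)
  ultimately show ?thesis by (intro bexI[of _ 0]) auto
qed

lemma \<beta>_injective:
  assumes "k \<ge> 1" "v \<in> carrier M" "\<beta> v = boundaries H 2"
  shows "v = \<zero>\<^bsub>M\<^esub>"
proof -
  obtain p where p: "p \<in> chains H 3" "v = \<alpha> (class_in_H3_Q p)" using \<beta>_zero_iff[OF assms(2)] assms(3) by blast
  then show ?thesis using \<alpha>_class_in_H3_Q_zero_iff[OF p(1)] H3_surjective[OF assms(1) p(1)] by simp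
qed

text \<open>Pairs of indices, not both outside J, that give coordinates on the kernel of the map between the second
  exterior powers of V and Q. A repeated index occurs only for odd basis vectors.\<close>

definition even_pairs :: "(heis_basis \<times> heis_basis) set" where
  "even_pairs = (\<lambda>(i, j). (HX i, HX j)) ` (SIGMA i:{1..k}. {i<..m}) \<union>
     (\<lambda>(i, j). (HY i, HY j)) ` (SIGMA i:{1..k}. {i..m})"

definition odd_pairs :: "(heis_basis \<times> heis_basis) set" where
  "odd_pairs = (\<lambda>(i, j). (HX i, HY j)) ` ({1..m} \<times> {1..m} - {k<..m} \<times> {k<..m})"

abbreviation all_pairs :: "(heis_basis \<times> heis_basis) set" where
  "all_pairs \<equiv> even_pairs \<union> odd_pairs \<union> exceptional \<times> {HZ}"

abbreviation coord_pairs :: "heis_basis \<times> heis_basis \<Rightarrow> (heis_basis \<times> heis_basis) set" where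
  "coord_pairs s0 \<equiv> even_pairs \<union> (odd_pairs - {s0}) \<union> exceptional \<times> {HZ}"

lemma mem_pairs:
  "(HX a, HX b) \<in> even_pairs \<longleftrightarrow> 1 \<le> a \<and> a \<le> k \<and> a < b \<and> b \<le> m"
  "(HY a, HY b) \<in> even_pairs \<longleftrightarrow> 1 \<le> a \<and> a \<le> k \<and> a \<le> b \<and> b \<le> m"
  "(HX a, HY b) \<in> odd_pairs \<longleftrightarrow> 1 \<le> a \<and> a \<le> m \<and> 1 \<le> b \<and> b \<le> m \<and> (a \<le> k \<or> b \<le> k)"
  "(HX a, HY b) \<notin> even_pairs" "(HY a, HX b) \<notin> even_pairs" "(i, HZ) \<notin> even_pairs" "(HZ, i) \<notin> even_pairs"
  "(HX a, HX b) \<notin> odd_pairs" "(HY a, i) \<notin> odd_pairs" "(i, HZ) \<notin> odd_pairs" "(HZ, i) \<notin> odd_pairs"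
  by (auto simp: even_pairs_def odd_pairs_def)

lemma pairs_index:
  assumes "s \<in> even_pairs \<union> odd_pairs"
  shows "fst s \<in> I - {HZ}" "snd s \<in> I - {HZ}" "fst s \<in> IJ \<or> snd s \<in> IJ"
  using assms k_le by (auto simp: even_pairs_def odd_pairs_def heis_index_def)

lemma pairs_parity:
  "s \<in> even_pairs \<Longrightarrow> par (fst s) + par (snd s) = 0" "s \<in> odd_pairs \<Longrightarrow> par (fst s) + par (snd s) = 1"
  by (auto simp: even_pairs_def odd_pairs_def)

lemma all_pairs_facts:
  assumes "s \<in> all_pairs"
  shows "fst s \<in> I" "snd s \<in> I" "fst s \<in> IJ \<or> snd s \<in> IJ" "kills_boundaries s"
proof -
  have *: "fst s \<in> I \<and> snd s \<in> I \<and> (fst s \<in> IJ \<or> snd s \<in> IJ) \<and> fst s \<noteq> HZ \<and> (snd s \<noteq> HZ \<or> fst s \<in> exceptional)"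
  proof (cases "s \<in> exceptional \<times> {HZ}")
    case True
    then obtain b where "s = (b, HZ)" "b \<in> exceptional" by blast
    then show ?thesis using exceptional_I by auto
  next
    case False
    then show ?thesis using assms pairs_index[of s] by blast
  qed
  then show "fst s \<in> I" "snd s \<in> I" "fst s \<in> IJ \<or> snd s \<in> IJ" "kills_boundaries s"
    using kills_boundariesI[of s] by blast+
qed

lemma pairs_cover:
  assumes "i \<in> I - {HZ}" "j \<in> I - {HZ}"
  shows "(i, j) \<in> even_pairs \<union> odd_pairs \<or> (j, i) \<in> even_pairs \<union> odd_pairs \<or>
    (i \<in> I - IJ \<and> j \<in> I - IJ) \<or> (\<exists>l. i = HX l \<and> j = HX l)"
  using assms by (cases i; cases j) (auto simp: heis_index_def mem_pairs)

text \<open>No two different coordinates belong to the same unordered pair. This makes the matrix of coordinates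
  of the pairs themselves diagonal.\<close>

lemma pairs_swap:
  assumes "s \<in> all_pairs" "t \<in> all_pairs"
    "snd t = fst s" "fst t = snd s"
  shows "s = t \<and> par (fst s) = 1 \<and> par (snd s) = 1"
proof -
  obtain i j where s: "s = (i, j)" and t: "t = (j, i)" using assms(3,4) by (metis prod.collapse)
  show ?thesis
    using assms(1,2) unfolding s t by (cases i; cases j) (auto simp: mem_pairs exceptional_I(2))
qed

lemma pairs_diag:
  assumes "s \<in> all_pairs" "fst s = snd s"
  shows "par (fst s) = 1"
proof -
  obtain i where s: "s = (i, i)" using assms(2) by (metis prod.collapse)
  show ?thesis using assms(1) unfolding s by (cases i) (auto simp: mem_pairs)
qed

text \<open>The vector \<open>e (HX 1)\<close> of J is not orthogonal to all of V, because \<omega> is nondegenerate.\<close>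

lemma exists_bracket_pair:
  assumes "k \<ge> 1"
  shows "\<exists>s\<in>odd_pairs. omega m (e (fst s)) (e (snd s)) \<noteq> 0"
proof (rule ccontr)
  assume *: "\<not> ?thesis"
  have 1: "1 \<in> {1..m}" using m_pos by auto
  define x where "x = e (HX 1)"
  have x: "x \<in> part H 0" "x \<noteq> 0" using e_even_nonzero[OF 1] by (auto simp: x_def)
  obtain j where j: "j \<in> {1..m}" "x (HX j) \<noteq> 0" using even_nonzero_dual[OF x] .
  have Y: "omega m x (e (HY l)) = 0" if "l \<in> {1..m}" for l
  proof -
    have "(HX 1, HY l) \<in> odd_pairs" unfolding odd_pairs_def using that assms m_pos by force
    then show ?thesis using * by (force simp: x_def)
  qed
  have X: "omega m x (e (HX l)) = 0" if "l \<in> {1..m}" for l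
    using omega_parity[OF x(1) e_part[of "HX l"]] that by (simp add: heis_index_def)
  let ?y = "delta (HY j) :: heis_basis \<Rightarrow> 'f"
  have "?y \<in> carrier H" using delta_part(2)[OF j(1)] by (rule part_carrier_heis)
  then have "omega m x ?y = omega m x (\<Sum>b\<in>I. fscale (\<xi> b ?y) (e b))"
    by (intro arg_cong[where f = "omega m x"] expand)
  also have "\<dots> = (\<Sum>b\<in>I. \<xi> b ?y * omega m x (e b))" by (simp only: omega_sum omega_scale)
  also have "\<dots> = 0" by (simp add: sum_heis_index X Y e_HZ)
  finally show False using j omega_delta_HY[OF j(1), of x] by simp
qed

text \<open>The cycle equation has a nonzero coefficient at some odd pair s0. It therefore determines the coordinate at s0, and any
  values of the other coordinates are attained by correcting with a multiple of the pair s0.\<close>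

lemma coordinates_k_pos:
  assumes k: "k \<ge> 1"
  obtains s0 where "s0 \<in> odd_pairs"
    "\<And>v. v \<in> carrier M \<Longrightarrow> (\<And>s. s \<in> coord_pairs s0 \<Longrightarrow> h2_coord s v = 0) \<Longrightarrow> v = \<zero>\<^bsub>M\<^esub>"
    "\<And>s. s \<in> coord_pairs s0 \<Longrightarrow>
      \<exists>v\<in>carrier M. \<forall>t\<in>coord_pairs s0. h2_coord t v = (if s = t then 1 else 0)"
proof -
  obtain s0 where s0: "s0 \<in> odd_pairs" and A0: "omega m (e (fst s0)) (e (snd s0)) \<noteq> 0"
    using exists_bracket_pair[OF k] by blast
  show thesis
  proof (rule that[OF s0])
    fix v assume v: "v \<in> carrier M" and T0: "\<And>s. s \<in> coord_pairs s0 \<Longrightarrow> h2_coord s v = 0"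
    obtain p where p: "p \<in> cycles H 2" "pchain p \<in> ext_rel Q 2" "\<beta> v = hclass H 2 p"
      using \<beta>_class[OF v] .
    have pc: "p \<in> chains H 2" and br: "leval bracket p = 0" using p(1) by (auto simp: cycles_iff)
    have c: "leval (coord (fst s) (snd s)) p = 0" if "s \<in> coord_pairs s0" for s
    proof -
      have "s \<in> all_pairs" using that by blast
      then show ?thesis using T0[OF that] h2_coord_eq[OF all_pairs_facts(4) p(3)] by metis
    qed
    have free: "leval (coord i j) p = 0" if "i \<in> I - IJ" "j \<in> I - IJ" for i j
      using coord_vanishes_if_pchain_ext_rel[OF that pc p(2)] .
    \<comment> \<open>The coordinate at s0 is determined by the others because p is a cycle.\<close>
    have c0: "leval (coord (fst s0) (snd s0)) p = 0"
    proof -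
      obtain i0 j0 where ij0: "s0 = (HX i0, HY j0)" "i0 \<in> {1..m}" "j0 \<in> {1..m}"
        using s0 by (auto simp: odd_pairs_def)
      have other: "leval (coord (HX i) (HY j)) p = 0" if "i \<in> {1..m}" "j \<in> {1..m}" "(i, j) \<noteq> (i0, j0)" for i j
      proof (cases "i \<le> k \<or> j \<le> k")
        case True
        then have "(HX i, HY j) \<in> odd_pairs - {s0}" using that by (auto simp: odd_pairs_def ij0)
        then show ?thesis using c[of "(HX i, HY j)"] by auto
      next
        case False
        then show ?thesis using that by (intro free) (auto simp: heis_index_def)
      qed
      have "0 = (\<Sum>(i, j)\<in>{1..m} \<times> {1..m}. omega m (e (HX i)) (e (HY j)) * leval (coord (HX i) (HY j)) p)"
        using bracket_coords[OF pc] br by (simp add: sum.cartesian_product)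
      also have "\<dots> = (\<Sum>(i, j)\<in>{(i0, j0)}. omega m (e (HX i)) (e (HY j)) * leval (coord (HX i) (HY j)) p)"
      proof (rule sum.mono_neutral_right, goal_cases)
        case 3
        show ?case
        proof
          fix s assume "s \<in> {1..m} \<times> {1..m} - {(i0, j0)}"
          then obtain i j where "s = (i, j)" "i \<in> {1..m}" "j \<in> {1..m}" "(i, j) \<noteq> (i0, j0)" by blast
          then show "(case s of (i, j) \<Rightarrow> omega m (e (HX i)) (e (HY j)) * leval (coord (HX i) (HY j)) p) = 0"
            using other[of i j] by simp
        qed
      qed (use ij0 in auto)
      finally show ?thesis using A0 by (simp add: ij0)
    qed
    have all: "leval (coord (fst s) (snd s)) p = 0" if "s \<in> all_pairs" for s
      using that c c0 by (cases "s = s0") auto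
    have "p \<in> boundaries H 2"
    proof (rule in_boundaries_if_coords[OF pc])
      fix i j assume ij: "i \<in> I - {HZ}" "j \<in> I - {HZ}"
      then consider "(i, j) \<in> all_pairs" | "(j, i) \<in> all_pairs" | "i \<in> I - IJ" "j \<in> I - IJ" | l where "i = HX l" "j = HX l"
        using pairs_cover by blast
      then show "leval (coord i j) p = 0"
      proof cases
        case 1
        then show ?thesis using all[of "(i, j)"] by simp
      next
        case 2
        then show ?thesis using all[of "(j, i)"] leval_coord_swap[of i j p] by simp
      next
        case 3
        then show ?thesis by (rule free)
      next
        case 4
        then have "leval (coord i j) p = - leval (coord i j) p"
          using leval_coord_swap[of i i p] by (simp add: psign_def)
        then have "2 * leval (coord i j) p = 0" by (simp add: eq_neg_iff_add_eq_0)
        then show ?thesis using two by simp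
      qed
    next
      fix i assume "i \<in> exceptional"
      then show "leval (coord i HZ) p = 0" using all[of "(i, HZ)"] by simp
    qed
    then have "\<beta> v = boundaries H 2" using p(3) heis.hclass_zero_iff by metis
    then show "v = \<zero>\<^bsub>M\<^esub>" by (rule \<beta>_injective[OF k v])
  next
    fix s assume s: "s \<in> coord_pairs s0"
    then have sA: "s \<in> all_pairs" and s0A: "s0 \<in> all_pairs" using s0 by auto
    let ?c = "\<lambda>t. coord (fst t) (snd t)" and ?g = "\<lambda>t. pair (fst t) (snd t)"
    have val: "?c t (?g r) = (if r = t then if fst r = snd r then 2 else 1 else 0)" if "r \<in> all_pairs" "t \<in> all_pairs" for r t
    proof -
      have cp: "?c t (?g r) = (if fst t = fst r \<and> snd t = snd r then 1 else 0) -
          psign (par (fst t) * par (snd t)) * (if snd t = fst r \<and> fst t = snd r then 1 else 0)"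
        by (rule coord_pair) (use all_pairs_facts that in blast)+
      show ?thesis
      proof (cases "r = t")
        case True
        show ?thesis
        proof (cases "fst r = snd r")
          case diag: True
          then have "par (fst r) = 1" by (rule pairs_diag[OF that(1)])
          then show ?thesis unfolding cp using \<open>r = t\<close> diag[symmetric] by (simp add: psign_def)
        next
          case False
          then show ?thesis unfolding cp using \<open>r = t\<close> by simp
        qed
      next
        case False
        then have "\<not> (fst t = fst r \<and> snd t = snd r)" by (metis prod_eq_iff)
        moreover have "\<not> (snd t = fst r \<and> fst t = snd r)" using pairs_swap[OF that] False by blast
        ultimately show ?thesis unfolding cp using False by (simp only: if_False simp_thms mult_zero_right diff_zero)
      qed
    qed
    \<comment> \<open>The coordinate at a repeated index takes the value 2 on its own pair. The multiple d of the
      pair s0 makes q a cycle.\<close>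
    define l :: 'f where "l = (if fst s = snd s then 1 / 2 else 1)"
    define d where "d = l * omega m (e (fst s)) (e (snd s)) / omega m (e (fst s0)) (e (snd s0))"
    define q where "q = cscale l (gen (?g s)) - cscale d (gen (?g s0))"
    have gens: "gen (?g t) \<in> chains H 2" "pchain (gen (?g t)) \<in> ext_rel Q 2" if "t \<in> all_pairs" for t
      using all_pairs_facts[OF that] pair_words pair_J_pchain by (auto intro: gen_in_chains)
    have "q \<in> chains H 2"
      unfolding q_def
      by (intro chain.subspace_diff[OF subspace_chains] chain.subspace_scale[OF subspace_chains] gens sA s0A)
    moreover have "leval bracket q = 0"
      using A0 by (simp add: q_def leval_simps bracket_def d_def)
    ultimately have "q \<in> cycles H 2" by (simp add: cycles_iff)
    moreover have "pchain q \<in> ext_rel Q 2"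
      unfolding q_def lin_ext_simps
      by (intro chain.subspace_diff[OF Q.subspace_ext_rel] chain.subspace_scale[OF Q.subspace_ext_rel] gens sA s0A)
    ultimately obtain v where v: "v \<in> carrier M" "\<beta> v = hclass H 2 q" using \<beta>_lift by blast
    have "h2_coord t v = (if s = t then 1 else 0)" if t: "t \<in> coord_pairs s0" for t
    proof -
      have tA: "t \<in> all_pairs" using t by blast
      have "s0 \<notin> even_pairs" using pairs_parity(1)[of s0] pairs_parity(2)[OF s0] by auto
      moreover have "s0 \<notin> exceptional \<times> {HZ}" using pairs_index(2)[of s0] s0 by auto
      ultimately have "t \<noteq> s0" using t by blast
      have "h2_coord t v = leval (?c t) q" by (rule h2_coord_eq[OF all_pairs_facts(4)[OF tA] v(2)])
      also have "\<dots> = l * ?c t (?g s) - d * ?c t (?g s0)" by (simp add: q_def leval_simps)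
      also have "\<dots> = (if s = t then 1 else 0)"
        using val[OF sA tA] val[OF s0A tA] \<open>t \<noteq> s0\<close> two by (auto simp: l_def)
      finally show ?thesis .
    qed
    then show "\<exists>v\<in>carrier M. \<forall>t\<in>coord_pairs s0. h2_coord t v = (if s = t then 1 else 0)" using v(1) by blast
  qed
qed

end

context heis_pair_multiplier
begin

lemma finite_pairs [simp]: "finite even_pairs" "finite odd_pairs" "finite exceptional"
  by (auto simp: even_pairs_def odd_pairs_def exceptional_def)

lemma card_even_pairs: "card even_pairs + k * k = 2 * m * k"
proof -
  have sum: "(\<Sum>i\<in>{1..n}. m - i) + (\<Sum>i\<in>{1..n}. Suc m - i) + n * n = 2 * m * n" if "n \<le> m" for n
    using that by (induction n) (auto simp: algebra_simps)
  have "even_pairs = (\<lambda>(i, j). (HX i, HX j)) ` (SIGMA i:{1..k}. {i<..m}) \<union>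
     (\<lambda>(i, j). (HY i, HY j)) ` (SIGMA i:{1..k}. {i..m})" by (rule even_pairs_def)
  also have "card \<dots> = card (SIGMA i:{1..k}. {i<..m}) + card (SIGMA i:{1..k}. {i..m})"
    by (subst card_Un_disjoint) (auto simp: card_image inj_on_def)
  also have "\<dots> = (\<Sum>i\<in>{1..k}. m - i) + (\<Sum>i\<in>{1..k}. Suc m - i)" by simp
  finally show ?thesis using sum[OF k_le] by simp
qed

lemma card_odd_pairs: "card odd_pairs + (m - k) * (m - k) = m * m"
proof -
  have "card odd_pairs = card ({1..m} \<times> {1..m} - {k<..m} \<times> {k<..m})"
    unfolding odd_pairs_def by (rule card_image) (auto simp: inj_on_def)
  also have "\<dots> = card ({1..m} \<times> {1..m}) - card ({k<..m} \<times> {k<..m})"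
    by (rule card_Diff_subset) auto
  finally have "card odd_pairs = m * m - (m - k) * (m - k)" by (simp add: card_cartesian_product)
  moreover have "(m - k) * (m - k) \<le> m * m" by (intro mult_le_mono) auto
  ultimately show ?thesis by simp
qed

lemma vectorspace_part_M: "vectorspace class_ring (M\<lparr>carrier := part M a\<rparr>)"
  using M.subspace_is_vs[OF M.part_subspace] .

lemma part_M_carrier: "v \<in> part M a \<Longrightarrow> v \<in> carrier M"
  using M.part_subspace[of a] unfolding subspace_def submodule_def by blast

lemma part_M_component:
  assumes "v \<in> carrier M"
  shows "\<exists>v'\<in>part M a. \<exists>v''\<in>part M (a + 1). v = v' \<oplus>\<^bsub>M\<^esub> v''"
proof -
  obtain v0 v1 where v: "v0 \<in> part M 0" "v1 \<in> part M 1" "v = v0 \<oplus>\<^bsub>M\<^esub> v1"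
    using assms M.part_sum unfolding set_add_def' by blast
  have swap: "v = v1 \<oplus>\<^bsub>M\<^esub> v0" unfolding v(3) using v(1,2) part_M_carrier by (intro M.a_comm) blast+
  show ?thesis
  proof (cases "a = 0")
    case True
    then show ?thesis using v by auto
  next
    case False
    then have "a = 1" by simp
    then show ?thesis using v(1,2) swap by (intro bexI[of _ v1] bexI[of _ v0]) auto
  qed
qed

lemma dims_k_pos:
  assumes k: "k \<ge> 1"
  shows "finite_dim M" and "total_dim M = card even_pairs + (card odd_pairs - 1 + card exceptional)"
    and "part_dim M 0 = card even_pairs" and "part_dim M 1 = card odd_pairs - 1 + card exceptional"
    and "card odd_pairs \<ge> 1"
proof -
  obtain s0 where s0: "s0 \<in> odd_pairs"
    and inj: "\<And>v. v \<in> carrier M \<Longrightarrow> (\<And>s. s \<in> coord_pairs s0 \<Longrightarrow> h2_coord s v = 0) \<Longrightarrow> v = \<zero>\<^bsub>M\<^esub>"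
    and dual: "\<And>s. s \<in> coord_pairs s0 \<Longrightarrow>
      \<exists>v\<in>carrier M. \<forall>t\<in>coord_pairs s0. h2_coord t v = (if s = t then 1 else 0)"
    using coordinates_k_pos[OF k] by blast
  define S where "S = coord_pairs s0"
  define P where "P a = {s \<in> S. par (fst s) + par (snd s) = a}" for a
  have S_I: "fst s \<in> I \<and> snd s \<in> I \<and> kills_boundaries s" if "s \<in> S" for s
    using all_pairs_facts[of s] that by (auto simp: S_def)
  have exc: "par (fst s) + par (snd s) = 1" if "s \<in> exceptional \<times> {HZ}" for s
  proof -
    obtain b where "s = (b, HZ)" "b \<in> exceptional" using \<open>s \<in> _\<close> by blast
    then show ?thesis using exceptional_I(3)[of b] by simp
  qed
  have P0: "P 0 = even_pairs" and P1: "P 1 = (odd_pairs - {s0}) \<union> exceptional \<times> {HZ}"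
    using pairs_parity exc by (auto simp: P_def S_def)
  have fin: "finite S" by (simp add: S_def)
  have disj: "(odd_pairs - {s0}) \<inter> exceptional \<times> {HZ} = {}"
  proof (rule equals0I)
    fix s assume s: "s \<in> (odd_pairs - {s0}) \<inter> exceptional \<times> {HZ}"
    then have "snd s = HZ" by auto
    then show False using pairs_index(2)[of s] s by simp
  qed
  have card1: "card (P 1) = card odd_pairs - 1 + card exceptional"
    unfolding P1 using disj s0 by (simp add: card_Un_disjoint)
  have "S = P 0 \<union> P 1" unfolding P0 P1 by (auto simp: S_def)
  moreover have "P 0 \<inter> P 1 = {}" by (auto simp: P_def)
  ultimately have cardS: "card S = card even_pairs + (card odd_pairs - 1 + card exceptional)"
    using fin card1 P0 card_Un_disjoint[of "P 0" "P 1"] by simp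
  have add: "h2_coord s (v \<oplus>\<^bsub>M\<^esub> w) = h2_coord s v + h2_coord s w" if "s \<in> S" "v \<in> carrier M" "w \<in> carrier M" for s v w
    using h2_coord_add S_I that by blast
  have smult: "h2_coord s (c \<odot>\<^bsub>M\<^esub> v) = c * h2_coord s v" if "s \<in> S" "v \<in> carrier M" for s c v
    using h2_coord_smult S_I that by blast
  have T_off: "h2_coord s v = 0" if "s \<in> S - P a" "v \<in> part M a" for s v a
    using h2_coord_parity[of s v a] S_I that by (auto simp: P_def)
  obtain u where u: "\<And>s. s \<in> S \<Longrightarrow> u s \<in> carrier M" "\<And>s t. s \<in> S \<Longrightarrow> t \<in> S \<Longrightarrow> h2_coord t (u s) = (if s = t then 1 else 0)"
    using dual unfolding S_def[symmetric] by metis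
  have inj: "v = \<zero>\<^bsub>M\<^esub>" if "v \<in> carrier M" "\<And>s. s \<in> S \<Longrightarrow> h2_coord s v = 0" for v
    using inj that unfolding S_def by blast
  note total = dim_from_coordinates[where W = M and T = h2_coord and S = S and u = u,
      OF M.vectorspace_axioms fin add smult inj u]
  show "finite_dim M" unfolding finite_dim_def by (rule total(1))
  show "total_dim M = card even_pairs + (card odd_pairs - 1 + card exceptional)"
    unfolding total_dim_def cardS[symmetric] by (rule total(2))
  have part: "part_dim M a = card (P a)" for a
  proof -
    have PS: "P a \<subseteq> S" by (auto simp: P_def)
    have "\<exists>v\<in>part M a. \<forall>t\<in>P a. h2_coord t v = (if s = t then 1 else 0)" if s: "s \<in> P a" for s
    proof -
      obtain v' v'' where v: "v' \<in> part M a" "v'' \<in> part M (a + 1)" "u s = v' \<oplus>\<^bsub>M\<^esub> v''"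
        using part_M_component[of "u s" a] u(1)[of s] s PS by blast
      have "h2_coord t v' = (if s = t then 1 else 0)" if t: "t \<in> P a" for t
      proof -
        have "t \<in> S - P (a + 1)" using t by (cases a) (auto simp: P_def)
        then have "h2_coord t v'' = 0" using T_off v(2) by blast
        then have "h2_coord t v' = h2_coord t (u s)" using add[of t v' v''] v part_M_carrier t PS by auto
        also have "h2_coord t (u s) = (if s = t then 1 else 0)" by (rule u(2)) (use s t PS in blast)+
        finally show ?thesis .
      qed
      then show ?thesis using v(1) by blast
    qed
    then obtain w where w: "\<And>s. s \<in> P a \<Longrightarrow> w s \<in> part M a" "\<And>s t. s \<in> P a \<Longrightarrow> t \<in> P a \<Longrightarrow> h2_coord t (w s) = (if s = t then 1 else 0)"
      by metis
    have "vectorspace.dim class_ring (M\<lparr>carrier := part M a\<rparr>) = card (P a)"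
    proof (rule dim_from_coordinates(2)[where T = h2_coord and u = w, OF vectorspace_part_M])
      fix v assume "v \<in> carrier (M\<lparr>carrier := part M a\<rparr>)" and T0: "\<And>s. s \<in> P a \<Longrightarrow> h2_coord s v = 0"
      then have v: "v \<in> part M a" by simp
      have "v = \<zero>\<^bsub>M\<^esub>"
        by (rule inj[OF part_M_carrier[OF v]]) (use T0 T_off[OF _ v] in blast)
      then show "v = \<zero>\<^bsub>M\<lparr>carrier := part M a\<rparr>\<^esub>" by simp
    qed (use fin PS add smult part_M_carrier w in \<open>auto intro: finite_subset\<close>)
    then show ?thesis by (simp add: part_dim_def)
  qed
  show "part_dim M 0 = card even_pairs" "part_dim M 1 = card odd_pairs - 1 + card exceptional"
    using part[of 0] part[of 1] P0 card1 by simp_all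
  show "card odd_pairs \<ge> 1" using s0 by (metis card_0_eq empty_iff finite_pairs(2) less_one not_less)
qed

subsection \<open>The centre\<close>

text \<open>Coordinates on the image of \<alpha>, for J spanned by z: the coefficient of \<open>z \<and> e i\<close> in the boundary of a chain that represents v.\<close>

definition h3_coord :: "heis_basis \<Rightarrow> 'w \<Rightarrow> 'f" where
  "h3_coord i v = leval (zwedge i) (SOME p. p \<in> chains H 3 \<and> \<alpha> (class_in_H3_Q p) = v)"

lemma zwedge_cycle:
  assumes "i \<in> I" "q \<in> cycles H 3"
  shows "leval (zwedge i) q = 0"
proof -
  have "boundary H q \<in> ext_rel H 2" using assms(2) by (simp add: cycles_def)
  then show ?thesis using coord_ext_rel[of HZ i] assms(1) by (simp add: leval_zwedge)
qed

text \<open>Two chains of H that represent v differ modulo relations of Q by a cycle of H, which has no boundary.\<close>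

lemma h3_coord_eq:
  assumes k: "k = 0" and i: "i \<in> I" "i \<noteq> HZ" and p: "p \<in> chains H 3" "\<alpha> (class_in_H3_Q p) = v"
  shows "h3_coord i v = leval (zwedge i) p"
proof -
  define p' where "p' = (SOME p. p \<in> chains H 3 \<and> \<alpha> (class_in_H3_Q p) = v)"
  have p': "p' \<in> chains H 3" "\<alpha> (class_in_H3_Q p') = v"
    using someI[of "\<lambda>p. p \<in> chains H 3 \<and> \<alpha> (class_in_H3_Q p) = v" p] p unfolding p'_def by auto
  have d: "p' - p \<in> chains H 3" using chain.subspace_diff[OF subspace_chains p'(1) p(1)] .
  have "v \<oplus>\<^bsub>M\<^esub> \<alpha> (class_in_H3_Q (p' - p)) = v"
    using \<alpha>_add[OF class_in_H3_Q_carrier[OF p(1)] class_in_H3_Q_carrier[OF d]] class_in_H3_Q_add[of p "p' - p"] p p' by simp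
  moreover have "v \<in> carrier M" "\<alpha> (class_in_H3_Q (p' - p)) \<in> carrier M"
    using \<alpha>_closed class_in_H3_Q_carrier p(1) d unfolding p(2)[symmetric] by blast+
  ultimately have "\<alpha> (class_in_H3_Q (p' - p)) = \<zero>\<^bsub>M\<^esub>" using M.add.l_cancel_one by blast
  then obtain q where q: "q \<in> cycles H 3" "pchain (p' - p - q) \<in> ext_rel Q 3"
    using \<alpha>_class_in_H3_Q_zero_iff[OF d] by blast
  have "q \<in> chains H 3" using q(1) by (simp add: cycles_def)
  then have "p' - p - q \<in> chains H 3" by (rule chain.subspace_diff[OF subspace_chains d])
  then have "leval (zwedge i) (p' - p - q) = 0" using zwedge_vanishes_if_pchain_ext_rel[OF k i _ q(2)] by blast
  then show ?thesis using zwedge_cycle[OF i(1) q(1)] by (simp add: h3_coord_def p'_def[symmetric] leval_simps)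
qed

text \<open>If J is spanned by z, all coordinates at pairs of indices other than HZ vanish on the kernel of M(H) \<open>\<rightarrow>\<close> M(Q).
  Up to boundaries only \<open>z \<and> e i\<close> with exceptional i remains.\<close>

lemma h2_coord_exceptional_zero_iff:
  assumes k: "k = 0" and v: "v \<in> carrier M"
  shows "(\<forall>s\<in>exceptional \<times> {HZ}. h2_coord s v = 0) \<longleftrightarrow> \<beta> v = boundaries H 2"
proof -
  have kills: "kills_boundaries s" if "s \<in> exceptional \<times> {HZ}" for s
    using that by (rule exceptional_kills_boundaries)
  show ?thesis
  proof
    assume T0: "\<forall>s\<in>exceptional \<times> {HZ}. h2_coord s v = 0"
    obtain p where p: "p \<in> cycles H 2" "pchain p \<in> ext_rel Q 2" "\<beta> v = hclass H 2 p"
      using \<beta>_class[OF v] .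
    have pc: "p \<in> chains H 2" using p(1) by (simp add: cycles_iff)
    have "p \<in> boundaries H 2"
    proof (rule in_boundaries_if_coords[OF pc])
      fix i j assume "i \<in> I - {HZ}" "j \<in> I - {HZ}"
      then show "leval (coord i j) p = 0"
        using k by (intro coord_vanishes_if_pchain_ext_rel[OF _ _ pc p(2)]) auto
    next
      fix i assume i: "i \<in> exceptional"
      then have "(i, HZ) \<in> exceptional \<times> {HZ}" by simp
      then show "leval (coord i HZ) p = 0" using T0 h2_coord_eq[OF kills p(3)] by fastforce
    qed
    then show "\<beta> v = boundaries H 2" using p(3) heis.hclass_zero_iff by metis
  next
    assume "\<beta> v = boundaries H 2"
    then have "\<beta> v = hclass H 2 0" by (simp add: heis.hclass_zero)
    then show "\<forall>s\<in>exceptional \<times> {HZ}. h2_coord s v = 0" using h2_coord_eq[OF kills] by fastforce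
  qed
qed

text \<open>All coordinates of the boundary of p vanish, except possibly that at \<open>z \<and> z\<close>. Correcting p by a chain that vanishes
  modulo J gives a cycle of H with the same image in Q.\<close>

lemma class_in_H3_Q_zero_if_zwedge_zero:
  assumes k: "k = 0" and p: "p \<in> chains H 3" and zwedge: "\<And>i. i \<in> I - {HZ} - exceptional \<Longrightarrow> leval (zwedge i) p = 0"
  shows "\<alpha> (class_in_H3_Q p) = \<zero>\<^bsub>M\<^esub>"
proof -
  have c: "leval (coord HZ i) (boundary H p) = 0" if i: "i \<in> I" "i \<noteq> HZ" for i
  proof (cases "i \<in> exceptional")
    case True
    then have "m = 1" "i = HX 1" using exceptional_I by auto
    have "p \<in> {p. leval (zwedge i) p = 0}"
      by (rule chains_in_subspace[OF p subspace_leval_zero]) (use zwedge_m1[OF \<open>m = 1\<close>] \<open>i = HX 1\<close> in simp)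
    then show ?thesis by (simp add: leval_zwedge)
  next
    case False
    then show ?thesis using zwedge[of i] i by (simp add: leval_zwedge)
  qed
  \<comment> \<open>The boundary of \<open>x \<and> y \<and> z\<close> is a nonzero multiple of \<open>z \<and> z\<close>.\<close>
  define x where "x = e (HX 1)"
  have x: "x \<in> part H 0" "x \<noteq> 0" using e_even_nonzero[of 1] m_pos by (auto simp: x_def)
  obtain j where j: "j \<in> {1..m}" "x (HX j) \<noteq> 0" using even_nonzero_dual[OF x] .
  define y where "y = (delta (HY j) :: heis_basis \<Rightarrow> 'f)"
  have y: "y \<in> part H 1" unfolding y_def by (rule delta_part(2)[OF j(1)])
  have xy: "omega m x y \<noteq> 0" unfolding y_def omega_delta_HY[OF j(1)] by (rule j(2))
  define w where "w = [(0 :: bit, x), (1, y), (1, hz)]"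
  have w: "w \<in> words H 3" using x y hz_part by (auto simp: w_def words_3)
  have wz: "leval (coord HZ HZ) (word_boundary H w) = 2 * omega m x y"
    by (simp add: w_def word_boundary_3 leval_simps coord_def \<xi>_fscale_hz \<xi>_HZ_hz psign_def \<xi>_0[unfolded zero_fun_def])
  have wi: "leval (coord HZ i) (word_boundary H w) = 0" if i: "i \<in> I" "i \<noteq> HZ" for i
  proof -
    have "zwedge i w = 0" unfolding w_def zwedge_eq[OF i] using \<xi>_hz[OF i] by simp
    then show ?thesis by (simp add: zwedge_def)
  qed
  define d where "d = leval (coord HZ HZ) (boundary H p) / (2 * omega m x y)"
  define q where "q = p - cscale d (gen w)"
  have q: "q \<in> chains H 3"
    unfolding q_def by (intro chain.subspace_diff[OF subspace_chains] chain.subspace_scale[OF subspace_chains] p gen_in_chains w)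
  have bq: "boundary H q = boundary H p - cscale d (word_boundary H w)"
    unfolding q_def lin_ext_simps by simp
  have HZ_row: "leval (coord HZ i) (boundary H q) = 0" if i: "i \<in> I" for i
  proof (cases "i = HZ")
    case True
    then show ?thesis using wz xy two by (simp add: bq leval_simps d_def)
  next
    case False
    then show ?thesis using wi c i by (simp add: bq leval_simps)
  qed
  have "boundary H q \<in> ext_rel H 2"
  proof (rule in_subspace_by_coords[OF _ heis.subspace_ext_rel order_refl])
    show "boundary H q \<in> chains H 2" using heis.boundary_chains[of q m 2] q by simp
    fix i j assume ij: "i \<in> I" "j \<in> I"
    have "leval (coord i j) (boundary H q) = 0"
      using HZ_row ij coord_boundary[OF ij _ _ q] leval_coord_swap[of i HZ "boundary H q"]
      by (cases "i = HZ"; cases "j = HZ") auto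
    then show "leval (coord i j) (boundary H q) = 0 \<or> gen (pair i j) \<in> ext_rel H 2" ..
  qed
  then have "q \<in> cycles H 3" using q by (simp add: cycles_def)
  moreover have "pchain (p - q) \<in> ext_rel Q 3"
    using pchain_J_letter[OF w, of 1 hz d] hz_J by (simp add: q_def w_def)
  ultimately show ?thesis using \<alpha>_class_in_H3_Q_zero_iff[OF p] by blast
qed

text \<open>Each index \<open>i \<noteq> HZ\<close> gives one coordinate: \<open>h2_coord (i, HZ)\<close> if i is exceptional, and else \<open>h3_coord i\<close> on
  the kernel of \<beta>.\<close>

lemma dims_k_zero:
  assumes k: "k = 0"
  shows "finite_dim M" and "total_dim M = 2 * m"
proof -
  let ?S = "exceptional \<times> {HZ}" and ?R = "I - {HZ} - exceptional"
  define N where "N = {v \<in> carrier M. \<forall>s\<in>?S. h2_coord s v = 0}"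
  have kills: "kills_boundaries s" if "s \<in> ?S" for s
    using that by (rule exceptional_kills_boundaries)
  have N_lift: "\<exists>p\<in>chains H 3. v = \<alpha> (class_in_H3_Q p)" if "v \<in> N" for v
    using that h2_coord_exceptional_zero_iff[OF k, of v] \<beta>_zero_iff[of v] by (simp add: N_def)
  have N_\<alpha>: "\<alpha> (class_in_H3_Q p) \<in> N" if "p \<in> chains H 3" for p
  proof -
    have "\<alpha> (class_in_H3_Q p) \<in> carrier M" using \<alpha>_closed class_in_H3_Q_carrier that by blast
    then show ?thesis
      using that h2_coord_exceptional_zero_iff[OF k, of "\<alpha> (class_in_H3_Q p)"] \<beta>_zero_iff[of "\<alpha> (class_in_H3_Q p)"]
      by (auto simp: N_def)
  qed
  have R: "i \<in> I \<and> i \<noteq> HZ" if "i \<in> ?R" for i using that by blast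
  have addU: "h3_coord i (v \<oplus>\<^bsub>M\<^esub> w) = h3_coord i v + h3_coord i w" if i: "i \<in> ?R" and vw: "v \<in> N" "w \<in> N" for i v w
  proof -
    obtain p q where pq: "p \<in> chains H 3" "v = \<alpha> (class_in_H3_Q p)" "q \<in> chains H 3" "w = \<alpha> (class_in_H3_Q q)"
      using N_lift vw by blast
    have "\<alpha> (class_in_H3_Q (p + q)) = v \<oplus>\<^bsub>M\<^esub> w" using pq by (simp add: class_in_H3_Q_add \<alpha>_add class_in_H3_Q_carrier)
    moreover have "p + q \<in> chains H 3" using pq chain.subspace_add[OF subspace_chains] by blast
    ultimately show ?thesis using h3_coord_eq[OF k] R[OF i] pq by (simp add: leval_simps)
  qed
  have smultU: "h3_coord i (c \<odot>\<^bsub>M\<^esub> v) = c * h3_coord i v" if i: "i \<in> ?R" and v: "v \<in> N" for i c v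
  proof -
    obtain p where p: "p \<in> chains H 3" "v = \<alpha> (class_in_H3_Q p)" using N_lift v by blast
    have "\<alpha> (class_in_H3_Q (cscale c p)) = c \<odot>\<^bsub>M\<^esub> v" using p by (simp add: class_in_H3_Q_smult \<alpha>_smult class_in_H3_Q_carrier)
    moreover have "cscale c p \<in> chains H 3" using p chain.subspace_scale[OF subspace_chains] by blast
    ultimately show ?thesis using h3_coord_eq[OF k] R[OF i] p by (simp add: leval_simps)
  qed
  have injU: "v = \<zero>\<^bsub>M\<^esub>" if v: "v \<in> N" and U0: "\<And>i. i \<in> ?R \<Longrightarrow> h3_coord i v = 0" for v
  proof -
    obtain p where p: "p \<in> chains H 3" "v = \<alpha> (class_in_H3_Q p)" using N_lift v by blast
    have "leval (zwedge i) p = 0" if "i \<in> ?R" for i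
      using U0[OF that] h3_coord_eq[OF k _ _ p(1) p(2)[symmetric]] R[OF that] by simp
    then show ?thesis using class_in_H3_Q_zero_if_zwedge_zero[OF k p(1)] p(2) by blast
  qed
  have "\<exists>v\<in>carrier M. \<forall>t\<in>?S. h2_coord t v = (if s = t then 1 else 0)" if s: "s \<in> ?S" for s
  proof -
    have "s = (HX 1, HZ)" and m1: "m = 1" and uniq: "t = s" if "t \<in> ?S" for t
      using s that exceptional_I(3) by auto
    then have s: "s = (HX 1, HZ)" and m1: "m = 1" using s by blast+
    have i: "HX 1 \<in> I" using m_pos by (auto simp: heis_index_def)
    let ?p = "gen (pair (HX 1) HZ) :: ('f, heis_basis \<Rightarrow> 'f) chain"
    have "?p \<in> cycles H 2"
      using gen_in_chains[OF pair_words[OF i HZ_index], of 1] by (simp add: cycles_iff bracket_def e_HZ)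
    moreover have "pchain ?p \<in> ext_rel Q 2" by (rule pair_J_pchain[OF i]) auto
    ultimately obtain v where v: "v \<in> carrier M" "\<beta> v = hclass H 2 ?p" using \<beta>_lift by blast
    have "h2_coord s v = 1"
      using h2_coord_eq[OF kills[OF \<open>s \<in> ?S\<close>] v(2)] coord_pair[OF i _ i, of HZ HZ] by (simp add: s)
    then show ?thesis using v(1) uniq by force
  qed
  then obtain u where u: "\<And>s. s \<in> ?S \<Longrightarrow> u s \<in> carrier M"
      "\<And>s t. s \<in> ?S \<Longrightarrow> t \<in> ?S \<Longrightarrow> h2_coord t (u s) = (if s = t then 1 else 0)" by metis
  have "\<exists>v\<in>N. \<forall>j\<in>?R. h3_coord j v = (if i = j then 1 else 0)" if i: "i \<in> ?R" for i
  proof -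
    have "par i = 1 \<or> m \<ge> 2"
      using i m_pos by (auto simp: heis_index_def exceptional_def split: if_splits)
    then have "gen [(1, hz), (par i, e i)] \<in> bounded_through m (e (HX 1))"
      using hz_wedge_bounded_through[OF two, of "e (HX 1)" m "e i" "par i"] e_even_nonzero[of 1] m_pos e_part i by auto
    then obtain r where r: "r \<in> through m (e (HX 1))" "gen (pair HZ i) - boundary H r \<in> ext_rel H 2"
      unfolding bounded_through_def by (auto simp: e_HZ)
    have rc: "r \<in> chains H 3" using r(1) through_chains by blast
    have "h3_coord j (\<alpha> (class_in_H3_Q r)) = (if i = j then 1 else 0)" if j: "j \<in> ?R" for j
    proof -
      have jI: "j \<in> I" "j \<noteq> HZ" "i \<in> I" using i j by auto
      have "leval (coord HZ j) (gen (pair HZ i) - boundary H r) = 0"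
        using coord_ext_rel[OF _ jI(1) r(2)] by simp
      then have "leval (zwedge j) r = coord HZ j (pair HZ i)" by (simp add: leval_simps leval_zwedge)
      also have "\<dots> = (if i = j then 1 else 0)" using coord_pair[of HZ j HZ i] jI by auto
      finally show ?thesis using h3_coord_eq[OF k jI(1,2) rc refl] by simp
    qed
    then show ?thesis using N_\<alpha>[OF rc] by blast
  qed
  then obtain n where n: "\<And>i. i \<in> ?R \<Longrightarrow> n i \<in> N"
      "\<And>i j. i \<in> ?R \<Longrightarrow> j \<in> ?R \<Longrightarrow> h3_coord j (n i) = (if i = j then 1 else 0)" by metis
  have fin: "finite ?S" "finite ?R" by auto
  note dims = dim_from_coordinates_of_extension[where W = M and T = h2_coord and U = h3_coord and S = ?S and R = ?R and N = N
      and u = u and n = n, OF M.vectorspace_axioms fin h2_coord_add[OF kills] h2_coord_smult[OF kills] N_def addU smultU injU u n]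
  show "finite_dim M" unfolding finite_dim_def by (rule dims(1))
  have "card (I - {HZ}) = 2 * m"
  proof -
    have "I - {HZ} = HX ` {1..m} \<union> HY ` {1..m}" by (auto simp: heis_index_def)
    moreover have "card (HX ` {1..m} \<union> HY ` {1..m}) = card (HX ` {1..m}) + card (HY ` {1..m})"
      by (rule card_Un_disjoint) auto
    ultimately show ?thesis by (simp add: card_image inj_on_def)
  qed
  moreover have "exceptional \<subseteq> I - {HZ}" using exceptional_I by blast
  then have "card ?R = card (I - {HZ}) - card exceptional" "card exceptional \<le> card (I - {HZ})"
    by (intro card_Diff_subset card_mono finite_pairs; simp)+
  ultimately have "card ?S + card ?R = 2 * m" by (simp add: card_cartesian_product)
  moreover have "vectorspace.dim class_ring M = card ?S + card ?R" by (rule dims(2))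
  ultimately show "total_dim M = 2 * m" unfolding total_dim_def by (rule trans[rotated])
qed

end

section \<open>Bases adapted to a graded ideal\<close>

lemma bij_betw_extend:
  assumes "finite X" "K \<subseteq> X" "inj_on g K" "g ` K \<subseteq> Y" "finite Y" "card Y = card X"
  shows "\<exists>f. bij_betw f X Y \<and> (\<forall>x\<in>K. f x = g x)"
proof -
  have fK: "finite K" using assms finite_subset by blast
  have "card (X - K) = card (Y - g ` K)"
    using assms fK by (simp add: card_Diff_subset card_image)
  then obtain h where h: "bij_betw h (X - K) (Y - g ` K)"
    using finite_same_card_bij[of "X - K" "Y - g ` K"] assms by auto
  define f where "f x = (if x \<in> K then g x else h x)" for x
  have "bij_betw f K (g ` K)"
    using assms(3) by (auto simp: bij_betw_def f_def inj_on_def)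
  moreover have "bij_betw f (X - K) (Y - g ` K)"
    using h by (rule bij_betw_cong[THEN iffD1, rotated]) (simp add: f_def)
  ultimately have "bij_betw f (K \<union> (X - K)) (g ` K \<union> (Y - g ` K))"
    by (rule bij_betw_combine) auto
  moreover have "K \<union> (X - K) = X" "g ` K \<union> (Y - g ` K) = Y" using assms by auto
  ultimately show ?thesis by (intro exI[of _ f]) (simp add: f_def)
qed

context vector_space
begin

text \<open>Bases are found in the type-based theory of vector spaces; this turns their cardinalities into
  dimensions in the carrier-based one.\<close>

lemma dim_carrier_eq_card:
  fixes W :: "('a, 'b, 'z) module_scheme"
  assumes V: "subspace (carrier W)"
    and ops: "\<And>x y. x \<oplus>\<^bsub>W\<^esub> y = x + y" "\<And>c x. c \<odot>\<^bsub>W\<^esub> x = scale c x" "\<zero>\<^bsub>W\<^esub> = 0"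
    and B: "independent B" "finite B" "B \<subseteq> carrier W" "carrier W \<subseteq> span B"
  shows "vectorspace.dim class_ring W = card B"
proof (rule dim_from_coordinates(2)[where T = "\<lambda>b v. representation B v b" and u = "\<lambda>b. b"])
  show "vectorspace class_ring W" using V ops by (rule vectorspace_carrier)
  fix v assume v: "v \<in> carrier W" and "\<And>b. b \<in> B \<Longrightarrow> representation B v b = 0"
  then have "(\<Sum>b\<in>B. scale (representation B v b) b) = 0" by simp
  moreover have "v = (\<Sum>b\<in>B. scale (representation B v b) b)"
    using sum_representation_eq[OF B(1) _ B(2) order_refl, of v] B(4) v by auto
  ultimately show "v = \<zero>\<^bsub>W\<^esub>" by (simp add: ops)
qed (use B in \<open>auto simp: ops representation_add representation_scale representation_basis subset_iff\<close>)

text \<open>Vectors of U that have to be in the basis, given as \<open>g ` K\<close>, are extended to a basis of U and this is extended to one of the whole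
  space.\<close>

lemma adapted_basis:
  assumes fin: "finite X" and sub: "K \<subseteq> X0" "X0 \<subseteq> X"
    and D: "independent D" "finite D" "card D = card X"
    and U: "subspace U" "U \<subseteq> span D"
    and g: "inj_on g K" "independent (g ` K)" "g ` K \<subseteq> U"
    and card_U: "\<And>B. independent B \<Longrightarrow> finite B \<Longrightarrow> B \<subseteq> U \<Longrightarrow> U \<subseteq> span B \<Longrightarrow> card B = card X0"
  obtains f \<xi> where
    "\<And>x. x \<in> K \<Longrightarrow> f x = g x"
    "\<And>x. x \<in> X \<Longrightarrow> f x \<in> span D"
    "\<And>x v w. x \<in> X \<Longrightarrow> v \<in> span D \<Longrightarrow> w \<in> span D \<Longrightarrow> \<xi> x (v + w) = \<xi> x v + \<xi> x w"
    "\<And>x c v. x \<in> X \<Longrightarrow> v \<in> span D \<Longrightarrow> \<xi> x (scale c v) = c * \<xi> x v"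
    "\<And>x y. x \<in> X \<Longrightarrow> y \<in> X \<Longrightarrow> \<xi> x (f y) = (if x = y then 1 else 0)"
    "\<And>v. v \<in> span D \<Longrightarrow> v = (\<Sum>x\<in>X. scale (\<xi> x v) (f x))"
    "\<And>v. v \<in> span D \<Longrightarrow> v \<in> U \<longleftrightarrow> (\<forall>x\<in>X - X0. \<xi> x v = 0)"
proof -
  have fin0: "finite X0" using fin sub finite_subset by blast
  obtain B where B: "g ` K \<subseteq> B" "B \<subseteq> U" "independent B" "U \<subseteq> span B"
    using maximal_independent_subset_extend[OF g(3,2)] by blast
  have finB: "finite B" using independent_span_bound[OF D(2) B(3)] B(2) U(2) by blast
  have BD: "B \<subseteq> span D" using B(2) U(2) by blast
  obtain C where C: "B \<subseteq> C" "C \<subseteq> span D" "independent C" "span D \<subseteq> span C"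
    using maximal_independent_subset_extend[OF BD B(3)] by blast
  have finC: "finite C" "card C \<le> card D" using independent_span_bound[OF D(2) C(3,2)] by auto
  have "D \<subseteq> span C" using C(4) span_superset[of D] by blast
  then have "card D \<le> card C" using independent_span_bound[OF finC(1) D(1)] by blast
  then have cardC: "card C = card X" using finC D(3) by simp
  have cardB: "card B = card X0" using card_U B finB by blast
  obtain f0 where f0: "bij_betw f0 X0 B" "\<forall>x\<in>K. f0 x = g x"
    using bij_betw_extend[OF fin0 sub(1) g(1) B(1) finB cardB] by blast
  obtain f where f: "bij_betw f X C" "\<forall>x\<in>X0. f x = f0 x"
    using bij_betw_extend[OF fin sub(2), of f0 C] f0(1) C(1) finC(1) cardC by (auto simp: bij_betw_def)
  have fX: "f ` X = C" and inj: "inj_on f X" using f(1) by (auto simp: bij_betw_def)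
  have fX0: "f ` X0 = B" using f0(1) f(2) by (auto simp: bij_betw_def)
  have spanC: "span C = span D" using C(2,4) span_minimal[OF C(2)] by blast
  define \<xi> where "\<xi> x v = representation C v (f x)" for x v
  have expand: "v = (\<Sum>x\<in>X. scale (\<xi> x v) (f x))" if "v \<in> span D" for v
  proof -
    have "v = (\<Sum>b\<in>C. scale (representation C v b) b)"
      using sum_representation_eq[OF C(3) _ finC(1) order_refl, of v] that spanC by simp
    also have "\<dots> = (\<Sum>x\<in>X. scale (\<xi> x v) (f x))"
      unfolding \<xi>_def by (rule sum.reindex_bij_betw[OF f(1), symmetric])
    finally show ?thesis .
  qed
  show thesis
  proof (rule that[of f \<xi>])
    show "f x = g x" if "x \<in> K" for x using that f(2) f0(2) sub(1) by auto
    show "f x \<in> span D" if "x \<in> X" for x using that fX C(2) by blast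
    show "\<xi> x (v + w) = \<xi> x v + \<xi> x w" if "v \<in> span D" "w \<in> span D" for x v w
      using that C(3) by (simp add: \<xi>_def representation_add spanC)
    show "\<xi> x (scale c v) = c * \<xi> x v" if "v \<in> span D" for x c v
      using that C(3) by (simp add: \<xi>_def representation_scale spanC)
    show "\<xi> x (f y) = (if x = y then 1 else 0)" if "x \<in> X" "y \<in> X" for x y
    proof -
      have "f y \<in> C" using that fX by blast
      then have "\<xi> x (f y) = (if f x = f y then 1 else 0)"
        using representation_basis[OF C(3)] by (simp add: \<xi>_def)
      then show ?thesis using inj that by (simp add: inj_on_eq_iff)
    qed
    show "v = (\<Sum>x\<in>X. scale (\<xi> x v) (f x))" if "v \<in> span D" for v using that by (rule expand)
    show "v \<in> U \<longleftrightarrow> (\<forall>x\<in>X - X0. \<xi> x v = 0)" if v: "v \<in> span D" for v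
    proof
      assume "v \<in> U"
      then have "v \<in> span B" using B(4) by blast
      then have rep: "representation C v = representation B v"
        using representation_extend[OF C(3) _ C(1)] by simp
      show "\<forall>x\<in>X - X0. \<xi> x v = 0"
      proof
        fix x assume x: "x \<in> X - X0"
        then have "f x \<notin> B" using inj fX0 sub(2) by (metis DiffD1 DiffD2 inj_on_image_mem_iff)
        then show "\<xi> x v = 0" unfolding \<xi>_def rep using representation_ne_zero by blast
      qed
    next
      assume 0: "\<forall>x\<in>X - X0. \<xi> x v = 0"
      have "v = (\<Sum>x\<in>X. scale (\<xi> x v) (f x))" using v by (rule expand)
      also have "\<dots> = (\<Sum>x\<in>X0. scale (\<xi> x v) (f x))"
        by (rule sum.mono_neutral_right) (use fin sub 0 in auto)
      also have "\<dots> \<in> U"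
        using fX0 B(2) by (intro subspace_sum[OF U(1)] subspace_scale[OF U(1)]) blast
      finally show "v \<in> U" .
    qed
  qed
qed

end

global_interpretation fun_space: vector_space "\<lambda>c (f :: heis_basis \<Rightarrow> 'f::field) b. c * f b"
  by standard (auto simp: fun_eq_iff algebra_simps)

lemma sum_fun_apply: "(\<Sum>b\<in>B. f b) c = (\<Sum>b\<in>B. f b c)" for f :: "'b \<Rightarrow> 'c \<Rightarrow> 'd::comm_monoid_add"
  by (induction B rule: infinite_finite_induct) simp_all

lemma delta_expansion:
  assumes "finite B" "\<And>b. x b \<noteq> 0 \<Longrightarrow> b \<in> B"
  shows "x = (\<Sum>b\<in>B. fscale (x b) (delta b))"
proof
  fix c
  have "(\<Sum>b\<in>B. fscale (x b) (delta b)) c = (\<Sum>b\<in>B. if c = b then x b else 0)"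
    by (auto simp: sum_fun_apply delta_def intro!: sum.cong)
  also have "\<dots> = x c" using assms by (auto simp: sum.delta)
  finally show "x c = (\<Sum>b\<in>B. fscale (x b) (delta b)) c" by simp
qed

lemma inj_delta: "inj (delta :: heis_basis \<Rightarrow> heis_basis \<Rightarrow> 'f::field)"
  by (rule injI) (metis delta_def zero_neq_one)

lemma independent_delta:
  assumes "finite B"
  shows "fun_space.independent ((delta :: heis_basis \<Rightarrow> heis_basis \<Rightarrow> 'f::field) ` B)"
proof (rule fun_space.independent_if_scalars_zero)
  fix f :: "(heis_basis \<Rightarrow> 'f) \<Rightarrow> 'f" and x :: "heis_basis \<Rightarrow> 'f"
  assume s: "(\<Sum>x\<in>delta ` B. fscale (f x) x) = 0" and "x \<in> delta ` B"
  then obtain b where b: "b \<in> B" "x = delta b" by blast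
  have "(\<Sum>x\<in>delta ` B. fscale (f x) x) b = (\<Sum>c\<in>B. f (delta c) * delta c b)"
    by (simp add: sum_fun_apply sum.reindex[OF inj_on_subset[OF inj_delta subset_UNIV]])
  also have "\<dots> = (\<Sum>c\<in>B. if c = b then f (delta c) else 0)"
    by (intro sum.cong) (auto simp: delta_def)
  finally show "f x = 0" using s b assms by (simp add: zero_fun_def)
qed (use assms in simp)

lemma span_delta:
  "fun_space.span ((delta :: heis_basis \<Rightarrow> heis_basis \<Rightarrow> 'f::field) ` {b \<in> heis_index m. par b = a}) = part (heisenberg m) a"
    (is "fun_space.span (delta ` ?B) = ?V")
proof
  have "fun_space.subspace ?V"
    by (auto simp: fun_space.subspace_def part_heis_add part_heis_scale zero_part)
  then show "fun_space.span (delta ` ?B) \<subseteq> ?V"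
    by (intro fun_space.span_minimal) (auto simp: part_heis delta_def split: if_splits)
  show "?V \<subseteq> fun_space.span (delta ` ?B)"
  proof
    fix x :: "heis_basis \<Rightarrow> 'f" assume "x \<in> ?V"
    then have x: "x b \<noteq> 0 \<Longrightarrow> b \<in> ?B" for b by (auto simp: part_heis)
    have "x = (\<Sum>b\<in>?B. fscale (x b) (delta b))" by (rule delta_expansion[OF _ x]) simp_all
    also have "\<dots> \<in> fun_space.span (delta ` ?B)"
      by (intro fun_space.span_sum fun_space.span_scale fun_space.span_base) blast
    finally show "x \<in> fun_space.span (delta ` ?B)" .
  qed
qed

locale graded_heis_ideal =
  fixes m k :: nat and J :: "(heis_basis \<Rightarrow> 'f::field) set"
  assumes ideal: "graded_ideal (heisenberg m) J"
    and dim0: "part_dim (sub_space (heisenberg m) J) 0 = k"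
    and dim1: "part_dim (sub_space (heisenberg m) J) 1 = k + 1"
begin

abbreviation H :: "('f, heis_basis \<Rightarrow> 'f) lie_superalg" where "H \<equiv> heisenberg m"

lemma J_submodule: "J \<subseteq> carrier H" "0 \<in> J" "x \<in> J \<Longrightarrow> y \<in> J \<Longrightarrow> x + y \<in> J" "x \<in> J \<Longrightarrow> fscale c x \<in> J"
proof -
  have s: "submodule class_ring J H" using ideal by (auto simp: graded_ideal_def subspace_def)
  show "J \<subseteq> carrier H" "0 \<in> J" using s by (auto simp: submodule_def)
  show "x \<in> J \<Longrightarrow> y \<in> J \<Longrightarrow> x + y \<in> J" using s by (auto simp: submodule_def)
  show "x \<in> J \<Longrightarrow> fscale c x \<in> J" using s by (auto simp: submodule_def)
qed

lemma subspace_J_part: "fun_space.subspace (J \<inter> part H a)"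
  by (auto simp: fun_space.subspace_def part_heis_add part_heis_scale zero_part J_submodule)

lemma card_basis_J:
  assumes "fun_space.independent B" "finite B" "B \<subseteq> J \<inter> part H a" "J \<inter> part H a \<subseteq> fun_space.span B"
  shows "card B = part_dim (sub_space H J) a"
proof -
  let ?W = "(sub_space H J)\<lparr>carrier := part (sub_space H J) a\<rparr>"
  have c: "carrier ?W = J \<inter> part H a" by (auto simp: sub_space_def)
  have "vectorspace.dim class_ring ?W = card B"
    by (rule fun_space.dim_carrier_eq_card) (use assms subspace_J_part in \<open>simp_all add: c, simp_all add: sub_space_def\<close>)
  then show ?thesis by (simp add: part_dim_def)
qed

lemma J_bracket: "x \<in> carrier H \<Longrightarrow> y \<in> J \<Longrightarrow> fscale (omega m x y) hz \<in> J"
proof -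
  assume "x \<in> carrier H" "y \<in> J"
  then have "lbrak H x y \<in> J" using ideal unfolding graded_ideal_def by blast
  then show ?thesis by simp
qed

text \<open>The odd part of J is not zero. An odd vector either has a nonzero coordinate at some y_j, so that its bracket with x_j is
  a nonzero multiple of z, or it is itself a multiple of z.\<close>

lemma hz_in_J: "hz \<in> J"
proof -
  have "\<exists>y\<in>J \<inter> part H 1. y \<noteq> 0"
  proof (rule ccontr)
    assume "\<not> ?thesis"
    then have "J \<inter> part H 1 \<subseteq> fun_space.span {}" by auto
    then show False using card_basis_J[of "{}" 1] dim1 by (simp add: fun_space.independent_empty)
  qed
  then obtain y where y: "y \<in> J" "y \<in> part H 1" "y \<noteq> 0" by blast
  show ?thesis
  proof (cases "\<exists>j\<in>{1..m}. y (HY j) \<noteq> 0")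
    case True
    then obtain j where j: "j \<in> {1..m}" "y (HY j) \<noteq> 0" by blast
    have "omega m (delta (HX j)) y = y (HY j)"
    proof -
      have "omega m (delta (HX j)) y = (\<Sum>i\<in>{1..m}. if i = j then y (HY i) else 0)"
        unfolding omega_def by (intro sum.cong) (auto simp: delta_def)
      then show ?thesis using j by simp
    qed
    then have "fscale (y (HY j)) hz \<in> J"
      using J_bracket[of "delta (HX j)" y] y(1) part_carrier_heis[OF delta_part(1)[OF j(1)]] by simp
    then have "fscale (1 / y (HY j)) (fscale (y (HY j)) hz) \<in> J" by (rule J_submodule(4))
    then show ?thesis using j(2) by simp
  next
    case False
    have "y b = y HZ * hz b" for b
    proof (cases "b = HZ")
      case False
      have "y b = 0"
      proof (rule ccontr)
        assume "y b \<noteq> 0"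
        then have "b \<in> heis_index m" "par b = 1" using y(2) by (auto simp: part_heis)
        then obtain j where "b = HY j" "j \<in> {1..m}" using \<open>b \<noteq> HZ\<close> by (auto simp: heis_index_def)
        then show False using \<open>y b \<noteq> 0\<close> \<open>\<not> (\<exists>j\<in>{1..m}. y (HY j) \<noteq> 0)\<close> by blast
      qed
      then show ?thesis using False by (simp add: hz_def)
    qed (simp add: hz_def)
    note y_eq = this
    have "y HZ \<noteq> 0"
    proof
      assume "y HZ = 0"
      have "y b = 0" for b by (subst y_eq) (simp add: \<open>y HZ = 0\<close>)
      then show False using y(3) by (simp add: fun_eq_iff)
    qed
    have "fscale (1 / y HZ) y = hz"
    proof
      fix b
      have "1 / y HZ * y b = 1 / y HZ * (y HZ * hz b)" by (subst y_eq) (rule refl)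
      then show "1 / y HZ * y b = hz b" using \<open>y HZ \<noteq> 0\<close> by simp
    qed
    then show ?thesis using J_submodule(4)[OF y(1), of "1 / y HZ"] by simp
  qed
qed

lemma J_components:
  assumes "x \<in> carrier H"
  shows "x \<in> J \<longleftrightarrow> (\<forall>a. (\<lambda>b. if par b = a then x b else 0) \<in> J)"
proof
  assume "x \<in> J"
  then have "x \<in> (J \<inter> part H 0) <+>\<^bsub>H\<^esub> (J \<inter> part H 1)" using ideal unfolding graded_ideal_def by blast
  then obtain x0 x1 where x: "x0 \<in> J" "x1 \<in> J" "x0 \<in> part H 0" "x1 \<in> part H 1" "x = x0 + x1"
    unfolding set_add_def' heis_simps by blast
  have "(\<lambda>b. if par b = 0 then x b else 0) = x0" "(\<lambda>b. if par b = 1 then x b else 0) = x1"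
    using x(3,4) unfolding part_heis x(5) plus_fun_def by (force simp: fun_eq_iff)+
  then have "(\<lambda>b. if par b = 0 then x b else 0) \<in> J" "(\<lambda>b. if par b = 1 then x b else 0) \<in> J" using x(1,2) by simp_all
  then show "\<forall>a. (\<lambda>b. if par b = a then x b else 0) \<in> J" by (metis bit_not_zero_iff)
next
  assume *: "\<forall>a. (\<lambda>b. if par b = a then x b else 0) \<in> J"
  have "x = (\<lambda>b. if par b = 0 then x b else 0) + (\<lambda>b. if par b = 1 then x b else 0)"
    by (auto simp: fun_eq_iff)
  then show "x \<in> J" using * J_submodule(3) by metis
qed

text \<open>The even and the odd part have separate bases. In the odd one z is prescribed, which is in J.\<close>

lemma exists_coords:
  assumes two: "(2::'f) \<noteq> 0" and m: "m \<ge> 1"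
  shows "\<exists>e \<xi>. heis_coords m J k e \<xi>"
proof -
  let ?Ix = "\<lambda>a. {b \<in> heis_index m. par b = a}"
  let ?Del = "\<lambda>a. (delta :: heis_basis \<Rightarrow> heis_basis \<Rightarrow> 'f) ` ?Ix a"
  have D: "fun_space.independent (?Del a)" "finite (?Del a)" "card (?Del a) = card (?Ix a)" for a
    using inj_delta by (auto intro!: independent_delta card_image inj_on_subset[OF inj_delta])
  have X0: "?Ix 0 = HX ` {1..m}" and X1: "?Ix 1 = HY ` {1..m} \<union> {HZ}" by (auto simp: heis_index_def)
  have J_span: "J \<inter> part H a \<subseteq> fun_space.span (?Del a)" for a unfolding span_delta by blast
  have "k \<le> m"
  proof -
    obtain B where B: "B \<subseteq> J \<inter> part H 0" "fun_space.independent B" "J \<inter> part H 0 \<subseteq> fun_space.span B"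
      using fun_space.maximal_independent_subset[of "J \<inter> part H 0"] by blast
    have "finite B \<and> card B \<le> card (?Del 0)"
      using B(1) J_span by (intro fun_space.independent_span_bound[OF D(2) B(2)]) blast
    moreover have "card (?Del 0) = card (?Ix 0)" by (rule D(3))
    moreover have "card (?Ix 0) = m" unfolding X0 by (simp add: card_image inj_on_def)
    ultimately show ?thesis using card_basis_J[OF B(2) _ B(1,3)] dim0 by simp
  qed
  have hz0: "hz \<noteq> (0 :: heis_basis \<Rightarrow> 'f)" by (auto simp: hz_def fun_eq_iff)
  let ?Ka = "HX ` {1..k}" and ?Kb = "HY ` {1..k} \<union> {HZ}"
  obtain f0 \<xi>0 where c0:
    "\<And>x. x \<in> ?Ix 0 \<Longrightarrow> f0 x \<in> fun_space.span (?Del 0)"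
    "\<And>x v w. x \<in> ?Ix 0 \<Longrightarrow> v \<in> fun_space.span (?Del 0) \<Longrightarrow> w \<in> fun_space.span (?Del 0) \<Longrightarrow> \<xi>0 x (v + w) = \<xi>0 x v + \<xi>0 x w"
    "\<And>x c v. x \<in> ?Ix 0 \<Longrightarrow> v \<in> fun_space.span (?Del 0) \<Longrightarrow> \<xi>0 x (fscale c v) = c * \<xi>0 x v"
    "\<And>x y. x \<in> ?Ix 0 \<Longrightarrow> y \<in> ?Ix 0 \<Longrightarrow> \<xi>0 x (f0 y) = (if x = y then 1 else 0)"
    "\<And>v. v \<in> fun_space.span (?Del 0) \<Longrightarrow> v = (\<Sum>x\<in>?Ix 0. fscale (\<xi>0 x v) (f0 x))"
    "\<And>v. v \<in> fun_space.span (?Del 0) \<Longrightarrow> v \<in> J \<inter> part H 0 \<longleftrightarrow> (\<forall>x\<in>?Ix 0 - ?Ka. \<xi>0 x v = 0)"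
  proof (rule fun_space.adapted_basis[of "?Ix 0" "{}" ?Ka "?Del 0" "J \<inter> part H 0" "\<lambda>_. 0"])
    show "?Ka \<subseteq> ?Ix 0" using \<open>k \<le> m\<close> by (auto simp: heis_index_def)
    show "card B = card ?Ka" if "fun_space.independent B" "finite B" "B \<subseteq> J \<inter> part H 0" "J \<inter> part H 0 \<subseteq> fun_space.span B" for B
      using card_basis_J[OF that] dim0 by (simp add: card_image inj_on_def)
  qed (use D subspace_J_part J_span fun_space.independent_empty in auto)
  obtain f1 \<xi>1 where c1:
    "\<And>x. x \<in> {HZ} \<Longrightarrow> f1 x = hz"
    "\<And>x. x \<in> ?Ix 1 \<Longrightarrow> f1 x \<in> fun_space.span (?Del 1)"
    "\<And>x v w. x \<in> ?Ix 1 \<Longrightarrow> v \<in> fun_space.span (?Del 1) \<Longrightarrow> w \<in> fun_space.span (?Del 1) \<Longrightarrow> \<xi>1 x (v + w) = \<xi>1 x v + \<xi>1 x w"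
    "\<And>x c v. x \<in> ?Ix 1 \<Longrightarrow> v \<in> fun_space.span (?Del 1) \<Longrightarrow> \<xi>1 x (fscale c v) = c * \<xi>1 x v"
    "\<And>x y. x \<in> ?Ix 1 \<Longrightarrow> y \<in> ?Ix 1 \<Longrightarrow> \<xi>1 x (f1 y) = (if x = y then 1 else 0)"
    "\<And>v. v \<in> fun_space.span (?Del 1) \<Longrightarrow> v = (\<Sum>x\<in>?Ix 1. fscale (\<xi>1 x v) (f1 x))"
    "\<And>v. v \<in> fun_space.span (?Del 1) \<Longrightarrow> v \<in> J \<inter> part H 1 \<longleftrightarrow> (\<forall>x\<in>?Ix 1 - ?Kb. \<xi>1 x v = 0)"
  proof (rule fun_space.adapted_basis[of "?Ix 1" "{HZ}" ?Kb "?Del 1" "J \<inter> part H 1" "\<lambda>_. hz"])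
    show "?Kb \<subseteq> ?Ix 1" using \<open>k \<le> m\<close> by (auto simp: heis_index_def)
    show "card B = card ?Kb" if "fun_space.independent B" "finite B" "B \<subseteq> J \<inter> part H 1" "J \<inter> part H 1 \<subseteq> fun_space.span B" for B
    proof -
      have "card ?Kb = k + 1" by (subst card_Un_disjoint) (auto simp: card_image inj_on_def)
      then show ?thesis using card_basis_J[OF that] dim1 by simp
    qed
    show "fun_space.independent ((\<lambda>_. hz :: heis_basis \<Rightarrow> 'f) ` {HZ})"
      using hz0 fun_space.dependent_single[of hz] by simp
  qed (use D subspace_J_part J_span hz_in_J hz_part in auto)
  define pt where "pt a x = (\<lambda>b. if par b = a then x b else 0)" for a and x :: "heis_basis \<Rightarrow> 'f"
  define e where "e b = (if par b = 0 then f0 b else f1 b)" for b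
  define \<xi> where "\<xi> b x = (if par b = 0 then \<xi>0 b (pt 0 x) else \<xi>1 b (pt 1 x))" for b x
  have pt: "pt a x \<in> part H a" if "x \<in> carrier H" for a x
    using that by (auto simp: pt_def part_heis carrier_heis)
  have pt_same: "pt a x = x" if "x \<in> part H a" for a x
    using that by (auto simp: pt_def part_heis fun_eq_iff)
  have pt_other: "pt a x = 0" if "x \<in> part H b" "b \<noteq> a" for a b x
    using that by (auto simp: pt_def part_heis fun_eq_iff)
  have pt_add: "pt a (x + y) = pt a x + pt a y" and pt_scale: "pt a (fscale c x) = fscale c (pt a x)" for a c x y
    by (auto simp: pt_def fun_eq_iff)
  have pt_sum: "x = pt 0 x + pt 1 x" for x by (auto simp: pt_def fun_eq_iff)
  have \<xi>_0: "\<xi>0 b 0 = 0" if "b \<in> ?Ix 0" for b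
    using c0(3)[of b 0 0] that fun_space.span_zero[of "?Del 0"] by (simp add: zero_fun_def)
  have \<xi>_1: "\<xi>1 b 0 = 0" if "b \<in> ?Ix 1" for b
    using c1(4)[of b 0 0] that fun_space.span_zero[of "?Del 1"] by (simp add: zero_fun_def)
  note c0 = c0[unfolded span_delta] and c1 = c1[unfolded span_delta]
  have par1: "par b = 1" if "par b \<noteq> 0" for b using that by simp
  have e_part: "e b \<in> part H (par b)" if "b \<in> heis_index m" for b
    using that c0(1)[of b] c1(2)[of b] par1[of b] by (cases "par b = 0") (auto simp: e_def)
  have "heis_coords m J k e \<xi>"
  proof
    show "J \<subseteq> carrier H" "0 \<in> J" "hz \<in> J" by (fact J_submodule hz_in_J)+
    show "x + y \<in> J" if "x \<in> J" "y \<in> J" for x y using J_submodule(3) that .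
    show "fscale c x \<in> J" if "x \<in> J" for c x using J_submodule(4) that .
    show "(2::'f) \<noteq> 0" "1 \<le> m" "k \<le> m" by fact+
    show "e b \<in> part H (par b)" if "b \<in> heis_index m" for b using that by (rule e_part)
    show "e HZ = hz" using c1(1) by (simp add: e_def)
    show "\<xi> b (x + y) = \<xi> b x + \<xi> b y" if "b \<in> heis_index m" "x \<in> carrier H" "y \<in> carrier H" for b x y
      using that c0(2)[of b "pt 0 x" "pt 0 y"] c1(3)[of b "pt 1 x" "pt 1 y"] pt par1[of b]
      by (cases "par b = 0") (auto simp: \<xi>_def pt_add)
    show "\<xi> b (fscale c x) = c * \<xi> b x" if "b \<in> heis_index m" "x \<in> carrier H" for b c x
      using that c0(3)[of b "pt 0 x" c] c1(4)[of b "pt 1 x" c] pt par1[of b]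
      by (cases "par b = 0") (auto simp: \<xi>_def pt_scale)
    show parity: "\<xi> b x = 0" if "b \<in> heis_index m" "x \<in> part H a" "par b \<noteq> a" for b x a
      using that pt_other[OF that(2)] \<xi>_0[of b] \<xi>_1[of b] par1[of b]
      by (cases "par b = 0") (auto simp: \<xi>_def)
    show "\<xi> b (e b') = (if b = b' then 1 else 0)" if b: "b \<in> heis_index m" "b' \<in> heis_index m" for b b'
    proof (cases "par b = par b'")
      case True
      then show ?thesis
        using b c0(4)[of b b'] c1(5)[of b b'] e_part[OF b(2)] pt_same[OF e_part[OF b(2)]] par1[of b]
        by (cases "par b = 0") (auto simp: \<xi>_def e_def)
    next
      case False
      then show ?thesis using parity[OF b(1) e_part[OF b(2)]] by auto
    qed
    show "x = (\<Sum>b\<in>heis_index m. fscale (\<xi> b x) (e b))" if x: "x \<in> carrier H" for x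
    proof -
      have "(\<Sum>b\<in>heis_index m. fscale (\<xi> b x) (e b)) = (\<Sum>b\<in>?Ix 0. fscale (\<xi> b x) (e b)) + (\<Sum>b\<in>?Ix 1. fscale (\<xi> b x) (e b))"
      proof -
        have "(\<Sum>b\<in>?Ix 0 \<union> ?Ix 1. fscale (\<xi> b x) (e b)) =
            (\<Sum>b\<in>?Ix 0. fscale (\<xi> b x) (e b)) + (\<Sum>b\<in>?Ix 1. fscale (\<xi> b x) (e b))"
          by (rule sum.union_disjoint) auto
        moreover have "?Ix 0 \<union> ?Ix 1 = heis_index m" by auto
        ultimately show ?thesis by (simp only:)
      qed
      also have "(\<Sum>b\<in>?Ix 0. fscale (\<xi> b x) (e b)) = (\<Sum>b\<in>?Ix 0. fscale (\<xi>0 b (pt 0 x)) (f0 b))"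
        by (intro sum.cong) (auto simp: \<xi>_def e_def)
      also have "\<dots> = pt 0 x" using c0(5)[OF pt[OF x]] by simp
      also have "(\<Sum>b\<in>?Ix 1. fscale (\<xi> b x) (e b)) = (\<Sum>b\<in>?Ix 1. fscale (\<xi>1 b (pt 1 x)) (f1 b))"
        by (intro sum.cong) (auto simp: \<xi>_def e_def)
      also have "\<dots> = pt 1 x" using c1(6)[OF pt[OF x]] by simp
      finally show ?thesis using pt_sum[of x] by simp
    qed
    show "x \<in> J \<longleftrightarrow> (\<forall>b\<in>heis_index m - (HX ` {1..k} \<union> HY ` {1..k} \<union> {HZ}). \<xi> b x = 0)"
      if x: "x \<in> carrier H" for x
    proof -
      have "x \<in> J \<longleftrightarrow> pt 0 x \<in> J \<and> pt 1 x \<in> J"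
        unfolding J_components[OF x] pt_def[symmetric] by (metis bit_not_zero_iff)
      also have "\<dots> \<longleftrightarrow> (\<forall>b\<in>?Ix 0 - ?Ka. \<xi>0 b (pt 0 x) = 0) \<and> (\<forall>b\<in>?Ix 1 - ?Kb. \<xi>1 b (pt 1 x) = 0)"
        using c0(6)[OF pt[OF x]] c1(7)[OF pt[OF x]] pt[OF x] by blast
      also have "\<dots> \<longleftrightarrow> (\<forall>b\<in>?Ix 0 - ?Ka. \<xi> b x = 0) \<and> (\<forall>b\<in>?Ix 1 - ?Kb. \<xi> b x = 0)"
        by (simp add: \<xi>_def)
      also have "\<dots> \<longleftrightarrow> (\<forall>b\<in>(?Ix 0 - ?Ka) \<union> (?Ix 1 - ?Kb). \<xi> b x = 0)" by blast
      also have "(?Ix 0 - ?Ka) \<union> (?Ix 1 - ?Kb) = heis_index m - (HX ` {1..k} \<union> HY ` {1..k} \<union> {HZ})"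
        unfolding X0 X1 heis_index_def by auto
      finally show ?thesis .
    qed
  qed
  then show ?thesis by blast
qed

end

theorem theorem6p15:
  fixes m k :: nat
    and J :: "(heis_basis \<Rightarrow> 'f::field) set"
    and M :: "('f, 'w) lie_superalg"
  assumes "CHAR('f) \<noteq> 2" and "CHAR('f) \<noteq> 3"
    and "m \<ge> 1"
    and "graded_ideal (heisenberg m) J"
    and "finite_dim (sub_space (heisenberg m) J)"
    and "part_dim (sub_space (heisenberg m) J) 0 = k"
    and "part_dim (sub_space (heisenberg m) J) 1 = k + 1"
    and "is_pair_multiplier (heisenberg m) J M"
  shows "finite_dim M \<and>
    (k = 1 \<and> m = 1 \<longrightarrow> total_dim M = 1 \<or> total_dim M = 2) \<and>
    (k = 0 \<longrightarrow> total_dim M = 2 * m) \<and>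
    (k \<ge> 1 \<and> \<not> (k = 1 \<and> m = 1) \<longrightarrow>
      real (part_dim M 0) =
        1 / 2 * real k * ((2 * real m - real k - 1) + (2 * real m - real k + 1)) \<and>
      real (part_dim M 1) = (real m)\<^sup>2 - (real m - real k)\<^sup>2 - 1)"
proof -
  have two: "(2::'f) \<noteq> 0"
  proof
    assume "(2::'f) = 0"
    then have "of_nat 2 = (0::'f)" by simp
    then have dvd: "CHAR('f) dvd 2" by (simp only: of_nat_eq_0_iff_char_dvd)
    then have "CHAR('f) \<le> 2" by (rule dvd_imp_le) simp
    moreover have "CHAR('f) \<noteq> 0" using dvd by (metis dvd_0_left_iff zero_neq_numeral)
    ultimately show False using assms(1) CHAR_not_1[where 'a = 'f] by linarith
  qed
  interpret ideal: graded_heis_ideal m k J using assms(4,6,7) by unfold_locales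
  obtain e \<xi> where coords: "heis_coords m J k e \<xi>" using ideal.exists_coords[OF two assms(3)] by blast
  have M: "super_vectorspace M"
    using assms(8) by (simp add: is_pair_multiplier_def lie_superalgebra_def)
  obtain \<alpha> \<beta> where
    "even_linear (homology (quot_lie (heisenberg m) J) 3) M \<alpha>"
    "even_linear M (homology (heisenberg m) 2) \<beta>"
    "exact_at (homology (heisenberg m) 3)
      (homology_map (quot_lie (heisenberg m) J) 3 (\<lambda>x. J +>\<^bsub>heisenberg m\<^esub> x)) (homology (quot_lie (heisenberg m) J) 3) \<alpha> M"
    "exact_at (homology (quot_lie (heisenberg m) J) 3) \<alpha> M \<beta> (homology (heisenberg m) 2)"
    "exact_at M \<beta> (homology (heisenberg m) 2)
      (homology_map (quot_lie (heisenberg m) J) 2 (\<lambda>x. J +>\<^bsub>heisenberg m\<^esub> x)) (homology (quot_lie (heisenberg m) J) 2)"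
    using assms(8) unfolding is_pair_multiplier_def Let_def schur_multiplier_def by blast
  then interpret heis_pair_multiplier m J k e \<xi> M \<alpha> \<beta>
    using coords M by (intro heis_pair_multiplier.intro heis_pair_multiplier_axioms.intro)
  show ?thesis
  proof (cases "k = 0")
    case True
    then show ?thesis using dims_k_zero by simp
  next
    case False
    then have k: "k \<ge> 1" by simp
    note dims = dims_k_pos[OF k]
    have total: "total_dim M = 2" if "k = 1" "m = 1"
    proof -
      have "card even_pairs = 1" using card_even_pairs that by simp
      moreover have "card odd_pairs = 1" using card_odd_pairs that by simp
      moreover have "card exceptional = 1" unfolding exceptional_def using that by simp
      ultimately show ?thesis using dims(2) by simp
    qed
    have even: "real (part_dim M 0) = 1 / 2 * real k * ((2 * real m - real k - 1) + (2 * real m - real k + 1))"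
    proof -
      have "real (card even_pairs) + real k * real k = 2 * real m * real k"
        using arg_cong[OF card_even_pairs, of real] by simp
      then show ?thesis unfolding dims(3) by (simp add: field_simps)
    qed
    have odd: "real (part_dim M 1) = (real m)\<^sup>2 - (real m - real k)\<^sup>2 - 1" if "\<not> (k = 1 \<and> m = 1)"
    proof -
      have "m \<noteq> 1" using that k k_le by auto
      then have "card exceptional = 0" by (simp add: exceptional_def)
      moreover have "real (card odd_pairs) + (real m - real k) * (real m - real k) = real m * real m"
        using arg_cong[OF card_odd_pairs, of real] k_le by (simp add: of_nat_diff)
      ultimately show ?thesis unfolding dims(4) using dims(5) by (simp add: of_nat_diff power2_eq_square)
    qed
    show ?thesis using dims(1) total even odd k by auto
  qed
qed

end
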